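(* Let $d\ge2$, let $\rho\in\mathcal D(\mathbb C^d\otimes\mathbb C^d)$ be a distillable state (that is, $E_d(\rho)>0$), and let $0<R<E_d(\rho)$. Then there exist a radius $r>0$ and a sequence of LOCC channels $\Lambda_n^{(\rho,R)}$, mapping $n$ copies of $\mathbb C^d\otimes\mathbb C^d$ to $\lceil Rn\rceil$ shared qubit pairs, such that $$\lim_{n\to\infty}\ \sup_{\sigma\in B_r(\rho)}\ \tfrac12\Big\|\Lambda_n^{(\rho,R)}(\sigma^{\otimes n})-\Phi_2^{\otimes\lceil Rn\rceil}\Big\|_1=0 .$$
   Context: $\mathcal D(\mathcal H)$ is the set of density operators on $\mathcal H$. $\|X\|_1=\mathrm{Tr}\sqrt{X^\dagger X}$, and $B_r(\rho)=\{\sigma\in\mathcal D(\mathbb C^d\otimes\mathbb C^d):\frac12\|\sigma-\rho\|_1<r\}$. Bipartite systems are shared between Alice (first factor) and Bob (second factor). An LOCC channel is a quantum channel between bipartite systems implementable by local quantum operations of Alice and Bob and classical communication between them (in the usual sense: rounds of local instruments, each allowed to depend on previously communicated outcomes). The ebit is $\Phi_2=|\Phi_2\rangle\!\langle\Phi_2|$ with $|\Phi_2\rangle=(|00\rangle+|11\rangle)/\sqrt2$, one qubit per party. The distillable entanglement $E_d(\rho)$ of a bipartite state $\rho$ is the supremum of all rates $R\ge0$ for which there exists a sequence of LOCC channels $\Lambda_n$ (allowed to depend on $\rho$), mapping $n$ copies of the system to $\lceil Rn\rceil$ shared qubit pairs, with $\lim_{n\to\infty}\frac12\|\Lambda_n(\rho^{\otimes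 n})-\Phi_2^{\otimes\lceil Rn\rceil}\|_1=0$. *)

theory Defs
  imports
    "HOL-Analysis.Analysis"
    "Jordan_Normal_Form.Schur_Decomposition"
begin

text \<open>
  Operators on \<open>\<complex>\<^sup>n\<close> are complex \<open>n \<times> n\<close> matrices. In a bipartite space
  \<open>\<complex>\<^sup>a \<otimes> \<complex>\<^sup>b\<close> (Alice first, Bob second) the basis vector \<open>|i\<rangle>|j\<rangle>\<close> has index \<open>i * b + j\<close>,
  so that operators on it are matrices of size \<open>a * b\<close>.
\<close>

subsection \<open>Positive operators, trace norm, states\<close>

definition mat_trace :: "complex mat \<Rightarrow> complex" where
  "mat_trace A = (\<Sum>i<dim_row A. A $$ (i, i))"

text \<open>The order on \<open>complex\<close> is the one of \<^theory>\<open>HOL-Library.Complex_Order\<close>: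
  \<open>0 \<le> z\<close> means that \<open>z\<close> is real and nonnegative.\<close>

definition psd :: "nat \<Rightarrow> complex mat \<Rightarrow> bool" where
  "psd n A \<longleftrightarrow> A \<in> carrier_mat n n \<and> (\<forall>v \<in> carrier_vec n. 0 \<le> (A *\<^sub>v v) \<bullet>c v)"

definition psd_sqrt :: "complex mat \<Rightarrow> complex mat" where
  "psd_sqrt A = (THE B. psd (dim_row A) B \<and> B * B = A)"

definition trace_norm :: "complex mat \<Rightarrow> real" where
  "trace_norm X = Re (mat_trace (psd_sqrt (mat_adjoint X * X)))"

definition density_ops :: "nat \<Rightarrow> complex mat set" where
  "density_ops n = {\<rho>. psd n \<rho> \<and> mat_trace \<rho> = 1}"

definition state_ball :: "nat \<Rightarrow> real \<Rightarrow> complex mat \<Rightarrow> complex mat set" where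
  "state_ball d r \<rho> = {\<sigma> \<in> density_ops (d * d). 1/2 * trace_norm (\<sigma> - \<rho>) < r}"

subsection \<open>Tensor powers of bipartite operators\<close>

text \<open>
  For \<open>X\<close> on \<open>\<complex>\<^sup>a \<otimes> \<complex>\<^sup>b\<close> and \<open>Y\<close> on \<open>\<complex>\<^sup>a\<^sup>' \<otimes> \<complex>\<^sup>b\<^sup>'\<close>, the operator \<open>X \<otimes> Y\<close> regrouped as an operator
  on \<open>(\<complex>\<^sup>a \<otimes> \<complex>\<^sup>a\<^sup>') \<otimes> (\<complex>\<^sup>b \<otimes> \<complex>\<^sup>b\<^sup>')\<close>. The functions \<open>l\<close> and \<open>r\<close> send the index of
  \<open>|i i'\<rangle>|j j'\<rangle>\<close> to the indices of \<open>|i\<rangle>|j\<rangle>\<close> and \<open>|i'\<rangle>|j'\<rangle>\<close>.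
\<close>

definition bip_tensor ::
  "nat \<Rightarrow> nat \<Rightarrow> nat \<Rightarrow> nat \<Rightarrow> complex mat \<Rightarrow> complex mat \<Rightarrow> complex mat" where
  "bip_tensor a b a' b' X Y =
    (let N = (a * a') * (b * b');
         l = (\<lambda>i. (i div (b * b') div a') * b + i mod (b * b') div b');
         r = (\<lambda>i. (i div (b * b') mod a') * b' + i mod (b * b') mod b')
     in mat N N (\<lambda>(i, j). X $$ (l i, l j) * Y $$ (r i, r j)))"

text \<open>\<open>X\<^sup>\<otimes>\<^sup>n\<close> on \<open>(\<complex>\<^sup>a)\<^sup>\<otimes>\<^sup>n \<otimes> (\<complex>\<^sup>b)\<^sup>\<otimes>\<^sup>n\<close>, all of Alice's factors preceding all of Bob's.\<close>

primrec bip_power :: "nat \<Rightarrow> nat \<Rightarrow> complex mat \<Rightarrow> nat \<Rightarrow> complex mat" where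
  "bip_power a b X 0 = 1\<^sub>m 1"
| "bip_power a b X (Suc n) = bip_tensor (a ^ n) (b ^ n) a b (bip_power a b X n) X"

text \<open>With two qubits, \<open>|00\<rangle>\<close> and \<open>|11\<rangle>\<close> have indices 0 and 3.\<close>

definition ebit_vec :: "complex vec" where
  "ebit_vec = complex_of_real (1 / sqrt 2) \<cdot>\<^sub>v (unit_vec 4 0 + unit_vec 4 3)"

definition ebit :: "complex mat" where
  "ebit = mat 4 4 (\<lambda>(i, j). ebit_vec $ i * cnj (ebit_vec $ j))"

subsection \<open>Local operations\<close>

definition linear_map :: "nat \<Rightarrow> nat \<Rightarrow> (complex mat \<Rightarrow> complex mat) \<Rightarrow> bool" where
  "linear_map n m \<Phi> \<longleftrightarrow>
    (\<forall>X \<in> carrier_mat n n. \<Phi> X \<in> carrier_mat m m) \<and>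
    (\<forall>X \<in> carrier_mat n n. \<forall>Y \<in> carrier_mat n n. \<Phi> (X + Y) = \<Phi> X + \<Phi> Y) \<and>
    (\<forall>X \<in> carrier_mat n n. \<forall>c. \<Phi> (c \<cdot>\<^sub>m X) = c \<cdot>\<^sub>m \<Phi> X)"

text \<open>
  For \<open>\<Phi>\<close> from operators on \<open>\<complex>\<^sup>n\<close> to operators on \<open>\<complex>\<^sup>m\<close>: \<open>\<Phi> \<otimes> id\<close> on \<open>\<complex>\<^sup>n \<otimes> \<complex>\<^sup>k\<close> and
  \<open>id \<otimes> \<Phi>\<close> on \<open>\<complex>\<^sup>k \<otimes> \<complex>\<^sup>n\<close>, obtained by applying \<open>\<Phi>\<close> to every block.
\<close>

definition on_left ::
  "nat \<Rightarrow> nat \<Rightarrow> nat \<Rightarrow> (complex mat \<Rightarrow> complex mat) \<Rightarrow> complex mat \<Rightarrow> complex mat" where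
  "on_left n m k \<Phi> X = mat (m * k) (m * k) (\<lambda>(i, j).
     \<Phi> (mat n n (\<lambda>(p, q). X $$ (p * k + i mod k, q * k + j mod k))) $$ (i div k, j div k))"

definition on_right ::
  "nat \<Rightarrow> nat \<Rightarrow> nat \<Rightarrow> (complex mat \<Rightarrow> complex mat) \<Rightarrow> complex mat \<Rightarrow> complex mat" where
  "on_right n m k \<Phi> X = mat (k * m) (k * m) (\<lambda>(i, j).
     \<Phi> (mat n n (\<lambda>(p, q). X $$ ((i div m) * n + p, (j div m) * n + q))) $$ (i mod m, j mod m))"

definition completely_positive :: "nat \<Rightarrow> nat \<Rightarrow> (complex mat \<Rightarrow> complex mat) \<Rightarrow> bool" where
  "completely_positive n m \<Phi> \<longleftrightarrow>
    linear_map n m \<Phi> \<and> (\<forall>k X. psd (n * k) X \<longrightarrow> psd (m * k) (on_left n m k \<Phi> X))"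

text \<open>A quantum instrument with outcomes \<open>x < q\<close>.\<close>

definition instrument :: "nat \<Rightarrow> nat \<Rightarrow> nat \<Rightarrow> (nat \<Rightarrow> complex mat \<Rightarrow> complex mat) \<Rightarrow> bool" where
  "instrument n m q I \<longleftrightarrow>
    (\<forall>x<q. completely_positive n m (I x)) \<and>
    (\<forall>X \<in> carrier_mat n n. (\<Sum>x<q. mat_trace (I x X)) = mat_trace X)"

subsection \<open>LOCC channels\<close>

definition mat_sum :: "nat \<Rightarrow> nat \<Rightarrow> (nat \<Rightarrow> complex mat) \<Rightarrow> complex mat" where
  "mat_sum n q F = mat n n (\<lambda>(i, j). \<Sum>x<q. F x $$ (i, j))"

text \<open>
  \<open>locc a b a' b' \<Lambda>\<close>: the map \<open>\<Lambda>\<close>, from operators on \<open>\<complex>\<^sup>a \<otimes> \<complex>\<^sup>b\<close> to operators on \<open>\<complex>\<^sup>a\<^sup>' \<otimes> \<complex>\<^sup>b\<^sup>'\<close>,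
  is implemented by a protocol of finitely many rounds. In each round one party applies an
  instrument to its system and announces the outcome \<open>x\<close>; \<open>F x\<close> is the remainder of the protocol
  given this outcome, so every later instrument may depend on all previous outcomes.
\<close>

inductive locc :: "nat \<Rightarrow> nat \<Rightarrow> nat \<Rightarrow> nat \<Rightarrow> (complex mat \<Rightarrow> complex mat) \<Rightarrow> bool" where
  finish: "locc a b a b (\<lambda>X. X)"
| alice: "\<lbrakk>instrument a m q I; \<And>x. x < q \<Longrightarrow> locc m b a' b' (F x)\<rbrakk> \<Longrightarrow>
    locc a b a' b' (\<lambda>X. mat_sum (a' * b') q (\<lambda>x. F x (on_left a m b (I x) X)))"
| bob: "\<lbrakk>instrument b m q I; \<And>x. x < q \<Longrightarrow> locc a m a' b' (F x)\<rbrakk> \<Longrightarrow>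
    locc a b a' b' (\<lambda>X. mat_sum (a' * b') q (\<lambda>x. F x (on_right b m a (I x) X)))"

subsection \<open>Entanglement distillation\<close>

definition num_pairs :: "real \<Rightarrow> nat \<Rightarrow> nat" where
  "num_pairs R n = nat \<lceil>R * real n\<rceil>"

definition distill_error ::
  "nat \<Rightarrow> real \<Rightarrow> nat \<Rightarrow> (complex mat \<Rightarrow> complex mat) \<Rightarrow> complex mat \<Rightarrow> real" where
  "distill_error d R n \<Lambda> \<sigma> =
    1/2 * trace_norm (\<Lambda> (bip_power d d \<sigma> n) - bip_power 2 2 ebit (num_pairs R n))"

definition locc_sequence :: "nat \<Rightarrow> real \<Rightarrow> (nat \<Rightarrow> complex mat \<Rightarrow> complex mat) \<Rightarrow> bool" where
  "locc_sequence d R \<Lambda> \<longleftrightarrow>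
    (\<forall>n. locc (d ^ n) (d ^ n) (2 ^ num_pairs R n) (2 ^ num_pairs R n) (\<Lambda> n))"

definition achievable_rate :: "nat \<Rightarrow> complex mat \<Rightarrow> real \<Rightarrow> bool" where
  "achievable_rate d \<rho> R \<longleftrightarrow>
    R \<ge> 0 \<and>
    (\<exists>\<Lambda>. locc_sequence d R \<Lambda> \<and> (\<lambda>n. distill_error d R n (\<Lambda> n) \<rho>) \<longlonglongrightarrow> 0)"

definition distillable_entanglement :: "nat \<Rightarrow> complex mat \<Rightarrow> ereal" where
  "distillable_entanglement d \<rho> = (SUP R \<in> {R. achievable_rate d \<rho> R}. ereal R)"

end

theory Submission
  imports Defs
begin

text \<open>
  For one fixed large \<open>k\<close>, a protocol that distills \<open>\<rho>\<close> at a rate \<open>R1 > R\<close> turns \<open>\<rho>\<^sup>\<otimes>\<^sup>k\<close> into a state close to \<open>K \<ge> R1 k\<close>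
  ebits. By continuity it does the same, up to a fixed small infidelity, for every \<open>\<sigma>\<close> in a ball around \<open>\<rho>\<close>.
  Applied to \<open>m\<close> groups of \<open>k\<close> copies it leaves \<open>m\<close> blocks of noisy ebits, on which a universal protocol corrects
  all Pauli errors that affect at most \<open>m / g\<close> blocks. There are at most \<open>2\<^sup>m 4\<^bsup>K m / g\<^esup>\<close> of these. The parties
  adaptively compare parities, or signs under a translation, that separate at least a quarter of the pairs of errors
  not yet told apart, and each comparison costs one ebit; so \<open>O(m + K m / g)\<close> ebits suffice, a small fraction of
  \<open>K m\<close>. Errors on more blocks have exponentially small probability by a Chernoff bound, uniformly in \<open>\<sigma>\<close>.

  The infidelity is linear in the state. A vector in the span of the correctable errors is mapped exactly to ebits,
  so the infidelity is bounded by the squared distance from this span, and neither a twirl nor a gentle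
  measurement is needed.
\<close>

section \<open>The spectral theorem and the trace norm\<close>

text \<open>For growing \<open>n\<close> the powers of two different states become almost perfectly
  distinguishable, so continuity can be used only for a fixed number \<open>k\<close> of copies. The
  stage after that must not depend on \<sigma>, which is why it corrects all errors on few blocks
  instead of the typical errors of some distribution. The constants: block infidelity at most 4^-g
  makes errors on more than m/g blocks unlikely, because weighting every faulty block with 4^g gives
  a total of at most 2 per block, against at least 4^m for one such error. A comparison leaves at
  most 3/4 of the pairs of errors and (3/4)^3 < 1/2, so three ebits are paid per bit of the number
  of pairs, which is at most 2^(2m + 4Km/g). The loss is thus about the fraction 6/K + 12/g of the K
  m ebits. Hence g is determined by the gap between R and R1 alone; only afterwards k is chosen,
  large enough both for K and for the infidelity 4^-g. This order avoids a circle between the block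
  size and the accuracy demanded of a block.\<close>

lemma index_mult_mat_sum:
  assumes "A \<in> carrier_mat n m" "B \<in> carrier_mat m p" "i < n" "j < p"
  shows "(A * B) $$ (i, j) = (\<Sum>k<m. A $$ (i, k) * B $$ (k, j))"
  using assms by (auto simp: scalar_prod_def atLeast0LessThan)

lemma mat_trace_mult_comm:
  assumes A: "A \<in> carrier_mat n m" and B: "B \<in> carrier_mat m n"
  shows "mat_trace (A * B) = mat_trace (B * A)"
proof -
  have "mat_trace (A * B) = (\<Sum>i<n. \<Sum>k<m. A $$ (i, k) * B $$ (k, i))"
    using A by (simp add: mat_trace_def index_mult_mat_sum[OF A B])
  also have "\<dots> = (\<Sum>k<m. \<Sum>i<n. B $$ (k, i) * A $$ (i, k))"
    by (subst sum.swap) (simp add: mult.commute)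
  also have "\<dots> = mat_trace (B * A)"
    using B by (simp add: mat_trace_def index_mult_mat_sum[OF B A])
  finally show ?thesis .
qed

text \<open>Schur form: the trace survives the similarity, and the diagonal of the triangular matrix
  consists of roots of the characteristic polynomial. It serves to produce an eigenvalue different
  from a given \<open>\<mu>\<close> when the trace is not \<open>n * \<mu>\<close>.\<close>

lemma trace_eigenvalues:
  fixes A :: "complex mat"
  assumes A: "A \<in> carrier_mat n n"
  obtains e where "mat_trace A = (\<Sum>i<n. e i)" "\<And>i. i < n \<Longrightarrow> eigenvalue A (e i)"
proof -
  obtain es where "char_poly A = (\<Prod>a\<leftarrow>es. [:- a, 1:])"
    using char_poly_factorized[OF A] by auto
  from schur_decomposition_exists[OF A this] obtain B where B: "B \<in> carrier_mat n n"
    and ut: "upper_triangular B" and sim: "similar_mat A B" by auto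
  from sim obtain P Q where PQ: "similar_mat_wit A B P Q" unfolding similar_mat_def by auto
  note w = similar_mat_witD2[OF A PQ]
  have "mat_trace A = mat_trace (P * (B * Q))"
    using w by (metis assoc_mult_mat)
  also have "\<dots> = mat_trace (B * Q * P)"
    using w by (intro mat_trace_mult_comm) auto
  also have "B * Q * P = B"
    using w by (metis assoc_mult_mat right_mult_one_mat)
  finally have tr: "mat_trace A = (\<Sum>i<n. B $$ (i, i))"
    using B by (simp add: mat_trace_def)
  have "eigenvalue A (B $$ (i, i))" if "i < n" for i
  proof -
    have "char_poly A = (\<Prod>a\<leftarrow>diag_mat B. [:- a, 1:])"
      using char_poly_similar[OF sim] char_poly_upper_triangular[OF B ut] by simp
    moreover have "B $$ (i, i) \<in> set (diag_mat B)"
      using that B by (auto simp: diag_mat_def)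
    ultimately show ?thesis
      unfolding eigenvalue_root_char_poly[OF A]
      by (auto simp: poly_prod_list prod_list_zero_iff)
  qed
  with tr show ?thesis using that by blast
qed

text \<open>Vectors are functions on \<open>nat\<close> from here on, of which only the values below
  \<open>n\<close> matter; this avoids carrier conditions.\<close>

lemma eigenvalue_fun:
  fixes A :: "complex mat"
  assumes A: "A \<in> carrier_mat n n" and "eigenvalue A e"
  obtains v where "\<And>i. i < n \<Longrightarrow> (\<Sum>j<n. A $$ (i, j) * v j) = e * v i"
    "(\<Sum>i<n. cnj (v i) * v i) = 1"
proof -
  from assms obtain w where w: "w \<in> carrier_vec n" "w \<noteq> 0\<^sub>v n" "A *\<^sub>v w = e \<cdot>\<^sub>v w"
    unfolding eigenvalue_def eigenvector_def by auto
  define s where "s = (\<Sum>i<n. (cmod (w $ i))\<^sup>2)"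
  from w(1,2) obtain i where i: "i < n" "w $ i \<noteq> 0" by (metis eq_vecI carrier_vecD index_zero_vec)
  hence "s > 0"
    unfolding s_def by (intro sum_pos2[where i = i]) auto
  define v where "v i = w $ i / complex_of_real (sqrt s)" for i
  have "(\<Sum>j<n. A $$ (i, j) * v j) = e * v i" if "i < n" for i
  proof -
    have "(\<Sum>j<n. A $$ (i, j) * w $ j) = (A *\<^sub>v w) $ i"
      using that A w(1) by (simp add: scalar_prod_def atLeast0LessThan)
    also have "\<dots> = e * w $ i" using w that by simp
    finally show ?thesis
      by (simp add: v_def sum_divide_distrib[symmetric])
  qed
  moreover have "(\<Sum>i<n. cnj (v i) * v i) = 1"
  proof -
    have "cnj (v i) * v i = complex_of_real ((cmod (w $ i))\<^sup>2 / s)" for i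
    proof -
      have "cnj (v i) * v i = cnj (w $ i) * w $ i / (complex_of_real (sqrt s) * complex_of_real (sqrt s))"
        by (simp add: v_def)
      also have "complex_of_real (sqrt s) * complex_of_real (sqrt s) = complex_of_real s"
        using \<open>s > 0\<close> by (metis of_real_mult real_sqrt_mult_self abs_of_pos)
      also have "cnj (w $ i) * w $ i = complex_of_real ((cmod (w $ i))\<^sup>2)"
        by (metis complex_norm_square mult.commute)
      finally show ?thesis by simp
    qed
    hence "(\<Sum>i<n. cnj (v i) * v i) = complex_of_real (\<Sum>i<n. (cmod (w $ i))\<^sup>2 / s)"
      by simp
    also have "(\<Sum>i<n. (cmod (w $ i))\<^sup>2 / s) = 1"
      using \<open>s > 0\<close> by (simp add: sum_divide_distrib[symmetric] s_def)
    finally show ?thesis by simp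
  qed
  ultimately show ?thesis using that by blast
qed

definition hermitian :: "nat \<Rightarrow> complex mat \<Rightarrow> bool" where
  "hermitian n A \<longleftrightarrow> A \<in> carrier_mat n n \<and> (\<forall>i<n. \<forall>j<n. A $$ (j, i) = cnj (A $$ (i, j)))"

lemma hermitian_inner:
  assumes "hermitian n A"
  shows "(\<Sum>i<n. cnj (u i) * (\<Sum>j<n. A $$ (i, j) * v j)) = (\<Sum>j<n. cnj (\<Sum>i<n. A $$ (j, i) * u i) * v j)"
proof -
  have "(\<Sum>i<n. cnj (u i) * (\<Sum>j<n. A $$ (i, j) * v j)) = (\<Sum>i<n. \<Sum>j<n. cnj (u i) * A $$ (i, j) * v j)"
    by (simp add: sum_distrib_left mult.assoc)
  also have "\<dots> = (\<Sum>j<n. \<Sum>i<n. cnj (u i) * A $$ (i, j) * v j)"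
    by (rule sum.swap)
  also have "\<dots> = (\<Sum>j<n. cnj (\<Sum>i<n. A $$ (j, i) * u i) * v j)"
  proof (rule sum.cong[OF refl])
    fix j assume "j \<in> {..<n}"
    with assms have "A $$ (i, j) = cnj (A $$ (j, i))" if "i < n" for i
      using that unfolding hermitian_def by blast
    hence "(\<Sum>i<n. cnj (u i) * A $$ (i, j) * v j) = (\<Sum>i<n. cnj (A $$ (j, i) * u i) * v j)"
      by (intro sum.cong refl) (simp only: lessThan_iff complex_cnj_mult mult_ac)
    thus "(\<Sum>i<n. cnj (u i) * A $$ (i, j) * v j) = cnj (\<Sum>i<n. A $$ (j, i) * u i) * v j"
      by (simp only: cnj_sum sum_distrib_right)
  qed
  finally show ?thesis .
qed

lemma hermitian_eigenvalue_real:
  assumes H: "hermitian n A" and e: "\<And>i. i < n \<Longrightarrow> (\<Sum>j<n. A $$ (i, j) * v j) = e * v i"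
    and v: "(\<Sum>i<n. cnj (v i) * v i) = 1"
  shows "cnj e = e"
proof -
  have "e * (\<Sum>i<n. cnj (v i) * v i) = cnj e * (\<Sum>i<n. cnj (v i) * v i)"
  proof -
    have "(\<Sum>i<n. cnj (v i) * (\<Sum>j<n. A $$ (i, j) * v j)) = (\<Sum>i<n. cnj (v i) * (e * v i))"
      by (intro sum.cong refl) (simp add: e)
    hence "(\<Sum>i<n. cnj (v i) * (\<Sum>j<n. A $$ (i, j) * v j)) = e * (\<Sum>i<n. cnj (v i) * v i)"
      by (simp add: sum_distrib_left mult.left_commute)
    moreover have "(\<Sum>j<n. cnj (\<Sum>i<n. A $$ (j, i) * v i) * v j) = (\<Sum>j<n. cnj (e * v j) * v j)"
      by (intro sum.cong refl) (simp only: e lessThan_iff)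
    hence "(\<Sum>j<n. cnj (\<Sum>i<n. A $$ (j, i) * v i) * v j) = cnj e * (\<Sum>i<n. cnj (v i) * v i)"
      by (simp add: sum_distrib_left mult.assoc)
    ultimately show ?thesis using hermitian_inner[OF H, of v v] by simp
  qed
  with v show ?thesis by simp
qed

lemma hermitian_eigenvectors_orthogonal:
  assumes H: "hermitian n A" and e: "\<And>i. i < n \<Longrightarrow> (\<Sum>j<n. A $$ (i, j) * v j) = e * v i"
    and f: "\<And>i. i < n \<Longrightarrow> (\<Sum>j<n. A $$ (i, j) * u j) = complex_of_real f * u i"
    and "e \<noteq> complex_of_real f"
  shows "(\<Sum>i<n. cnj (u i) * v i) = 0"
proof -
  have "e * (\<Sum>i<n. cnj (u i) * v i) = complex_of_real f * (\<Sum>i<n. cnj (u i) * v i)"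
  proof -
    have "(\<Sum>i<n. cnj (u i) * (\<Sum>j<n. A $$ (i, j) * v j)) = (\<Sum>i<n. cnj (u i) * (e * v i))"
      by (intro sum.cong refl) (simp add: e)
    hence "(\<Sum>i<n. cnj (u i) * (\<Sum>j<n. A $$ (i, j) * v j)) = e * (\<Sum>i<n. cnj (u i) * v i)"
      by (simp add: sum_distrib_left mult.left_commute)
    moreover have "(\<Sum>j<n. cnj (\<Sum>i<n. A $$ (j, i) * u i) * v j) = (\<Sum>j<n. cnj (complex_of_real f * u j) * v j)"
      by (intro sum.cong refl) (simp only: f lessThan_iff)
    hence "(\<Sum>j<n. cnj (\<Sum>i<n. A $$ (j, i) * u i) * v j) = complex_of_real f * (\<Sum>i<n. cnj (u i) * v i)"
      by (simp add: sum_distrib_left mult.assoc)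
    ultimately show ?thesis using hermitian_inner[OF H, of u v] by simp
  qed
  with assms show ?thesis by simp
qed

text \<open>The eigenvalues of the eigenvectors found so far are all moved to a common value \<open>\<mu>\<close>, chosen
  such that the trace forces a further eigenvalue different from \<open>\<mu>\<close>.\<close>

lemma orthonormal_eigenvectors:
  assumes H: "hermitian n A" and "k \<le> n"
  shows "\<exists>u l. (\<forall>a<k. \<forall>b<k. (\<Sum>i<n. cnj (u a i) * u b i) = (if a = b then 1 else 0)) \<and>
    (\<forall>a<k. \<forall>i<n. (\<Sum>j<n. A $$ (i, j) * u a j) = complex_of_real (l a) * u a i)"
  using \<open>k \<le> n\<close>
proof (induction k)
  case 0
  thus ?case by simp
next
  case (Suc k)
  then obtain u :: "nat \<Rightarrow> nat \<Rightarrow> complex" and l :: "nat \<Rightarrow> real"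
    where on: "\<And>a b. a < k \<Longrightarrow> b < k \<Longrightarrow> (\<Sum>i<n. cnj (u a i) * u b i) = (if a = b then 1 else 0)"
    and ev: "\<And>a i. a < k \<Longrightarrow> i < n \<Longrightarrow> (\<Sum>j<n. A $$ (i, j) * u a j) = complex_of_real (l a) * u a i"
    by fastforce
  have A: "A \<in> carrier_mat n n" using H by (simp add: hermitian_def)
  \<comment> \<open>If all eigenvalues of \<open>A'\<close> were \<open>\<mu>\<close>, its trace
    would be \<open>n * \<mu>\<close>. The real part of the trace is
    \<open>Re (mat_trace A) - (\<Sum>a<k. l a) + k * \<mu>\<close>, and this choice makes
    \<open>n * \<mu>\<close> larger by exactly 1.\<close>
  define \<mu> :: real where "\<mu> = (Re (mat_trace A) - (\<Sum>a<k. l a) + 1) / real (n - k)"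
  define A' where "A' = mat n n (\<lambda>(i, j). A $$ (i, j) +
    (\<Sum>a<k. complex_of_real (\<mu> - l a) * u a i * cnj (u a j)))"
  have A'c: "A' \<in> carrier_mat n n" by (simp add: A'_def)
  have H': "hermitian n A'"
  proof -
    have 1: "(\<Sum>a<k. complex_of_real (\<mu> - l a) * u a j * cnj (u a i)) =
      cnj (\<Sum>a<k. complex_of_real (\<mu> - l a) * u a i * cnj (u a j))" for i j
      unfolding cnj_sum by (intro sum.cong refl) (simp add: mult.commute mult.left_commute)
    have "A' $$ (j, i) = cnj (A' $$ (i, j))" if "i < n" "j < n" for i j
    proof -
      have "A $$ (j, i) = cnj (A $$ (i, j))" using H that unfolding hermitian_def by blast
      with that 1[of j i] show ?thesis by (simp only: A'_def index_mat(1) split complex_cnj_add)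
    qed
    with A'c show ?thesis unfolding hermitian_def by blast
  qed
  have act: "(\<Sum>j<n. A' $$ (i, j) * v j) = (\<Sum>j<n. A $$ (i, j) * v j) +
      (\<Sum>a<k. complex_of_real (\<mu> - l a) * u a i * (\<Sum>j<n. cnj (u a j) * v j))"
    if "i < n" for i v
  proof -
    have "(\<Sum>j<n. A' $$ (i, j) * v j) = (\<Sum>j<n. A $$ (i, j) * v j) +
      (\<Sum>j<n. \<Sum>a<k. complex_of_real (\<mu> - l a) * u a i * cnj (u a j) * v j)"
      using that by (simp add: A'_def distrib_right sum.distrib sum_distrib_right)
    also have "(\<Sum>j<n. \<Sum>a<k. complex_of_real (\<mu> - l a) * u a i * cnj (u a j) * v j) =
      (\<Sum>a<k. complex_of_real (\<mu> - l a) * u a i * (\<Sum>j<n. cnj (u a j) * v j))"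
      by (subst sum.swap) (simp add: sum_distrib_left mult.assoc)
    finally show ?thesis .
  qed
  have ev': "(\<Sum>j<n. A' $$ (i, j) * u b j) = complex_of_real \<mu> * u b i" if "b < k" "i < n" for b i
  proof -
    have "(\<Sum>a<k. complex_of_real (\<mu> - l a) * u a i * (\<Sum>j<n. cnj (u a j) * u b j)) =
      (\<Sum>a<k. if a = b then complex_of_real (\<mu> - l b) * u b i else 0)"
      using that by (intro sum.cong refl) (auto simp: on)
    also have "\<dots> = complex_of_real (\<mu> - l b) * u b i" using that by simp
    finally have "(\<Sum>j<n. A' $$ (i, j) * u b j) =
      complex_of_real (l b) * u b i + complex_of_real (\<mu> - l b) * u b i"
      by (simp only: act[OF that(2)] ev[OF that])
    thus ?thesis by (simp add: algebra_simps)
  qed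
  have trA': "mat_trace A' = mat_trace A + complex_of_real (real k * \<mu> - (\<Sum>a<k. l a))"
  proof -
    have "mat_trace A' = mat_trace A + (\<Sum>i<n. \<Sum>a<k. complex_of_real (\<mu> - l a) * u a i * cnj (u a i))"
      using A by (simp add: mat_trace_def A'_def sum.distrib)
    also have "(\<Sum>i<n. \<Sum>a<k. complex_of_real (\<mu> - l a) * u a i * cnj (u a i)) =
      (\<Sum>a<k. complex_of_real (\<mu> - l a) * (\<Sum>i<n. cnj (u a i) * u a i))"
      by (subst sum.swap) (simp add: sum_distrib_left mult_ac)
    also have "\<dots> = (\<Sum>a<k. complex_of_real (\<mu> - l a))" by (simp add: on)
    also have "\<dots> = complex_of_real (real k * \<mu> - (\<Sum>a<k. l a))" by (simp add: sum_subtractf)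
    finally show ?thesis .
  qed
  obtain e where e: "mat_trace A' = (\<Sum>i<n. e i)" "\<And>i. i < n \<Longrightarrow> eigenvalue A' (e i)"
    by (rule trace_eigenvalues[OF A'c]) (rule that)
  have "\<exists>i<n. e i \<noteq> complex_of_real \<mu>"
  proof (rule ccontr)
    assume "\<not> ?thesis"
    hence "mat_trace A' = complex_of_real (real n * \<mu>)" using e(1) by simp
    with trA' have "mat_trace A = complex_of_real (real n * \<mu> - real k * \<mu> + (\<Sum>a<k. l a))"
      by (simp add: algebra_simps)
    hence "Re (mat_trace A) = real n * \<mu> - real k * \<mu> + (\<Sum>a<k. l a)"
      by (simp only: Re_complex_of_real)
    hence "Re (mat_trace A) = (real n - real k) * \<mu> + (\<Sum>a<k. l a)"
      by (simp add: algebra_simps)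
    moreover have "(real n - real k) * \<mu> = Re (mat_trace A) - (\<Sum>a<k. l a) + 1"
      using Suc.prems by (simp add: \<mu>_def of_nat_diff)
    ultimately show False by simp
  qed
  then obtain i0 where i0: "i0 < n" "e i0 \<noteq> complex_of_real \<mu>" by auto
  obtain v where v: "\<And>i. i < n \<Longrightarrow> (\<Sum>j<n. A' $$ (i, j) * v j) = e i0 * v i"
    "(\<Sum>i<n. cnj (v i) * v i) = 1"
    using eigenvalue_fun[OF A'c e(2)[OF i0(1)]] by blast
  have orth: "(\<Sum>i<n. cnj (u a i) * v i) = 0" if "a < k" for a
    using hermitian_eigenvectors_orthogonal[OF H' v(1) ev'[OF that] i0(2)] by simp
  have orth': "(\<Sum>i<n. cnj (v i) * u a i) = 0" if "a < k" for a
  proof -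
    have "(\<Sum>i<n. cnj (v i) * u a i) = cnj (\<Sum>i<n. cnj (u a i) * v i)" by (simp add: mult.commute)
    thus ?thesis using orth[OF that] by simp
  qed
  have "cnj (e i0) = e i0" using hermitian_eigenvalue_real[OF H' v] by simp
  hence er: "e i0 = complex_of_real (Re (e i0))" by (simp add: complex_eq_iff)
  \<comment> \<open>The eigenvalue of \<open>v\<close> differs from \<open>\<mu>\<close>, so
    \<open>v\<close> is orthogonal to all \<open>u a\<close>; the added term vanishes on it, and
    \<open>v\<close> is an eigenvector of \<open>A\<close> itself.\<close>
  have evA: "(\<Sum>j<n. A $$ (i, j) * v j) = complex_of_real (Re (e i0)) * v i" if "i < n" for i
    using v(1)[OF that] act[OF that, of v] orth er by simp
  define u' where "u' = u(k := v)"
  define l' where "l' = l(k := Re (e i0))"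
  have "(\<Sum>i<n. cnj (u' a i) * u' b i) = (if a = b then 1 else 0)" if "a < Suc k" "b < Suc k" for a b
    using that on orth orth' v(2) by (auto simp: u'_def less_Suc_eq)
  moreover have "(\<Sum>j<n. A $$ (i, j) * u' a j) = complex_of_real (l' a) * u' a i" if "a < Suc k" "i < n" for a i
    using that ev evA by (auto simp: u'_def l'_def less_Suc_eq)
  ultimately show ?case by blast
qed

text \<open>For square matrices a left inverse is a right inverse: orthonormal columns imply the
  completeness relation.\<close>

lemma orthonormal_complete:
  fixes u :: "nat \<Rightarrow> nat \<Rightarrow> complex"
  assumes on: "\<And>a b. a < n \<Longrightarrow> b < n \<Longrightarrow> (\<Sum>i<n. cnj (u a i) * u b i) = (if a = b then 1 else 0)"
    and "i < n" "j < n"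
  shows "(\<Sum>a<n. u a i * cnj (u a j)) = (if i = j then 1 else 0)"
proof -
  define U where "U = mat n n (\<lambda>(i, a). u a i)"
  define V where "V = mat n n (\<lambda>(a, i). cnj (u a i))"
  have UV: "U \<in> carrier_mat n n" "V \<in> carrier_mat n n" by (simp_all add: U_def V_def)
  have "V * U = 1\<^sub>m n"
  proof (rule eq_matI)
    fix i j assume "i < dim_row (1\<^sub>m n :: complex mat)" "j < dim_col (1\<^sub>m n :: complex mat)"
    hence ij: "i < n" "j < n" by simp_all
    have "(V * U) $$ (i, j) = (\<Sum>a<n. V $$ (i, a) * U $$ (a, j))"
      by (rule index_mult_mat_sum[OF UV(2,1) ij])
    also have "\<dots> = 1\<^sub>m n $$ (i, j)" using ij on by (simp add: U_def V_def)
    finally show "(V * U) $$ (i, j) = 1\<^sub>m n $$ (i, j)" .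
  qed (use UV in auto)
  hence "U * V = 1\<^sub>m n" using mat_mult_left_right_inverse[OF UV(2,1)] by simp
  hence "(U * V) $$ (i, j) = (if i = j then 1 else 0)" using assms by simp
  moreover have "(U * V) $$ (i, j) = (\<Sum>a<n. U $$ (i, a) * V $$ (a, j))"
    by (rule index_mult_mat_sum[OF UV assms(2,3)])
  ultimately show ?thesis using assms by (simp add: U_def V_def)
qed

lemma spectral_theorem:
  assumes H: "hermitian n A"
  obtains u :: "nat \<Rightarrow> nat \<Rightarrow> complex" and l :: "nat \<Rightarrow> real"
  where "\<And>a b. a < n \<Longrightarrow> b < n \<Longrightarrow> (\<Sum>i<n. cnj (u a i) * u b i) = (if a = b then 1 else 0)"
    and "\<And>i j. i < n \<Longrightarrow> j < n \<Longrightarrow> A $$ (i, j) = (\<Sum>a<n. complex_of_real (l a) * u a i * cnj (u a j))"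
proof -
  from orthonormal_eigenvectors[OF H order_refl] obtain u l
    where on: "\<And>a b. a < n \<Longrightarrow> b < n \<Longrightarrow> (\<Sum>i<n. cnj (u a i) * u b i) = (if a = b then 1 else 0)"
    and ev: "\<And>a i. a < n \<Longrightarrow> i < n \<Longrightarrow> (\<Sum>j<n. A $$ (i, j) * u a j) = complex_of_real (l a) * u a i"
    by blast
  have "A $$ (i, j) = (\<Sum>a<n. complex_of_real (l a) * u a i * cnj (u a j))" if "i < n" "j < n" for i j
  proof -
    have "A $$ (i, j) = (\<Sum>k<n. A $$ (i, k) * (if k = j then 1 else 0))"
      using that by (simp add: if_distrib[of "(*) _"] cong: if_cong)
    also have "\<dots> = (\<Sum>k<n. A $$ (i, k) * (\<Sum>a<n. u a k * cnj (u a j)))"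
      using that by (intro sum.cong refl) (subst orthonormal_complete[where u = u, OF on], auto)
    also have "\<dots> = (\<Sum>k<n. \<Sum>a<n. A $$ (i, k) * u a k * cnj (u a j))"
      by (simp add: sum_distrib_left mult.assoc)
    also have "\<dots> = (\<Sum>a<n. (\<Sum>k<n. A $$ (i, k) * u a k) * cnj (u a j))"
      by (subst sum.swap) (simp add: sum_distrib_right)
    also have "\<dots> = (\<Sum>a<n. complex_of_real (l a) * u a i * cnj (u a j))"
      using that by (simp add: ev)
    finally show ?thesis .
  qed
  with on show ?thesis using that by blast
qed

section \<open>Expansion in an orthonormal basis\<close>

definition orthonormal :: "nat \<Rightarrow> (nat \<Rightarrow> nat \<Rightarrow> complex) \<Rightarrow> bool" where
  "orthonormal n u \<longleftrightarrow> (\<forall>a<n. \<forall>b<n. (\<Sum>i<n. cnj (u a i) * u b i) = (if a = b then 1 else 0))"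

definition coef :: "nat \<Rightarrow> (nat \<Rightarrow> nat \<Rightarrow> complex) \<Rightarrow> (nat \<Rightarrow> complex) \<Rightarrow> nat \<Rightarrow> complex" where
  "coef n u f a = (\<Sum>i<n. cnj (u a i) * f i)"

lemma orthonormal_expand:
  assumes "orthonormal n u" "i < n"
  shows "f i = (\<Sum>a<n. coef n u f a * u a i)"
proof -
  have "(\<Sum>a<n. coef n u f a * u a i) = (\<Sum>a<n. \<Sum>j<n. f j * (u a i * cnj (u a j)))"
    by (simp add: coef_def sum_distrib_left sum_distrib_right mult_ac)
  also have "\<dots> = (\<Sum>j<n. f j * (\<Sum>a<n. u a i * cnj (u a j)))"
    by (subst sum.swap) (simp add: sum_distrib_left)
  also have "\<dots> = (\<Sum>j<n. f j * (if i = j then 1 else 0))"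
    using assms by (intro sum.cong refl arg_cong2[of _ _ _ _ "(*)"] orthonormal_complete)
      (auto simp: orthonormal_def)
  also have "\<dots> = f i"
    using assms by (simp add: if_distrib[of "(*) _"] cong: if_cong)
  finally show ?thesis by simp
qed

lemma parseval:
  assumes "orthonormal n u"
  shows "(\<Sum>a<n. cnj (coef n u f a) * coef n u g a) = (\<Sum>i<n. cnj (f i) * g i)"
proof -
  have "(\<Sum>a<n. cnj (coef n u f a) * coef n u g a) = (\<Sum>a<n. \<Sum>i<n. cnj (f i) * (coef n u g a * u a i))"
    by (simp add: coef_def[of n u f] sum_distrib_left sum_distrib_right mult_ac)
  also have "\<dots> = (\<Sum>i<n. cnj (f i) * (\<Sum>a<n. coef n u g a * u a i))"
    by (subst sum.swap) (simp add: sum_distrib_left)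
  also have "\<dots> = (\<Sum>i<n. cnj (f i) * g i)"
    using assms by (intro sum.cong refl) (simp flip: orthonormal_expand)
  finally show ?thesis .
qed

lemma cnj_mult_self: "cnj z * z = complex_of_real ((cmod z)\<^sup>2)"
  unfolding complex_norm_square by (rule mult.commute)

lemma parseval_norm:
  assumes "orthonormal n u"
  shows "(\<Sum>a<n. (cmod (coef n u f a))\<^sup>2) = (\<Sum>i<n. (cmod (f i))\<^sup>2)"
proof -
  have "complex_of_real (\<Sum>a<n. (cmod (coef n u f a))\<^sup>2) = complex_of_real (\<Sum>i<n. (cmod (f i))\<^sup>2)"
    using parseval[OF assms, of f f] by (simp add: cnj_mult_self)
  thus ?thesis by (simp only: of_real_eq_iff)
qed

section \<open>Quadratic forms and positivity\<close>

definition qform :: "nat \<Rightarrow> complex mat \<Rightarrow> (nat \<Rightarrow> complex) \<Rightarrow> complex" where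
  "qform n A v = (\<Sum>i<n. \<Sum>j<n. cnj (v i) * A $$ (i, j) * v j)"

lemma psd_iff: "psd n A \<longleftrightarrow> A \<in> carrier_mat n n \<and> (\<forall>v. 0 \<le> qform n A v)"
proof -
  have eq: "(A *\<^sub>v w) \<bullet>c w = qform n A (\<lambda>i. w $ i)" if "A \<in> carrier_mat n n" "w \<in> carrier_vec n" for w
  proof -
    have "(A *\<^sub>v w) \<bullet>c w = (\<Sum>i<n. (\<Sum>j<n. A $$ (i, j) * w $ j) * cnj (w $ i))"
      using that by (simp add: scalar_prod_def atLeast0LessThan)
    thus ?thesis by (simp add: qform_def sum_distrib_right sum_distrib_left mult_ac)
  qed
  have "qform n A v = qform n A (\<lambda>i. vec n v $ i)" for v
    by (simp add: qform_def)
  thus ?thesis unfolding psd_def using eq by (metis vec_carrier)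
qed

text \<open>The indicators are added rather than nested, so that \<open>i = j\<close> is covered;
  with \<open>c\<close> equal to 0, 1 and \<open>\<i>\<close> the formula gives the polarisation
  argument below.\<close>

lemma qform_two_points:
  assumes "i < n" "j < n"
  shows "qform n A (\<lambda>k. (if k = i then 1 else 0) + (if k = j then c else 0)) =
    A $$ (i, i) + c * A $$ (i, j) + cnj c * A $$ (j, i) + cnj c * c * A $$ (j, j)"
proof -
  have "qform n A (\<lambda>k. (if k = i then 1 else 0) + (if k = j then c else 0)) =
    (\<Sum>k<n. \<Sum>m<n. (if k = i then (if m = i then A $$ (k, m) else 0) else 0) +
      (if k = i then (if m = j then c * A $$ (k, m) else 0) else 0) +
      (if k = j then (if m = i then cnj c * A $$ (k, m) else 0) else 0) +
      (if k = j then (if m = j then cnj c * c * A $$ (k, m) else 0) else 0))"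
    unfolding qform_def by (intro sum.cong refl) (auto simp: algebra_simps)
  also have "\<dots> = A $$ (i, i) + c * A $$ (i, j) + cnj c * A $$ (j, i) + cnj c * c * A $$ (j, j)"
    using assms by (simp add: sum.distrib if_distrib[of "\<lambda>f. sum f _"] sum.If_cases)
  finally show ?thesis .
qed

text \<open>A quadratic form that takes only real values comes from a Hermitian matrix:
  \<open>c = 1\<close> compares the imaginary parts of the entries at \<open>(i, j)\<close> and
  \<open>(j, i)\<close>, \<open>c = \<i>\<close> the real parts.\<close>

lemma psd_hermitian:
  assumes "psd n A"
  shows "hermitian n A"
proof -
  have A: "A \<in> carrier_mat n n" and q: "\<And>v. 0 \<le> qform n A v"
    using assms by (simp_all add: psd_iff)
  have im: "Im (qform n A v) = 0" for v using q[of v] by (simp add: less_eq_complex_def)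
  have d: "Im (A $$ (i, i)) = 0" if "i < n" for i
    using im[of "\<lambda>k. (if k = i then 1 else 0) + (if k = i then 0 else 0)"]
    unfolding qform_two_points[OF that that] by simp
  have "A $$ (j, i) = cnj (A $$ (i, j))" if "i < n" "j < n" for i j
    using im[of "\<lambda>k. (if k = i then 1 else 0) + (if k = j then 1 else 0)"]
      im[of "\<lambda>k. (if k = i then 1 else 0) + (if k = j then \<i> else 0)"] that
    unfolding qform_two_points[OF that] by (simp add: complex_eq_iff d)
  thus ?thesis using A unfolding hermitian_def by blast
qed

section \<open>Positive square roots and the trace norm of a Hermitian matrix\<close>

definition spectral_mat :: "nat \<Rightarrow> (nat \<Rightarrow> nat \<Rightarrow> complex) \<Rightarrow> (nat \<Rightarrow> real) \<Rightarrow> complex mat" where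
  "spectral_mat n u l = mat n n (\<lambda>(i, j). \<Sum>a<n. complex_of_real (l a) * u a i * cnj (u a j))"

lemma spectral_mat_carrier [simp]: "spectral_mat n u l \<in> carrier_mat n n"
  by (simp add: spectral_mat_def)

lemma spectral_mat_apply:
  assumes "i < n"
  shows "(\<Sum>j<n. spectral_mat n u l $$ (i, j) * v j) = (\<Sum>a<n. complex_of_real (l a) * u a i * coef n u v a)"
proof -
  have "(\<Sum>j<n. spectral_mat n u l $$ (i, j) * v j) =
    (\<Sum>j<n. \<Sum>a<n. complex_of_real (l a) * u a i * (cnj (u a j) * v j))"
    using assms by (simp add: spectral_mat_def sum_distrib_right mult.assoc)
  also have "\<dots> = (\<Sum>a<n. complex_of_real (l a) * u a i * coef n u v a)"
    by (subst sum.swap) (simp add: sum_distrib_left coef_def)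
  finally show ?thesis .
qed

lemma qform_spectral:
  "qform n (spectral_mat n u l) v = complex_of_real (\<Sum>a<n. l a * (cmod (coef n u v a))\<^sup>2)"
proof -
  have "qform n (spectral_mat n u l) v = (\<Sum>i<n. cnj (v i) * (\<Sum>j<n. spectral_mat n u l $$ (i, j) * v j))"
    by (simp add: qform_def sum_distrib_left mult.assoc)
  also have "\<dots> = (\<Sum>i<n. cnj (v i) * (\<Sum>a<n. complex_of_real (l a) * u a i * coef n u v a))"
    by (intro sum.cong refl) (simp only: spectral_mat_apply lessThan_iff)
  also have "\<dots> = (\<Sum>i<n. \<Sum>a<n. complex_of_real (l a) * coef n u v a * (cnj (v i) * u a i))"
    by (simp add: sum_distrib_left mult_ac)
  also have "\<dots> = (\<Sum>a<n. complex_of_real (l a) * coef n u v a * (\<Sum>i<n. cnj (v i) * u a i))"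
    by (subst sum.swap) (simp add: sum_distrib_left)
  also have "\<dots> = (\<Sum>a<n. complex_of_real (l a) * (cnj (coef n u v a) * coef n u v a))"
    by (simp add: coef_def mult_ac)
  finally show ?thesis by (simp add: cnj_mult_self)
qed

lemma psd_spectral_mat:
  assumes "\<And>a. a < n \<Longrightarrow> l a \<ge> 0"
  shows "psd n (spectral_mat n u l)"
  unfolding psd_iff qform_spectral using assms
  by (auto simp: less_eq_complex_def intro!: sum_nonneg)

lemma spectral_mat_mult:
  assumes on: "orthonormal n u"
  shows "spectral_mat n u l * spectral_mat n u m = spectral_mat n u (\<lambda>a. l a * m a)"
proof (rule eq_matI)
  fix i j assume "i < dim_row (spectral_mat n u (\<lambda>a. l a * m a))" "j < dim_col (spectral_mat n u (\<lambda>a. l a * m a))"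
  hence ij: "i < n" "j < n" by (simp_all add: spectral_mat_def)
  have c: "coef n u (\<lambda>k. spectral_mat n u m $$ (k, j)) a = complex_of_real (m a) * cnj (u a j)" if "a < n" for a
  proof -
    have "coef n u (\<lambda>k. spectral_mat n u m $$ (k, j)) a =
      (\<Sum>k<n. \<Sum>b<n. complex_of_real (m b) * cnj (u b j) * (cnj (u a k) * u b k))"
      using ij by (simp add: coef_def spectral_mat_def sum_distrib_left mult_ac)
    also have "\<dots> = (\<Sum>b<n. complex_of_real (m b) * cnj (u b j) * (\<Sum>k<n. cnj (u a k) * u b k))"
      by (subst sum.swap) (simp add: sum_distrib_left)
    also have "\<dots> = (\<Sum>b<n. complex_of_real (m b) * cnj (u b j) * (if a = b then 1 else 0))"
      using on that by (intro sum.cong refl) (simp add: orthonormal_def)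
    also have "\<dots> = complex_of_real (m a) * cnj (u a j)"
      using that by (simp add: if_distrib[of "(*) _"] cong: if_cong)
    finally show ?thesis .
  qed
  have "(spectral_mat n u l * spectral_mat n u m) $$ (i, j) =
      (\<Sum>k<n. spectral_mat n u l $$ (i, k) * spectral_mat n u m $$ (k, j))"
    using ij by (intro index_mult_mat_sum) auto
  also have "\<dots> = (\<Sum>a<n. complex_of_real (l a) * u a i * (complex_of_real (m a) * cnj (u a j)))"
    unfolding spectral_mat_apply[OF ij(1)] by (intro sum.cong refl) (simp add: c)
  also have "\<dots> = spectral_mat n u (\<lambda>a. l a * m a) $$ (i, j)"
    using ij by (simp add: spectral_mat_def mult_ac)
  finally show "(spectral_mat n u l * spectral_mat n u m) $$ (i, j) = spectral_mat n u (\<lambda>a. l a * m a) $$ (i, j)" .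
qed (simp_all add: spectral_mat_def)

lemma spectral_mat_eigenvector:
  assumes on: "orthonormal n u" and "a < n" "i < n"
  shows "(\<Sum>j<n. spectral_mat n u l $$ (i, j) * u a j) = complex_of_real (l a) * u a i"
proof -
  have "(\<Sum>b<n. complex_of_real (l b) * u b i * coef n u (u a) b) =
    (\<Sum>b<n. complex_of_real (l b) * u b i * (if b = a then 1 else 0))"
    using assms by (intro sum.cong refl) (simp add: orthonormal_def coef_def)
  also have "\<dots> = complex_of_real (l a) * u a i"
    using assms by (simp add: if_distrib[of "(*) _"] cong: if_cong)
  finally show ?thesis by (simp only: spectral_mat_apply[OF assms(3)])
qed

text \<open>Let \<open>w\<close> be \<open>B u - l u\<close> for an eigenvector \<open>u\<close>.
  From \<open>B (B u) = l\<^sup>2 u\<close> follows \<open>B w = - l w\<close>, which contradicts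
  positivity unless \<open>w = 0\<close> or \<open>l = 0\<close>. In the latter case the squared
  norm of \<open>w\<close> is the inner product of \<open>w\<close> with \<open>B u\<close>, hence
  of \<open>B w = 0\<close> with \<open>u\<close>.\<close>

lemma psd_sqrt_unique:
  assumes on: "orthonormal n u" and l: "\<And>a. a < n \<Longrightarrow> l a \<ge> 0"
    and B: "psd n B" and BB: "B * B = spectral_mat n u (\<lambda>a. l a * l a)"
  shows "B = spectral_mat n u l"
proof (rule eq_matI)
  have Bc: "B \<in> carrier_mat n n" using B by (simp add: psd_iff)
  have ev: "(\<Sum>j<n. B $$ (i, j) * u a j) = complex_of_real (l a) * u a i" if a: "a < n" and "i < n" for a i
  proof -
    define x where "x i = (\<Sum>j<n. B $$ (i, j) * u a j)" for i
    define w where "w i = x i - complex_of_real (l a) * u a i" for i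
    have Bx: "(\<Sum>j<n. B $$ (i, j) * x j) = complex_of_real (l a * l a) * u a i" if "i < n" for i
    proof -
      have "(\<Sum>j<n. B $$ (i, j) * x j) = (\<Sum>j<n. \<Sum>k<n. B $$ (i, j) * B $$ (j, k) * u a k)"
        by (simp add: x_def sum_distrib_left mult.assoc)
      also have "\<dots> = (\<Sum>k<n. (\<Sum>j<n. B $$ (i, j) * B $$ (j, k)) * u a k)"
        by (subst sum.swap) (simp add: sum_distrib_right)
      also have "\<dots> = (\<Sum>k<n. (B * B) $$ (i, k) * u a k)"
        using that by (intro sum.cong refl) (simp only: index_mult_mat_sum[OF Bc Bc] lessThan_iff)
      also have "\<dots> = complex_of_real (l a * l a) * u a i"
        unfolding BB by (rule spectral_mat_eigenvector[OF on a that])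
      finally show ?thesis .
    qed
    have Bw: "(\<Sum>j<n. B $$ (i, j) * w j) = - complex_of_real (l a) * w i" if "i < n" for i
    proof -
      have "(\<Sum>j<n. B $$ (i, j) * w j) = (\<Sum>j<n. B $$ (i, j) * x j) - complex_of_real (l a) * x i"
        by (simp add: w_def x_def right_diff_distrib sum_subtractf sum_distrib_left mult.left_commute)
      thus ?thesis using Bx[OF that] by (simp add: w_def algebra_simps)
    qed
    have "(\<Sum>i<n. (cmod (w i))\<^sup>2) = 0"
    proof (cases "l a = 0")
      case True
      have "complex_of_real (\<Sum>i<n. (cmod (w i))\<^sup>2) = (\<Sum>i<n. cnj (w i) * w i)"
        by (simp add: cnj_mult_self)
      also have "\<dots> = (\<Sum>i<n. cnj (w i) * (\<Sum>j<n. B $$ (i, j) * u a j))"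
        using True by (simp add: w_def x_def)
      also have "\<dots> = (\<Sum>j<n. cnj (\<Sum>i<n. B $$ (j, i) * w i) * u a j)"
        by (rule hermitian_inner[OF psd_hermitian[OF B]])
      also have "\<dots> = (\<Sum>j<n. cnj (- complex_of_real (l a) * w j) * u a j)"
        by (intro sum.cong refl) (simp only: Bw lessThan_iff)
      also have "\<dots> = 0" using True by simp
      finally show ?thesis by (simp only: of_real_eq_0_iff)
    next
      case False
      have "qform n B w = (\<Sum>i<n. cnj (w i) * (\<Sum>j<n. B $$ (i, j) * w j))"
        by (simp add: qform_def sum_distrib_left mult.assoc)
      also have "\<dots> = (\<Sum>i<n. cnj (w i) * (- complex_of_real (l a) * w i))"
        by (intro sum.cong refl) (simp only: Bw lessThan_iff)
      also have "\<dots> = (\<Sum>i<n. - complex_of_real (l a) * (cnj (w i) * w i))"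
        by (simp add: mult_ac)
      also have "\<dots> = complex_of_real (- l a * (\<Sum>i<n. (cmod (w i))\<^sup>2))"
        by (simp add: cnj_mult_self sum_distrib_left sum_negf)
      finally have "0 \<le> complex_of_real (- l a * (\<Sum>i<n. (cmod (w i))\<^sup>2))"
        using B by (metis psd_iff)
      hence "0 \<le> - l a * (\<Sum>i<n. (cmod (w i))\<^sup>2)" by (simp add: less_eq_complex_def)
      moreover have "l a > 0" using False l[OF a] by simp
      moreover have "(\<Sum>i<n. (cmod (w i))\<^sup>2) \<ge> 0" by (intro sum_nonneg) simp
      ultimately show ?thesis by (simp add: mult_le_0_iff)
    qed
    hence "w i = 0" using \<open>i < n\<close> by (simp add: sum_nonneg_eq_0_iff)
    thus ?thesis by (simp add: w_def x_def)
  qed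
  fix i j assume "i < dim_row (spectral_mat n u l)" "j < dim_col (spectral_mat n u l)"
  hence ij: "i < n" "j < n" by (simp_all add: spectral_mat_def)
  have "B $$ (i, j) = (\<Sum>k<n. B $$ (i, k) * (if k = j then 1 else 0))"
    using ij by (simp add: if_distrib[of "(*) _"] cong: if_cong)
  also have "\<dots> = (\<Sum>k<n. B $$ (i, k) * (\<Sum>a<n. u a k * cnj (u a j)))"
    using ij on by (intro sum.cong refl arg_cong2[of _ _ _ _ "(*)"] orthonormal_complete[symmetric])
      (auto simp: orthonormal_def)
  also have "\<dots> = (\<Sum>k<n. \<Sum>a<n. B $$ (i, k) * u a k * cnj (u a j))"
    by (simp add: sum_distrib_left mult.assoc)
  also have "\<dots> = (\<Sum>a<n. (\<Sum>k<n. B $$ (i, k) * u a k) * cnj (u a j))"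
    by (subst sum.swap) (simp add: sum_distrib_right)
  also have "\<dots> = spectral_mat n u l $$ (i, j)"
    using ij by (simp add: ev spectral_mat_def)
  finally show "B $$ (i, j) = spectral_mat n u l $$ (i, j)" .
qed (use B in \<open>auto simp: psd_iff spectral_mat_def\<close>)

lemma qform_eigenvector:
  assumes "orthonormal n u" "a < n"
  shows "qform n (spectral_mat n u l) (u a) = complex_of_real (l a)"
proof -
  have "coef n u (u a) b = (if b = a then 1 else 0)" if "b < n" for b
    using assms that by (simp add: coef_def orthonormal_def)
  hence "(\<Sum>b<n. l b * (cmod (coef n u (u a) b))\<^sup>2) = (\<Sum>b<n. if b = a then l b else 0)"
    by (intro sum.cong refl) simp
  thus ?thesis using assms(2) by (simp add: qform_spectral)
qed

lemma mat_trace_spectral: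
  assumes "orthonormal n u"
  shows "mat_trace (spectral_mat n u l) = complex_of_real (\<Sum>a<n. l a)"
proof -
  have "mat_trace (spectral_mat n u l) = (\<Sum>i<n. \<Sum>a<n. complex_of_real (l a) * (cnj (u a i) * u a i))"
    by (simp add: mat_trace_def spectral_mat_def mult_ac)
  also have "\<dots> = (\<Sum>a<n. complex_of_real (l a) * (\<Sum>i<n. cnj (u a i) * u a i))"
    by (subst sum.swap) (simp add: sum_distrib_left)
  also have "\<dots> = complex_of_real (\<Sum>a<n. l a)"
    using assms by (simp add: orthonormal_def)
  finally show ?thesis .
qed

lemma mat_adjoint_index:
  assumes "A \<in> carrier_mat n m" "i < m" "j < n"
  shows "mat_adjoint A $$ (i, j) = cnj (A $$ (j, i))"
  using assms by (simp add: mat_adjoint_def mat_of_rows_def)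

lemma mat_adjoint_hermitian:
  assumes H: "hermitian n A"
  shows "mat_adjoint A = A"
proof (rule eq_matI)
  have A: "A \<in> carrier_mat n n" using H by (simp add: hermitian_def)
  fix i j assume "i < dim_row A" "j < dim_col A"
  hence ij: "i < n" "j < n" using A by auto
  have "mat_adjoint A $$ (i, j) = cnj (A $$ (j, i))" by (rule mat_adjoint_index[OF A ij])
  also have "\<dots> = A $$ (i, j)" using H ij unfolding hermitian_def by metis
  finally show "mat_adjoint A $$ (i, j) = A $$ (i, j)" .
qed (use H in \<open>auto simp: hermitian_def mat_adjoint_def\<close>)

text \<open>Uniqueness of the positive root resolves the definite description in
  \<open>psd_sqrt\<close>. All later facts about \<open>trace_norm\<close> rest on this lemma, since
  only Hermitian matrices, mostly differences of states, occur there.\<close>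

lemma hermitian_spectral:
  assumes H: "hermitian n A"
  obtains u l where "orthonormal n u" "A = spectral_mat n u l" "trace_norm A = (\<Sum>a<n. \<bar>l a\<bar>)"
proof -
  obtain u :: "nat \<Rightarrow> nat \<Rightarrow> complex" and l :: "nat \<Rightarrow> real"
    where 1: "\<And>a b. a < n \<Longrightarrow> b < n \<Longrightarrow> (\<Sum>i<n. cnj (u a i) * u b i) = (if a = b then 1 else 0)"
    and 2: "\<And>i j. i < n \<Longrightarrow> j < n \<Longrightarrow> A $$ (i, j) = (\<Sum>a<n. complex_of_real (l a) * u a i * cnj (u a j))"
    by (rule spectral_theorem[OF H]) (rule that)
  have on: "orthonormal n u" using 1 by (simp add: orthonormal_def)
  have "A \<in> carrier_mat n n" using H unfolding hermitian_def by blast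
  hence A: "A = spectral_mat n u l"
    using 2 by (intro eq_matI) (auto simp: spectral_mat_def)
  let ?B = "spectral_mat n u (\<lambda>a. \<bar>l a\<bar>)"
  have AA: "mat_adjoint A * A = spectral_mat n u (\<lambda>a. \<bar>l a\<bar> * \<bar>l a\<bar>)"
    unfolding mat_adjoint_hermitian[OF H] unfolding A spectral_mat_mult[OF on] by simp
  have dr: "dim_row (mat_adjoint A * A) = n" unfolding AA by (simp add: spectral_mat_def)
  have "psd_sqrt (mat_adjoint A * A) = ?B"
    unfolding psd_sqrt_def dr unfolding AA
  proof (rule the_equality)
    show "psd n ?B \<and> ?B * ?B = spectral_mat n u (\<lambda>a. \<bar>l a\<bar> * \<bar>l a\<bar>)"
      using spectral_mat_mult[OF on] psd_spectral_mat by simp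
    show "B = ?B" if "psd n B \<and> B * B = spectral_mat n u (\<lambda>a. \<bar>l a\<bar> * \<bar>l a\<bar>)" for B
      using that psd_sqrt_unique[OF on, of "\<lambda>a. \<bar>l a\<bar>"] by simp
  qed
  hence "trace_norm A = Re (mat_trace ?B)" by (simp add: trace_norm_def)
  also have "\<dots> = (\<Sum>a<n. \<bar>l a\<bar>)" by (simp add: mat_trace_spectral[OF on])
  finally show ?thesis using that on A by blast
qed


section \<open>Bounds by the trace norm\<close>

lemma trace_norm_nonneg: "hermitian n A \<Longrightarrow> trace_norm A \<ge> 0"
  by (erule hermitian_spectral) (simp add: sum_nonneg)

text \<open>Places a state in its own ball. The supremum over the ball is then bounded below by 0,
  whereas over the empty set it would be minus infinity.\<close>

lemma trace_norm_zero [simp]: "trace_norm (0\<^sub>m n n) = 0"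
proof -
  have "hermitian n (0\<^sub>m n n)" by (simp add: hermitian_def)
  then obtain u l where *: "orthonormal n u" "0\<^sub>m n n = spectral_mat n u l"
    "trace_norm (0\<^sub>m n n) = (\<Sum>a<n. \<bar>l a\<bar>)" by (rule hermitian_spectral)
  have "l a = 0" if "a < n" for a
  proof -
    have "l a * (cmod (u a i))\<^sup>2 = 0" if "i < n" for i
      using spectral_mat_eigenvector[OF *(1) \<open>a < n\<close> that, of l] that unfolding *(2)[symmetric] by simp
    moreover have "\<exists>i<n. u a i \<noteq> 0"
      using *(1) \<open>a < n\<close> unfolding orthonormal_def
      by (metis (no_types, lifting) complex_cnj_zero lessThan_iff mult_zero_left sum.neutral zero_neq_one)
    ultimately show ?thesis by auto
  qed
  thus ?thesis using *(3) by simp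
qed

text \<open>Turns convergence in trace norm into entrywise convergence, in which the continuity of a
  protocol is easy to express.\<close>

lemma cmod_le_trace_norm:
  assumes "hermitian n A" "i < n" "j < n"
  shows "cmod (A $$ (i, j)) \<le> trace_norm A"
proof -
  obtain u l where on: "orthonormal n u" and A: "A = spectral_mat n u l"
    and tn: "trace_norm A = (\<Sum>a<n. \<bar>l a\<bar>)" using assms(1) by (rule hermitian_spectral)
  have le: "cmod (u a k) \<le> 1" if "a < n" "k < n" for a k
  proof -
    have "complex_of_real (\<Sum>k<n. (cmod (u a k))\<^sup>2) = (\<Sum>k<n. cnj (u a k) * u a k)"
      by (simp add: cnj_mult_self)
    also have "\<dots> = 1" using on that by (simp add: orthonormal_def)
    finally have "complex_of_real (\<Sum>k<n. (cmod (u a k))\<^sup>2) = 1" .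
    hence "(\<Sum>k<n. (cmod (u a k))\<^sup>2) = 1" by (simp only: of_real_eq_1_iff)
    moreover have "(cmod (u a k))\<^sup>2 \<le> (\<Sum>k<n. (cmod (u a k))\<^sup>2)"
      using that by (intro member_le_sum) auto
    ultimately show ?thesis by (simp add: abs_square_le_1)
  qed
  have "cmod (A $$ (i, j)) \<le> (\<Sum>a<n. cmod (complex_of_real (l a) * u a i * cnj (u a j)))"
    using assms unfolding A by (simp add: spectral_mat_def norm_sum)
  also have "\<dots> \<le> (\<Sum>a<n. \<bar>l a\<bar>)"
  proof (rule sum_mono)
    fix a assume "a \<in> {..<n}"
    hence "cmod (u a i) * cmod (u a j) \<le> 1" using le assms by (intro mult_le_one) auto
    hence "\<bar>l a\<bar> * (cmod (u a i) * cmod (u a j)) \<le> \<bar>l a\<bar> * 1" by (intro mult_left_mono) auto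
    thus "cmod (complex_of_real (l a) * u a i * cnj (u a j)) \<le> \<bar>l a\<bar>"
      by (simp add: norm_mult mult.assoc)
  qed
  finally show ?thesis by (simp add: tn)
qed

lemma abs_qform_le_trace_norm:
  assumes "hermitian n A" "(\<Sum>i<n. (cmod (f i))\<^sup>2) = 1"
  shows "\<bar>Re (qform n A f)\<bar> \<le> trace_norm A"
proof -
  obtain u l where on: "orthonormal n u" and A: "A = spectral_mat n u l"
    and tn: "trace_norm A = (\<Sum>a<n. \<bar>l a\<bar>)" using assms(1) by (rule hermitian_spectral)
  have le: "(cmod (coef n u f a))\<^sup>2 \<le> 1" if "a < n" for a
    using that assms(2) unfolding parseval_norm[OF on, of f, symmetric]
    by (metis (no_types, lifting) finite_lessThan lessThan_iff member_le_sum zero_le_power2)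
  have "\<bar>Re (qform n A f)\<bar> \<le> (\<Sum>a<n. \<bar>l a * (cmod (coef n u f a))\<^sup>2\<bar>)"
    unfolding A qform_spectral by (simp add: sum_abs)
  also have "\<dots> \<le> (\<Sum>a<n. \<bar>l a\<bar>)"
  proof (rule sum_mono)
    fix a assume "a \<in> {..<n}"
    hence "\<bar>l a\<bar> * (cmod (coef n u f a))\<^sup>2 \<le> \<bar>l a\<bar> * 1" using le by (intro mult_left_mono) auto
    thus "\<bar>l a * (cmod (coef n u f a))\<^sup>2\<bar> \<le> \<bar>l a\<bar>" by (simp add: abs_mult)
  qed
  finally show ?thesis by (simp add: tn)
qed

section \<open>Decomposition into rank-one operators\<close>

definition rank_one :: "nat \<Rightarrow> (nat \<Rightarrow> complex) \<Rightarrow> complex mat" where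
  "rank_one n f = mat n n (\<lambda>(i, j). f i * cnj (f j))"

lemma rank_one_carrier [simp]: "rank_one n f \<in> carrier_mat n n"
  by (simp add: rank_one_def)

lemma qform_rank_one: "qform n (rank_one n f) v = complex_of_real ((cmod (\<Sum>i<n. cnj (v i) * f i))\<^sup>2)"
proof -
  have "qform n (rank_one n f) v = (\<Sum>i<n. cnj (v i) * f i) * (\<Sum>j<n. cnj (f j) * v j)"
    unfolding sum_product by (simp add: qform_def rank_one_def mult_ac)
  also have "(\<Sum>j<n. cnj (f j) * v j) = cnj (\<Sum>i<n. cnj (v i) * f i)"
    by (simp add: mult.commute)
  finally show ?thesis by (simp only: complex_norm_square)
qed

lemma rank_one_psd: "psd n (rank_one n f)"
  by (auto simp: psd_iff qform_rank_one less_eq_complex_def)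

text \<open>The roots of the eigenvalues are absorbed into the eigenvectors. Estimates that are
  linear in a state thereby reduce to unnormalised vectors \<open>g k\<close>.\<close>

lemma psd_decomposition:
  assumes "psd n A"
  obtains g :: "nat \<Rightarrow> nat \<Rightarrow> complex"
  where "\<And>i j. i < n \<Longrightarrow> j < n \<Longrightarrow> A $$ (i, j) = (\<Sum>k<n. g k i * cnj (g k j))"
proof -
  obtain u l where on: "orthonormal n u" and A: "A = spectral_mat n u l"
    using psd_hermitian[OF assms] by (rule hermitian_spectral)
  have pos: "l a \<ge> 0" if "a < n" for a
  proof -
    have "0 \<le> qform n A (u a)" using assms by (simp add: psd_iff)
    thus ?thesis using qform_eigenvector[OF on that, of l] by (simp add: A less_eq_complex_def)
  qed
  define g where "g a i = complex_of_real (sqrt (l a)) * u a i" for a i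
  have "A $$ (i, j) = (\<Sum>k<n. g k i * cnj (g k j))" if "i < n" "j < n" for i j
  proof -
    have "complex_of_real (l a) * u a i * cnj (u a j) = g a i * cnj (g a j)" if "a < n" for a
    proof -
      have "complex_of_real (l a) = complex_of_real (sqrt (l a)) * complex_of_real (sqrt (l a))"
        using pos[OF that] by (simp flip: of_real_mult)
      thus ?thesis by (simp add: g_def mult_ac)
    qed
    thus ?thesis using that by (simp add: A spectral_mat_def)
  qed
  thus ?thesis using that by blast
qed

lemma qform_mat_sum: "qform n (mat_sum n q F) v = (\<Sum>x<q. qform n (F x) v)"
proof -
  have "qform n (mat_sum n q F) v = (\<Sum>i<n. \<Sum>j<n. \<Sum>x<q. cnj (v i) * F x $$ (i, j) * v j)"
    by (simp add: qform_def mat_sum_def sum_distrib_left sum_distrib_right)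
  also have "\<dots> = (\<Sum>i<n. \<Sum>x<q. \<Sum>j<n. cnj (v i) * F x $$ (i, j) * v j)"
    by (intro sum.cong refl sum.swap)
  also have "\<dots> = (\<Sum>x<q. qform n (F x) v)"
    by (subst sum.swap) (simp add: qform_def)
  finally show ?thesis .
qed

lemma qform_decomposition:
  fixes q :: nat
  assumes "\<And>i j. i < n \<Longrightarrow> j < n \<Longrightarrow> A $$ (i, j) = (\<Sum>k<q. g k i * cnj (g k j))"
  shows "qform n A v = complex_of_real (\<Sum>k<q. (cmod (\<Sum>i<n. cnj (v i) * g k i))\<^sup>2)"
proof -
  have "qform n A v = qform n (mat_sum n q (\<lambda>k. rank_one n (g k))) v"
    using assms by (simp add: qform_def mat_sum_def rank_one_def)
  thus ?thesis by (simp add: qform_mat_sum qform_rank_one)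
qed

section \<open>Trace distance and fidelity with a pure state\<close>

lemma complex_cauchy_schwarz:
  fixes f g :: "'a \<Rightarrow> complex"
  shows "(cmod (\<Sum>i\<in>S. f i * g i))\<^sup>2 \<le> (\<Sum>i\<in>S. (cmod (f i))\<^sup>2) * (\<Sum>i\<in>S. (cmod (g i))\<^sup>2)"
proof -
  have "(cmod (\<Sum>i\<in>S. f i * g i))\<^sup>2 \<le> (\<Sum>i\<in>S. cmod (f i) * cmod (g i))\<^sup>2"
    by (intro power_mono order_trans[OF norm_sum]) (simp_all add: norm_mult)
  also have "\<dots> \<le> (\<Sum>i\<in>S. (cmod (f i))\<^sup>2) * (\<Sum>i\<in>S. (cmod (g i))\<^sup>2)"
    by (rule Cauchy_Schwarz_ineq_sum)
  finally show ?thesis .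
qed

text \<open>Scalar core of the Fuchs-van de Graaf inequality. Here \<open>c\<close> and
  \<open>T\<close> are the probabilities of one outcome in the pure and in the mixed state, and
  \<open>p k\<close>, \<open>q k\<close> bound the parts of the overlap with the \<open>k\<close>-th
  component. The mixed term is estimated by
  \<open>2 * sqrt (c * c' * T * T') \<le> c * c' + T * T'\<close>, and
  \<open>c * T + c' * T' + c * c' + T * T'\<close> is exactly
  \<open>1 - (c - T)\<^sup>2\<close>.\<close>

lemma two_outcome_fidelity:
  fixes p q t t' :: "nat \<Rightarrow> real"
  assumes "c \<ge> 0" "c' \<ge> 0" "c + c' = 1" "T + T' = 1" "T \<ge> 0" "T' \<ge> 0"
    and T: "T = (\<Sum>k<n. t k)" "T' = (\<Sum>k<n. t' k)"
    and p: "\<And>k. (p k)\<^sup>2 \<le> c * t k" and q: "\<And>k. (q k)\<^sup>2 \<le> c' * t' k"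
  shows "(\<Sum>k<n. (p k + q k)\<^sup>2) \<le> 1 - (c - T)\<^sup>2"
proof -
  have P: "(\<Sum>k<n. (p k)\<^sup>2) \<le> c * T" and Q: "(\<Sum>k<n. (q k)\<^sup>2) \<le> c' * T'"
    using p q by (auto simp: T sum_distrib_left intro!: sum_mono)
  have nonneg: "0 \<le> (\<Sum>k<n. (p k)\<^sup>2)" "0 \<le> (\<Sum>k<n. (q k)\<^sup>2)" by (simp_all add: sum_nonneg)
  have "(\<Sum>k<n. p k * q k)\<^sup>2 \<le> (\<Sum>k<n. (p k)\<^sup>2) * (\<Sum>k<n. (q k)\<^sup>2)"
    by (rule Cauchy_Schwarz_ineq_sum)
  also have "\<dots> \<le> (c * T) * (c' * T')"
    using P Q nonneg by (intro mult_mono) auto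
  also have "\<dots> \<le> ((c * c' + T * T') / 2)\<^sup>2"
  proof -
    have "((c * c' + T * T') / 2)\<^sup>2 - (c * T) * (c' * T') = ((c * c' - T * T') / 2)\<^sup>2"
      by (simp add: power2_eq_square field_simps)
    thus ?thesis by (metis diff_ge_0_iff_ge zero_le_power2)
  qed
  finally have "\<bar>\<Sum>k<n. p k * q k\<bar> \<le> \<bar>(c * c' + T * T') / 2\<bar>"
    by (simp only: abs_le_square_iff)
  moreover have "(c * c' + T * T') / 2 \<ge> 0" using assms(1-6) by simp
  ultimately have pq: "2 * (\<Sum>k<n. p k * q k) \<le> c * c' + T * T'"
    using abs_ge_self[of "\<Sum>k<n. p k * q k"] by (simp add: abs_of_nonneg)
  have "(\<Sum>k<n. (p k + q k)\<^sup>2) = (\<Sum>k<n. (p k)\<^sup>2) + (\<Sum>k<n. (q k)\<^sup>2) + 2 * (\<Sum>k<n. p k * q k)"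
    by (simp add: power2_sum sum.distrib sum_distrib_left mult.assoc)
  also have "\<dots> \<le> c * T + c' * T' + (c * c' + T * T')" using P Q pq by linarith
  also have "\<dots> = 1 - (c - T)\<^sup>2"
  proof -
    have *: "c' = 1 - c" "T' = 1 - T" using assms(3,4) by simp_all
    show ?thesis unfolding * by (simp add: power2_eq_square algebra_simps)
  qed
  finally show ?thesis .
qed

lemma qform_diff:
  assumes "A \<in> carrier_mat n n" "B \<in> carrier_mat n n"
  shows "qform n (A - B) v = qform n A v - qform n B v"
  using assms by (simp add: qform_def sum_subtractf left_diff_distrib right_diff_distrib)

lemma hermitian_diff:
  assumes "hermitian n A" "hermitian n B"
  shows "hermitian n (A - B)"
proof -
  have c: "A \<in> carrier_mat n n" "B \<in> carrier_mat n n" using assms unfolding hermitian_def by blast+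
  have "(A - B) $$ (j, i) = cnj ((A - B) $$ (i, j))" if "i < n" "j < n" for i j
  proof -
    have "A $$ (j, i) = cnj (A $$ (i, j))" "B $$ (j, i) = cnj (B $$ (i, j))"
      using assms that unfolding hermitian_def by blast+
    thus ?thesis using c that by (simp only: index_minus_mat carrier_matD complex_cnj_diff)
  qed
  thus ?thesis using c unfolding hermitian_def by (meson minus_carrier_mat)
qed

text \<open>The projection onto the negative eigenspace of the difference is an optimal two-outcome
  measurement: its probabilities in the two states differ by half the trace norm. The fidelity can
  only increase when the overlap is split along this measurement, so the scalar estimate
  applies.\<close>

lemma trace_norm_pure_le:
  assumes \<omega>: "psd n \<omega>" and tr: "mat_trace \<omega> = 1" and \<phi>: "(\<Sum>i<n. (cmod (\<phi> i))\<^sup>2) = 1"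
  shows "1/2 * trace_norm (\<omega> - rank_one n \<phi>) \<le> sqrt (1 - Re (qform n \<omega> \<phi>))"
proof -
  have \<omega>c: "\<omega> \<in> carrier_mat n n" using \<omega> by (simp add: psd_iff)
  have "hermitian n (\<omega> - rank_one n \<phi>)"
    using \<omega> rank_one_psd by (intro hermitian_diff psd_hermitian)
  then obtain u l where on: "orthonormal n u" and X: "\<omega> - rank_one n \<phi> = spectral_mat n u l"
    and tn: "trace_norm (\<omega> - rank_one n \<phi>) = (\<Sum>a<n. \<bar>l a\<bar>)" by (rule hermitian_spectral)
  obtain g where g: "\<And>i j. i < n \<Longrightarrow> j < n \<Longrightarrow> \<omega> $$ (i, j) = (\<Sum>k<n. g k i * cnj (g k j))"
    using psd_decomposition[OF \<omega>] by blast
  have q\<omega>: "qform n \<omega> v = complex_of_real (\<Sum>k<n. (cmod (\<Sum>i<n. cnj (v i) * g k i))\<^sup>2)" for v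
    by (rule qform_decomposition) (rule g)
  define N where "N = {a. a < n \<and> l a < 0}"
  define N' where "N' = {a. a < n \<and> \<not> l a < 0}"
  have N: "{..<n} = N \<union> N'" "N \<inter> N' = {}" "finite N" "finite N'" by (auto simp: N_def N'_def)
  have split: "(\<Sum>a<n. h a) = (\<Sum>a\<in>N. h a) + (\<Sum>a\<in>N'. h a)" for h :: "nat \<Rightarrow> 'b :: comm_monoid_add"
    unfolding N(1) using N by (intro sum.union_disjoint) auto
  define c where "c = (\<Sum>a\<in>N. (cmod (coef n u \<phi> a))\<^sup>2)"
  define c' where "c' = (\<Sum>a\<in>N'. (cmod (coef n u \<phi> a))\<^sup>2)"
  define t where "t k = (\<Sum>a\<in>N. (cmod (coef n u (g k) a))\<^sup>2)" for k
  define t' where "t' k = (\<Sum>a\<in>N'. (cmod (coef n u (g k) a))\<^sup>2)" for k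
  define T where "T = (\<Sum>k<n. t k)"
  define T' where "T' = (\<Sum>k<n. t' k)"
  define p where "p k = cmod (\<Sum>a\<in>N. cnj (coef n u \<phi> a) * coef n u (g k) a)" for k
  define q where "q k = cmod (\<Sum>a\<in>N'. cnj (coef n u \<phi> a) * coef n u (g k) a)" for k
  have cc: "c + c' = 1"
    using parseval_norm[OF on, of \<phi>] \<phi> by (simp add: c_def c'_def split)
  have "complex_of_real (\<Sum>i<n. \<Sum>k<n. (cmod (g k i))\<^sup>2) = mat_trace \<omega>"
    using \<omega>c by (simp add: mat_trace_def g flip: complex_norm_square)
  hence "(\<Sum>i<n. \<Sum>k<n. (cmod (g k i))\<^sup>2) = 1" unfolding tr by (simp only: of_real_eq_1_iff)
  moreover have "t k + t' k = (\<Sum>i<n. (cmod (g k i))\<^sup>2)" for k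
    by (simp only: t_def t'_def split[symmetric] parseval_norm[OF on])
  hence "T + T' = (\<Sum>k<n. \<Sum>i<n. (cmod (g k i))\<^sup>2)"
    by (simp only: T_def T'_def sum.distrib[symmetric])
  moreover have "(\<Sum>k<n. \<Sum>i<n. (cmod (g k i))\<^sup>2) = (\<Sum>i<n. \<Sum>k<n. (cmod (g k i))\<^sup>2)" by (rule sum.swap)
  ultimately have TT: "T + T' = 1" by simp
  have l: "l a = (\<Sum>k<n. (cmod (coef n u (g k) a))\<^sup>2) - (cmod (coef n u \<phi> a))\<^sup>2" if "a < n" for a
  proof -
    have "complex_of_real (l a) = qform n \<omega> (u a) - qform n (rank_one n \<phi>) (u a)"
      using qform_eigenvector[OF on that, of l] by (simp add: qform_diff \<omega>c flip: X)
    also have "\<dots> = complex_of_real ((\<Sum>k<n. (cmod (coef n u (g k) a))\<^sup>2) - (cmod (coef n u \<phi> a))\<^sup>2)"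
      unfolding q\<omega> qform_rank_one by (simp add: coef_def)
    finally show ?thesis by (simp only: of_real_eq_iff)
  qed
  have "(\<Sum>a\<in>N. l a) = (\<Sum>a\<in>N. \<Sum>k<n. (cmod (coef n u (g k) a))\<^sup>2) - c"
    using l by (simp add: N_def c_def sum_subtractf)
  also have "(\<Sum>a\<in>N. \<Sum>k<n. (cmod (coef n u (g k) a))\<^sup>2) = T"
    by (simp add: T_def t_def sum.swap[of _ N])
  finally have lN: "(\<Sum>a\<in>N. l a) = T - c" .
  have "mat_trace (rank_one n \<phi>) = complex_of_real (\<Sum>i<n. (cmod (\<phi> i))\<^sup>2)"
    by (simp add: mat_trace_def rank_one_def flip: complex_norm_square)
  moreover have "mat_trace (\<omega> - rank_one n \<phi>) = mat_trace \<omega> - mat_trace (rank_one n \<phi>)"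
    using \<omega>c by (simp add: mat_trace_def sum_subtractf rank_one_def)
  ultimately have "complex_of_real (\<Sum>a<n. l a) = 0"
    using mat_trace_spectral[OF on, of l] tr \<phi> by (simp add: X)
  hence "(\<Sum>a<n. l a) = 0" by (simp only: of_real_eq_0_iff)
  \<comment> \<open>The difference has trace zero, so its negative and its positive part contribute
    equally to the trace norm.\<close>
  hence lN': "(\<Sum>a\<in>N'. l a) = c - T" using lN split[of l] by simp
  have "(\<Sum>a<n. \<bar>l a\<bar>) = (\<Sum>a\<in>N. - l a) + (\<Sum>a\<in>N'. l a)"
    unfolding split by (intro arg_cong2[of _ _ _ _ "(+)"] sum.cong) (auto simp: N_def N'_def)
  hence norm: "1/2 * trace_norm (\<omega> - rank_one n \<phi>) = c - T"
    using lN lN' by (simp add: tn sum_negf)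
  have "Re (qform n \<omega> \<phi>) = (\<Sum>k<n. (cmod (\<Sum>a<n. cnj (coef n u \<phi> a) * coef n u (g k) a))\<^sup>2)"
    by (simp add: q\<omega> parseval[OF on])
  also have "\<dots> \<le> (\<Sum>k<n. (p k + q k)\<^sup>2)"
  proof (intro sum_mono power_mono)
    show "cmod (\<Sum>a<n. cnj (coef n u \<phi> a) * coef n u (g k) a) \<le> p k + q k" for k
      unfolding split p_def q_def by (rule norm_triangle_ineq)
  qed simp
  also have "\<dots> \<le> 1 - (c - T)\<^sup>2"
  proof (rule two_outcome_fidelity[where T = T and T' = T' and t = t and t' = t', OF _ _ cc TT])
    show "(p k)\<^sup>2 \<le> c * t k" for k
      using complex_cauchy_schwarz[of "\<lambda>a. cnj (coef n u \<phi> a)" "coef n u (g k)" N] by (simp add: p_def c_def t_def)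
    show "(q k)\<^sup>2 \<le> c' * t' k" for k
      using complex_cauchy_schwarz[of "\<lambda>a. cnj (coef n u \<phi> a)" "coef n u (g k)" N'] by (simp add: q_def c'_def t'_def)
  qed (auto simp: T_def T'_def t_def t'_def c_def c'_def intro!: sum_nonneg)
  finally have "(c - T)\<^sup>2 \<le> 1 - Re (qform n \<omega> \<phi>)" by simp
  thus ?thesis unfolding norm by (rule real_le_rsqrt)
qed

text \<open>The infidelity is minus the quadratic form of the difference at \<phi>. The bound is by
  twice the trace distance, which is where a factor 2 in the final choice of constants comes
  from.\<close>

lemma fidelity_ge:
  assumes "psd n \<omega>" and \<phi>: "(\<Sum>i<n. (cmod (\<phi> i))\<^sup>2) = 1"
  shows "1 - Re (qform n \<omega> \<phi>) \<le> trace_norm (\<omega> - rank_one n \<phi>)"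
proof -
  have "hermitian n (\<omega> - rank_one n \<phi>)"
    using assms rank_one_psd by (intro hermitian_diff psd_hermitian)
  hence "\<bar>Re (qform n (\<omega> - rank_one n \<phi>) \<phi>)\<bar> \<le> trace_norm (\<omega> - rank_one n \<phi>)"
    by (rule abs_qform_le_trace_norm[OF _ \<phi>])
  moreover have "qform n (rank_one n \<phi>) \<phi> = 1"
  proof -
    have "(\<Sum>i<n. cnj (\<phi> i) * \<phi> i) = complex_of_real (\<Sum>i<n. (cmod (\<phi> i))\<^sup>2)"
      by (simp add: cnj_mult_self)
    thus ?thesis unfolding qform_rank_one \<phi> by simp
  qed
  ultimately show ?thesis using assms(1) by (simp add: qform_diff psd_iff)
qed

section \<open>Properties of LOCC maps\<close>

lemma sum_mult_index: "(\<Sum>I<m * k. f I) = (\<Sum>i<m. \<Sum>c<k. f (i * k + c))" for k m :: nat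
proof -
  have "(\<Sum>I<m * k. f I) = (\<Sum>i<m. sum f {i * k..<i * k + k})"
    by (simp add: sum.nat_group)
  also have "\<dots> = (\<Sum>i<m. \<Sum>c<k. f (i * k + c))"
  proof (rule sum.cong[OF refl])
    fix i
    have "sum f {i * k..<i * k + k} = sum f {0 + i * k..<k + i * k}" by (simp add: add.commute)
    also have "\<dots> = (\<Sum>c\<in>{0..<k}. f (c + i * k))" by (rule sum.shift_bounds_nat_ivl)
    finally show "sum f {i * k..<i * k + k} = (\<Sum>c<k. f (i * k + c))"
      by (simp add: add.commute atLeast0LessThan)
  qed
  finally show ?thesis .
qed

lemma mat_trace_carrier: "A \<in> carrier_mat n n \<Longrightarrow> mat_trace A = (\<Sum>i<n. A $$ (i, i))"
  by (simp add: mat_trace_def)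

lemma index_less: "i < m \<Longrightarrow> c < k \<Longrightarrow> i * k + c < m * k" for i m c k :: nat
proof -
  assume "i < m" "c < k"
  hence "i * k + c < Suc i * k" by simp
  also have "\<dots> \<le> m * k" using \<open>i < m\<close> by (intro mult_right_mono) auto
  finally show ?thesis .
qed

lemma div_less_index: "I < m * k \<Longrightarrow> I div k < m" for I m k :: nat
  by (simp add: less_mult_imp_div_less)

lemma mod_less_index: "I < m * k \<Longrightarrow> I mod k < k" for I m k :: nat
  by (cases "k = 0") auto

text \<open>\<open>T\<close> is the kernel of a possibly rectangular operator, and the matrix is its
  congruence applied to \<open>A\<close>; testing it at \<open>v\<close> means testing
  \<open>A\<close> at the adjoint of \<open>T\<close> applied to \<open>v\<close>. Relabelling and
  Kraus maps are instances.\<close>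

lemma psd_congruence:
  assumes A: "psd N A"
  shows "psd n (mat n n (\<lambda>(i, j). \<Sum>I<N. \<Sum>J<N. T i I * A $$ (I, J) * cnj (T j J)))" (is "psd n ?M")
proof -
  have "0 \<le> qform n ?M v" for v
  proof -
    define w where "w J = (\<Sum>j<n. cnj (T j J) * v j)" for J
    define r where "r I = (\<Sum>J<N. A $$ (I, J) * w J)" for I
    have r: "(\<Sum>I<N. T i I * r I) = (\<Sum>j<n. ?M $$ (i, j) * v j)" if "i < n" for i
    proof -
      have "(\<Sum>I<N. T i I * r I) = (\<Sum>I<N. \<Sum>J<N. \<Sum>j<n. T i I * A $$ (I, J) * cnj (T j J) * v j)"
        by (simp add: r_def w_def sum_distrib_left mult.assoc)
      also have "\<dots> = (\<Sum>I<N. \<Sum>j<n. \<Sum>J<N. T i I * A $$ (I, J) * cnj (T j J) * v j)"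
        by (intro sum.cong refl sum.swap)
      also have "\<dots> = (\<Sum>j<n. \<Sum>I<N. \<Sum>J<N. T i I * A $$ (I, J) * cnj (T j J) * v j)"
        by (rule sum.swap)
      also have "\<dots> = (\<Sum>j<n. ?M $$ (i, j) * v j)"
        using that by (simp add: sum_distrib_right)
      finally show ?thesis .
    qed
    have "qform N A w = (\<Sum>I<N. cnj (w I) * r I)"
      by (simp add: qform_def r_def sum_distrib_left mult.assoc)
    also have "\<dots> = (\<Sum>I<N. \<Sum>i<n. cnj (v i) * (T i I * r I))"
      by (simp add: w_def sum_distrib_left sum_distrib_right mult_ac)
    also have "\<dots> = (\<Sum>i<n. cnj (v i) * (\<Sum>I<N. T i I * r I))"
      by (subst sum.swap) (simp add: sum_distrib_left)
    also have "\<dots> = (\<Sum>i<n. cnj (v i) * (\<Sum>j<n. ?M $$ (i, j) * v j))"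
      by (intro sum.cong refl) (simp only: r lessThan_iff)
    also have "\<dots> = qform n ?M v" by (simp only: qform_def sum_distrib_left mult.assoc)
    finally show ?thesis using A by (metis psd_iff)
  qed
  thus ?thesis by (simp add: psd_iff)
qed

lemma delta_sum2:
  fixes g :: "nat \<Rightarrow> nat \<Rightarrow> complex"
  assumes "a < n" "b < n"
  shows "(\<Sum>p<n. \<Sum>q<n. (if p = a then 1 else 0) * g p q * cnj (if q = b then 1 else 0)) = g a b"
proof -
  have "(\<Sum>q<n. (if p = a then 1 else 0) * g p q * cnj (if q = b then 1 else 0)) = (if p = a then g p b else 0)" for p
  proof -
    have "(\<Sum>q<n. (if p = a then 1 else 0) * g p q * cnj (if q = b then 1 else 0)) =
      (\<Sum>q<n. if q = b then if p = a then g p q else 0 else 0)"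
      by (intro sum.cong refl) auto
    thus ?thesis using assms(2) by simp
  qed
  thus ?thesis using assms(1) by simp
qed

lemma psd_reindex:
  assumes A: "psd N A" and s: "\<And>i. i < n \<Longrightarrow> s i < N"
  shows "psd n (mat n n (\<lambda>(i, j). A $$ (s i, s j)))"
proof -
  have "mat n n (\<lambda>(i, j). A $$ (s i, s j)) = mat n n (\<lambda>(i, j). \<Sum>I<N. \<Sum>J<N.
      (if I = s i then 1 else 0) * A $$ (I, J) * cnj (if J = s j then 1 else 0))"
    using s by (intro eq_matI) (simp_all only: index_mat split dim_row_mat dim_col_mat delta_sum2)
  thus ?thesis using psd_congruence[OF A, of n "\<lambda>i I. if I = s i then 1 else 0"] by simp
qed

section \<open>Maps applied to one tensor factor\<close>

lemma linear_map_carrier: "linear_map n m \<Phi> \<Longrightarrow> X \<in> carrier_mat n n \<Longrightarrow> \<Phi> X \<in> carrier_mat m m"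
  and linear_map_add: "linear_map n m \<Phi> \<Longrightarrow> X \<in> carrier_mat n n \<Longrightarrow> Y \<in> carrier_mat n n \<Longrightarrow> \<Phi> (X + Y) = \<Phi> X + \<Phi> Y"
  and linear_map_smult: "linear_map n m \<Phi> \<Longrightarrow> X \<in> carrier_mat n n \<Longrightarrow> \<Phi> (c \<cdot>\<^sub>m X) = c \<cdot>\<^sub>m \<Phi> X"
  by (simp_all add: linear_map_def)

lemma on_left_carrier [simp]: "on_left n m k \<Phi> X \<in> carrier_mat (m * k) (m * k)"
  by (simp add: on_left_def)

lemma on_right_carrier [simp]: "on_right n m k \<Phi> X \<in> carrier_mat (k * m) (k * m)"
  by (simp add: on_right_def)

lemma on_left_linear:
  assumes "linear_map n m \<Phi>"
  shows "linear_map (n * k) (m * k) (on_left n m k \<Phi>)"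
proof -
  have 1: "on_left n m k \<Phi> (X + Y) = on_left n m k \<Phi> X + on_left n m k \<Phi> Y"
    if "X \<in> carrier_mat (n * k) (n * k)" "Y \<in> carrier_mat (n * k) (n * k)" for X Y
  proof (rule eq_matI)
    fix i j assume "i < dim_row (on_left n m k \<Phi> X + on_left n m k \<Phi> Y)"
      "j < dim_col (on_left n m k \<Phi> X + on_left n m k \<Phi> Y)"
    hence ij: "i < m * k" "j < m * k" by (simp_all add: on_left_def)
    let ?B = "\<lambda>X. mat n n (\<lambda>(p, q). X $$ (p * k + i mod k, q * k + j mod k))"
    have "?B (X + Y) = ?B X + ?B Y"
      using that ij by (intro eq_matI) (auto intro!: index_add_mat simp: index_less mod_less_index)
    thus "on_left n m k \<Phi> (X + Y) $$ (i, j) = (on_left n m k \<Phi> X + on_left n m k \<Phi> Y) $$ (i, j)"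
      using ij linear_map_carrier[OF assms, of "?B Y"]
      by (simp add: on_left_def linear_map_add[OF assms] div_less_index)
  qed (simp_all add: on_left_def)
  have 2: "on_left n m k \<Phi> (c \<cdot>\<^sub>m X) = c \<cdot>\<^sub>m on_left n m k \<Phi> X"
    if "X \<in> carrier_mat (n * k) (n * k)" for c X
  proof (rule eq_matI)
    fix i j assume "i < dim_row (c \<cdot>\<^sub>m on_left n m k \<Phi> X)" "j < dim_col (c \<cdot>\<^sub>m on_left n m k \<Phi> X)"
    hence ij: "i < m * k" "j < m * k" by (simp_all add: on_left_def)
    let ?B = "\<lambda>X. mat n n (\<lambda>(p, q). X $$ (p * k + i mod k, q * k + j mod k))"
    have "?B (c \<cdot>\<^sub>m X) = c \<cdot>\<^sub>m ?B X"
      using that ij by (intro eq_matI) (auto intro!: index_smult_mat simp: index_less mod_less_index)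
    thus "on_left n m k \<Phi> (c \<cdot>\<^sub>m X) $$ (i, j) = (c \<cdot>\<^sub>m on_left n m k \<Phi> X) $$ (i, j)"
      using ij linear_map_carrier[OF assms, of "?B X"]
      by (simp add: on_left_def linear_map_smult[OF assms] div_less_index)
  qed (simp_all add: on_left_def)
  show ?thesis using 1 2 by (simp add: linear_map_def)
qed

definition flip_index :: "nat \<Rightarrow> nat \<Rightarrow> nat \<Rightarrow> nat" where
  "flip_index n k I = (I mod k) * n + I div k"

lemma flip_index_less: "I < n * k \<Longrightarrow> flip_index n k I < k * n"
  by (simp add: flip_index_def index_less div_less_index mod_less_index)

definition flip_mat :: "nat \<Rightarrow> nat \<Rightarrow> complex mat \<Rightarrow> complex mat" where
  "flip_mat n k X = mat (n * k) (n * k) (\<lambda>(I, J). X $$ (flip_index n k I, flip_index n k J))"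

lemma flip_mat_carrier [simp]: "flip_mat n k X \<in> carrier_mat (n * k) (n * k)"
  by (simp add: flip_mat_def)

text \<open>Bob's operations are Alice's between two exchanges of the factors, so linearity,
  positivity and trace need to be treated only on the left.\<close>

lemma on_right_eq: "on_right n m k \<Phi> X = flip_mat k m (on_left n m k \<Phi> (flip_mat n k X))"
proof (rule eq_matI)
  fix i j assume "i < dim_row (flip_mat k m (on_left n m k \<Phi> (flip_mat n k X)))"
    "j < dim_col (flip_mat k m (on_left n m k \<Phi> (flip_mat n k X)))"
  hence ij: "i < k * m" "j < k * m" by (simp_all add: flip_mat_def)
  note b = div_less_index[OF ij(1)] div_less_index[OF ij(2)]
  have f: "flip_index k m i mod k = i div m" "flip_index k m i div k = i mod m"
    "flip_index k m j mod k = j div m" "flip_index k m j div k = j mod m"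
    using b by (simp_all add: flip_index_def)
  have "mat n n (\<lambda>(p, q). X $$ (i div m * n + p, j div m * n + q)) =
    mat n n (\<lambda>(p, q). flip_mat n k X $$ (p * k + i div m, q * k + j div m))"
    using b by (intro eq_matI) (auto simp: flip_mat_def flip_index_def index_less)
  thus "on_right n m k \<Phi> X $$ (i, j) = flip_mat k m (on_left n m k \<Phi> (flip_mat n k X)) $$ (i, j)"
    using ij flip_index_less[of i k m] flip_index_less[of j k m]
    by (simp add: on_right_def on_left_def flip_mat_def[of k m] f)
qed (simp_all add: on_right_def flip_mat_def)

lemma flip_mat_psd: "psd (k * n) X \<Longrightarrow> psd (n * k) (flip_mat n k X)"
  unfolding flip_mat_def by (rule psd_reindex) (auto simp: flip_index_less)

lemma flip_mat_linear: "linear_map (k * n) (n * k) (flip_mat n k)"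
  unfolding linear_map_def by (auto intro!: eq_matI simp: flip_mat_def flip_index_less)

lemma flip_mat_trace:
  assumes "X \<in> carrier_mat (k * n) (k * n)"
  shows "mat_trace (flip_mat n k X) = mat_trace X"
proof -
  have "mat_trace (flip_mat n k X) = (\<Sum>i<n. \<Sum>c<k. X $$ (c * n + i, c * n + i))"
    by (simp add: mat_trace_def flip_mat_def sum_mult_index flip_index_def index_less)
  also have "\<dots> = mat_trace X"
    using assms by (subst sum.swap) (simp add: mat_trace_def sum_mult_index)
  finally show ?thesis .
qed

lemma linear_map_comp:
  "linear_map n m \<Phi> \<Longrightarrow> linear_map m k \<Psi> \<Longrightarrow> linear_map n k (\<lambda>X. \<Psi> (\<Phi> X))"
  by (simp add: linear_map_def)

lemma on_right_linear:
  assumes "linear_map n m \<Phi>"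
  shows "linear_map (k * n) (k * m) (on_right n m k \<Phi>)"
  unfolding on_right_eq
  by (intro linear_map_comp[OF linear_map_comp[OF flip_mat_linear on_left_linear[OF assms]] flip_mat_linear])

lemma on_left_psd: "completely_positive n m \<Phi> \<Longrightarrow> psd (n * k) X \<Longrightarrow> psd (m * k) (on_left n m k \<Phi> X)"
  by (simp add: completely_positive_def)

lemma on_right_psd: "completely_positive n m \<Phi> \<Longrightarrow> psd (k * n) X \<Longrightarrow> psd (k * m) (on_right n m k \<Phi> X)"
  unfolding on_right_eq by (intro flip_mat_psd on_left_psd)

lemma instrument_linear: "instrument n m q I \<Longrightarrow> x < q \<Longrightarrow> linear_map n m (I x)"
  by (simp add: instrument_def completely_positive_def)

text \<open>Only the blocks \<open>B c\<close> that are diagonal in the untouched system contribute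
  to the trace, and the instrument preserves the trace of each.\<close>

lemma instrument_trace_left:
  assumes I: "instrument n m q I" and X: "X \<in> carrier_mat (n * k) (n * k)"
  shows "(\<Sum>x<q. mat_trace (on_left n m k (I x) X)) = mat_trace X"
proof -
  define B where "B c = mat n n (\<lambda>(p, q). X $$ (p * k + c, q * k + c))" for c
  have Bc: "B c \<in> carrier_mat n n" for c by (simp add: B_def)
  have "mat_trace (on_left n m k (I x) X) = (\<Sum>c<k. mat_trace (I x (B c)))" if "x < q" for x
  proof -
    have "mat_trace (on_left n m k (I x) X) = (\<Sum>i<m. \<Sum>c<k. I x (B c) $$ (i, i))"
      by (simp add: mat_trace_def on_left_def sum_mult_index index_less B_def)
    also have "\<dots> = (\<Sum>c<k. mat_trace (I x (B c)))"
      using linear_map_carrier[OF instrument_linear[OF I that] Bc]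
      by (subst sum.swap) (simp add: mat_trace_carrier[of _ m])
    finally show ?thesis .
  qed
  hence "(\<Sum>x<q. mat_trace (on_left n m k (I x) X)) = (\<Sum>x<q. \<Sum>c<k. mat_trace (I x (B c)))"
    by simp
  also have "\<dots> = (\<Sum>c<k. \<Sum>x<q. mat_trace (I x (B c)))" by (rule sum.swap)
  also have "\<dots> = (\<Sum>c<k. mat_trace (B c))"
    using I Bc by (simp add: instrument_def)
  also have "\<dots> = (\<Sum>c<k. \<Sum>p<n. X $$ (p * k + c, p * k + c))"
    by (simp add: mat_trace_def B_def)
  also have "\<dots> = mat_trace X"
    using X by (subst sum.swap) (simp add: mat_trace_def sum_mult_index)
  finally show ?thesis .
qed

lemma instrument_trace_right:
  assumes I: "instrument n m q I" and X: "X \<in> carrier_mat (k * n) (k * n)"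
  shows "(\<Sum>x<q. mat_trace (on_right n m k (I x) X)) = mat_trace X"
  unfolding on_right_eq using instrument_trace_left[OF I flip_mat_carrier, of k X]
  by (simp add: flip_mat_trace X)

section \<open>Sums over measurement outcomes\<close>

lemma mat_sum_carrier [simp]: "mat_sum n q F \<in> carrier_mat n n"
  by (simp add: mat_sum_def)

lemma mat_sum_psd: "(\<And>x. x < q \<Longrightarrow> psd n (F x)) \<Longrightarrow> psd n (mat_sum n q F)"
  by (auto simp: psd_iff qform_mat_sum intro!: sum_nonneg)

lemma mat_sum_trace:
  assumes "\<And>x. x < q \<Longrightarrow> F x \<in> carrier_mat n n"
  shows "mat_trace (mat_sum n q F) = (\<Sum>x<q. mat_trace (F x))"
proof -
  have "mat_trace (mat_sum n q F) = (\<Sum>i<n. \<Sum>x<q. F x $$ (i, i))"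
    by (simp add: mat_trace_def mat_sum_def)
  also have "\<dots> = (\<Sum>x<q. mat_trace (F x))"
    using assms by (subst sum.swap) (simp add: mat_trace_carrier[of _ n])
  finally show ?thesis .
qed

lemma mat_sum_cong: "(\<And>x. x < q \<Longrightarrow> F x = G x) \<Longrightarrow> mat_sum n q F = mat_sum n q G"
  by (simp add: mat_sum_def)

lemma mat_sum_linear:
  assumes "\<And>x. x < q \<Longrightarrow> linear_map n m (G x)"
  shows "linear_map n m (\<lambda>X. mat_sum m q (\<lambda>x. G x X))"
proof -
  have "mat_sum m q (\<lambda>x. G x (X + Y)) = mat_sum m q (\<lambda>x. G x X) + mat_sum m q (\<lambda>x. G x Y)"
    if XY: "X \<in> carrier_mat n n" "Y \<in> carrier_mat n n" for X Y
  proof (rule eq_matI, goal_cases)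
    case (1 i j)
    hence ij: "i < m" "j < m" by (simp_all add: mat_sum_def)
    have "G x (X + Y) $$ (i, j) = G x X $$ (i, j) + G x Y $$ (i, j)" if "x < q" for x
      using linear_map_carrier[OF assms[OF that] XY(1)] linear_map_carrier[OF assms[OF that] XY(2)] ij
      by (simp add: linear_map_add[OF assms[OF that] XY])
    thus ?case using ij by (simp add: mat_sum_def sum.distrib)
  qed (simp_all add: mat_sum_def)
  moreover have "mat_sum m q (\<lambda>x. G x (c \<cdot>\<^sub>m X)) = c \<cdot>\<^sub>m mat_sum m q (\<lambda>x. G x X)"
    if X: "X \<in> carrier_mat n n" for c X
  proof (rule eq_matI, goal_cases)
    case (1 i j)
    hence ij: "i < m" "j < m" by (simp_all add: mat_sum_def)
    have "G x (c \<cdot>\<^sub>m X) $$ (i, j) = c * G x X $$ (i, j)" if "x < q" for x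
      using linear_map_carrier[OF assms[OF that] X] ij
      by (simp add: linear_map_smult[OF assms[OF that] X])
    thus ?case using ij by (simp add: mat_sum_def sum_distrib_left)
  qed (simp_all add: mat_sum_def)
  ultimately show ?thesis by (simp add: linear_map_def)
qed

lemma linear_map_mat_sum:
  assumes M: "linear_map n m M" and F: "\<And>x. x < q \<Longrightarrow> F x \<in> carrier_mat n n"
  shows "M (mat_sum n q F) = mat_sum m q (\<lambda>x. M (F x))"
  using F
proof (induction q)
  case 0
  \<comment> \<open>The empty sum is the zero matrix; that it is mapped to zero follows from
    homogeneity with the scalar 0.\<close>
  have "mat_sum n 0 F = 0 \<cdot>\<^sub>m mat_sum n 0 F" by (intro eq_matI) (auto simp: mat_sum_def)
  hence "M (mat_sum n 0 F) = 0 \<cdot>\<^sub>m M (mat_sum n 0 F)"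
    using linear_map_smult[OF M mat_sum_carrier, of 0 0 F] by simp
  also have "\<dots> = mat_sum m 0 (\<lambda>x. M (F x))"
    using linear_map_carrier[OF M mat_sum_carrier, of 0 F] by (intro eq_matI) (auto simp: mat_sum_def)
  finally show ?case .
next
  case (Suc q)
  have Fq: "F q \<in> carrier_mat n n" using Suc.prems by simp
  have "mat_sum n (Suc q) F = mat_sum n q F + F q"
    using Fq by (intro eq_matI) (auto simp: mat_sum_def)
  hence "M (mat_sum n (Suc q) F) = mat_sum m q (\<lambda>x. M (F x)) + M (F q)"
    using Suc linear_map_add[OF M mat_sum_carrier Fq] by simp
  also have "\<dots> = mat_sum m (Suc q) (\<lambda>x. M (F x))"
    using linear_map_carrier[OF M Fq] by (intro eq_matI) (auto simp: mat_sum_def)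
  finally show ?case .
qed

section \<open>Induction over the rounds of a protocol\<close>

lemma locc_linear: "locc a b a' b' \<Lambda> \<Longrightarrow> linear_map (a * b) (a' * b') \<Lambda>"
proof (induction rule: locc.induct)
  case (finish a b)
  show ?case by (simp add: linear_map_def)
next
  case (alice a m q I b a' b' F)
  have "linear_map (a * b) (a' * b') (\<lambda>X. F x (on_left a m b (I x) X))" if "x < q" for x
    by (rule linear_map_comp[OF on_left_linear[OF instrument_linear[OF alice.hyps(1) that]] alice.IH[OF that]])
  thus ?case by (rule mat_sum_linear)
next
  case (bob b m q I a a' b' F)
  have "linear_map (a * b) (a' * b') (\<lambda>X. F x (on_right b m a (I x) X))" if "x < q" for x
    by (rule linear_map_comp[OF on_right_linear[OF instrument_linear[OF bob.hyps(1) that]] bob.IH[OF that]])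
  thus ?case by (rule mat_sum_linear)
qed

lemma instrument_cp: "instrument n m q I \<Longrightarrow> x < q \<Longrightarrow> completely_positive n m (I x)"
  by (simp add: instrument_def)

lemma locc_psd: "locc a b a' b' \<Lambda> \<Longrightarrow> psd (a * b) X \<Longrightarrow> psd (a' * b') (\<Lambda> X)"
proof (induction arbitrary: X rule: locc.induct)
  case (alice a m q I b a' b' F)
  show ?case
    by (intro mat_sum_psd alice.IH on_left_psd[OF instrument_cp[OF alice.hyps(1)]] alice.prems)
next
  case (bob b m q I a a' b' F)
  show ?case
    by (intro mat_sum_psd bob.IH on_right_psd[OF instrument_cp[OF bob.hyps(1)]] bob.prems)
qed

lemma locc_trace: "locc a b a' b' \<Lambda> \<Longrightarrow> X \<in> carrier_mat (a * b) (a * b) \<Longrightarrow> mat_trace (\<Lambda> X) = mat_trace X"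
proof (induction arbitrary: X rule: locc.induct)
  case (alice a m q I b a' b' F)
  have "F x (on_left a m b (I x) X) \<in> carrier_mat (a' * b') (a' * b')" if "x < q" for x
    by (rule linear_map_carrier[OF locc_linear[OF alice.hyps(2)[OF that]] on_left_carrier])
  hence "mat_trace (mat_sum (a' * b') q (\<lambda>x. F x (on_left a m b (I x) X))) =
    (\<Sum>x<q. mat_trace (F x (on_left a m b (I x) X)))"
    by (intro mat_sum_trace) auto
  also have "\<dots> = mat_trace X"
    using alice.IH instrument_trace_left[OF alice.hyps(1) alice.prems] by simp
  finally show ?case .
next
  case (bob b m q I a a' b' F)
  have "F x (on_right b m a (I x) X) \<in> carrier_mat (a' * b') (a' * b')" if "x < q" for x
    by (rule linear_map_carrier[OF locc_linear[OF bob.hyps(2)[OF that]] on_right_carrier])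
  hence "mat_trace (mat_sum (a' * b') q (\<lambda>x. F x (on_right b m a (I x) X))) =
    (\<Sum>x<q. mat_trace (F x (on_right b m a (I x) X)))"
    by (intro mat_sum_trace) auto
  also have "\<dots> = mat_trace X"
    using bob.IH instrument_trace_right[OF bob.hyps(1) bob.prems] by simp
  finally show ?case .
qed simp

text \<open>\<open>M\<close> is appended at every leaf of the protocol tree and drawn through the
  sums over outcomes by linearity. Linearity speaks of matrices of the right size only, so the
  composite agrees with \<open>N\<close> on those, not as a function.\<close>

lemma locc_compose:
  assumes "locc a b a' b' \<Lambda>" "locc a' b' a'' b'' M"
  shows "\<exists>N. locc a b a'' b'' N \<and> (\<forall>X \<in> carrier_mat (a * b) (a * b). N X = M (\<Lambda> X))"
  using assms
proof (induction rule: locc.induct)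
  case (alice a m q I b a' b' F)
  have "\<exists>N. locc m b a'' b'' N \<and> (\<forall>X \<in> carrier_mat (m * b) (m * b). N X = M (F x X))" if "x < q" for x
    using alice.IH[OF that] alice.prems by blast
  then obtain N where N: "\<And>x. x < q \<Longrightarrow> locc m b a'' b'' (N x)"
    "\<And>x X. x < q \<Longrightarrow> X \<in> carrier_mat (m * b) (m * b) \<Longrightarrow> N x X = M (F x X)" by metis
  have eq: "M (mat_sum (a' * b') q (\<lambda>x. F x (on_left a m b (I x) X))) =
    mat_sum (a'' * b'') q (\<lambda>x. N x (on_left a m b (I x) X))" for X
  proof -
    have "F x (on_left a m b (I x) X) \<in> carrier_mat (a' * b') (a' * b')" if "x < q" for x
      by (rule linear_map_carrier[OF locc_linear[OF alice.hyps(2)[OF that]] on_left_carrier])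
    thus ?thesis
      using linear_map_mat_sum[OF locc_linear[OF alice.prems]] by (simp add: N(2) cong: mat_sum_cong)
  qed
  have "locc a b a'' b'' (\<lambda>X. mat_sum (a'' * b'') q (\<lambda>x. N x (on_left a m b (I x) X)))"
    by (rule locc.alice[OF alice.hyps(1) N(1)])
  with eq show ?case by (intro exI conjI ballI) (assumption, simp)
next
  case (bob b m q I a a' b' F)
  have "\<exists>N. locc a m a'' b'' N \<and> (\<forall>X \<in> carrier_mat (a * m) (a * m). N X = M (F x X))" if "x < q" for x
    using bob.IH[OF that] bob.prems by blast
  then obtain N where N: "\<And>x. x < q \<Longrightarrow> locc a m a'' b'' (N x)"
    "\<And>x X. x < q \<Longrightarrow> X \<in> carrier_mat (a * m) (a * m) \<Longrightarrow> N x X = M (F x X)" by metis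
  have eq: "M (mat_sum (a' * b') q (\<lambda>x. F x (on_right b m a (I x) X))) =
    mat_sum (a'' * b'') q (\<lambda>x. N x (on_right b m a (I x) X))" for X
  proof -
    have "F x (on_right b m a (I x) X) \<in> carrier_mat (a' * b') (a' * b')" if "x < q" for x
      by (rule linear_map_carrier[OF locc_linear[OF bob.hyps(2)[OF that]] on_right_carrier])
    thus ?thesis
      using linear_map_mat_sum[OF locc_linear[OF bob.prems]] by (simp add: N(2) cong: mat_sum_cong)
  qed
  have "locc a b a'' b'' (\<lambda>X. mat_sum (a'' * b'') q (\<lambda>x. N x (on_right b m a (I x) X)))"
    by (rule locc.bob[OF bob.hyps(1) N(1)])
  with eq show ?case by (intro exI conjI ballI) (assumption, simp)
qed blast

subsection \<open>Tensoring with a further system\<close>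

lemma index_div: "c < k \<Longrightarrow> (i * k + c) div k = i" for i c k :: nat
  by simp

lemma index_mod: "c < k \<Longrightarrow> (i * k + c) mod k = c" for i c k :: nat
  by simp

text \<open>The index functions \<open>l\<close> and \<open>r\<close> of \<open>bip_tensor\<close>.
  The parameters are Bob's first dimension, Alice's second and Bob's second; Alice's first dimension
  is that of the leading digit and does not enter.\<close>

definition bleft :: "nat \<Rightarrow> nat \<Rightarrow> nat \<Rightarrow> nat \<Rightarrow> nat" where
  "bleft b c e I = (I div (b * e) div c) * b + I mod (b * e) div e"

definition bright :: "nat \<Rightarrow> nat \<Rightarrow> nat \<Rightarrow> nat \<Rightarrow> nat" where
  "bright b c e I = (I div (b * e) mod c) * e + I mod (b * e) mod e"

lemma bip_tensor_eq:
  "bip_tensor a b c e X Y = mat ((a * c) * (b * e)) ((a * c) * (b * e))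
     (\<lambda>(I, J). X $$ (bleft b c e I, bleft b c e J) * Y $$ (bright b c e I, bright b c e J))"
  by (simp add: bip_tensor_def bleft_def bright_def Let_def)

lemma bip_tensor_carrier [simp]: "bip_tensor a b c e X Y \<in> carrier_mat ((a * c) * (b * e)) ((a * c) * (b * e))"
  by (simp add: bip_tensor_eq)

lemma bleft_less: "I < (a * c) * (b * e) \<Longrightarrow> bleft b c e I < a * b"
  unfolding bleft_def by (intro index_less div_less_index) (auto intro: div_less_index mod_less_index)

lemma bright_less: "I < (a * c) * (b * e) \<Longrightarrow> bright b c e I < c * e"
proof -
  assume I: "I < (a * c) * (b * e)"
  have "I mod (b * e) mod e < e" by (rule mod_less_index[OF mod_less_index[OF I]])
  moreover have "I div (b * e) mod c < c" by (rule mod_less_index[OF div_less_index[OF I]])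
  ultimately show ?thesis unfolding bright_def by (intro index_less)
qed

text \<open>Alice's enlarged system is itself a product in which her old system comes first, so her
  extended operation is again given by \<open>on_left\<close>. The entry of \<open>Y\<close> is a
  scalar for \<open>\<Phi>\<close> and is taken out by homogeneity.\<close>

lemma on_left_bip_tensor:
  assumes \<Phi>: "linear_map a m \<Phi>" and X: "X \<in> carrier_mat (a * b) (a * b)"
  shows "on_left (a * c) (m * c) (b * e) (on_left a m c \<Phi>) (bip_tensor a b c e X Y) =
    bip_tensor m b c e (on_left a m b \<Phi> X) Y" (is "?L = ?R")
proof (rule eq_matI)
  fix I J assume "I < dim_row ?R" "J < dim_col ?R"
  hence IJ: "I < (m * c) * (b * e)" "J < (m * c) * (b * e)" by (simp_all add: bip_tensor_eq)
  note d = div_less_index[OF IJ(1)] div_less_index[OF IJ(2)]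
  note mo = mod_less_index[OF IJ(1)] mod_less_index[OF IJ(2)]
  let ?y = "Y $$ (bright b c e I, bright b c e J)"
  have idx: "bleft b c e ((p * c + K div (b * e) mod c) * (b * e) + K mod (b * e)) = p * b + K mod (b * e) div e"
    "bright b c e ((p * c + K div (b * e) mod c) * (b * e) + K mod (b * e)) = bright b c e K"
    "(p * c + K div (b * e) mod c) * (b * e) + K mod (b * e) < (a * c) * (b * e)"
    "p * c + K div (b * e) mod c < a * c"
    if K: "K < (m * c) * (b * e)" and p: "p < a" for K p
  proof -
    have be: "K mod (b * e) < b * e" by (rule mod_less_index[OF K])
    have c: "K div (b * e) mod c < c" by (rule mod_less_index[OF div_less_index[OF K]])
    show "bleft b c e ((p * c + K div (b * e) mod c) * (b * e) + K mod (b * e)) = p * b + K mod (b * e) div e"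
      "bright b c e ((p * c + K div (b * e) mod c) * (b * e) + K mod (b * e)) = bright b c e K"
      unfolding bleft_def bright_def index_div[OF be] index_mod[OF be] index_div[OF c] index_mod[OF c]
      by (rule refl)+
    show 4: "p * c + K div (b * e) mod c < a * c" using p c by (rule index_less)
    show "(p * c + K div (b * e) mod c) * (b * e) + K mod (b * e) < (a * c) * (b * e)"
      using 4 be by (rule index_less)
  qed
  have bl: "bleft b c e K div b = K div (b * e) div c" "bleft b c e K mod b = K mod (b * e) div e"
    if "K < (m * c) * (b * e)" for K
    using div_less_index[OF mod_less_index[OF that]] by (simp_all add: bleft_def)
  define B where "B = mat a a (\<lambda>(p, q). X $$ (p * b + I mod (b * e) div e, q * b + J mod (b * e) div e))"
  have "?L $$ (I, J) = \<Phi> (?y \<cdot>\<^sub>m B) $$ (I div (b * e) div c, J div (b * e) div c)"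
  proof -
    have "mat a a (\<lambda>(p, q). mat (a * c) (a * c) (\<lambda>(p, q). bip_tensor a b c e X Y $$
        (p * (b * e) + I mod (b * e), q * (b * e) + J mod (b * e))) $$
        (p * c + I div (b * e) mod c, q * c + J div (b * e) mod c)) = ?y \<cdot>\<^sub>m B"
      using idx[OF IJ(1)] idx[OF IJ(2)]
      by (intro eq_matI) (auto simp: bip_tensor_eq B_def mult.commute)
    thus ?thesis using IJ d by (simp add: on_left_def)
  qed
  also have "\<dots> = ?y * \<Phi> B $$ (I div (b * e) div c, J div (b * e) div c)"
  proof -
    have B: "B \<in> carrier_mat a a" by (simp add: B_def)
    show ?thesis using linear_map_carrier[OF \<Phi> B] div_less_index[OF d(1)] div_less_index[OF d(2)]
      by (simp add: linear_map_smult[OF \<Phi> B])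
  qed
  also have "\<dots> = ?R $$ (I, J)"
    using IJ bleft_less[OF IJ(1)] bleft_less[OF IJ(2)]
    by (simp add: bip_tensor_eq on_left_def bl B_def)
  finally show "?L $$ (I, J) = ?R $$ (I, J)" .
qed (simp_all add: on_left_def bip_tensor_eq)

text \<open>The inner extension is \<open>on_left\<close> for Bob too: within his own product his
  old system is the first factor.\<close>

lemma on_right_bip_tensor:
  assumes \<Phi>: "linear_map b m \<Phi>" and X: "X \<in> carrier_mat (a * b) (a * b)"
  shows "on_right (b * e) (m * e) (a * c) (on_left b m e \<Phi>) (bip_tensor a b c e X Y) =
    bip_tensor a m c e (on_right b m a \<Phi> X) Y" (is "?L = ?R")
proof (rule eq_matI)
  fix I J assume "I < dim_row ?R" "J < dim_col ?R"
  hence IJ: "I < (a * c) * (m * e)" "J < (a * c) * (m * e)" by (simp_all add: bip_tensor_eq)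
  note d = div_less_index[OF IJ(1)] div_less_index[OF IJ(2)]
  note mo = mod_less_index[OF IJ(1)] mod_less_index[OF IJ(2)]
  let ?y = "Y $$ (bright m c e I, bright m c e J)"
  have idx: "bleft b c e ((K div (m * e)) * (b * e) + (p * e + K mod (m * e) mod e)) = K div (m * e) div c * b + p"
    "bright b c e ((K div (m * e)) * (b * e) + (p * e + K mod (m * e) mod e)) = bright m c e K"
    "(K div (m * e)) * (b * e) + (p * e + K mod (m * e) mod e) < (a * c) * (b * e)"
    "p * e + K mod (m * e) mod e < b * e"
    if K: "K < (a * c) * (m * e)" and p: "p < b" for K p
  proof -
    have e: "K mod (m * e) mod e < e" by (rule mod_less_index[OF mod_less_index[OF K]])
    show 4: "p * e + K mod (m * e) mod e < b * e" using p e by (rule index_less)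
    show "(K div (m * e)) * (b * e) + (p * e + K mod (m * e) mod e) < (a * c) * (b * e)"
      using div_less_index[OF K] 4 by (rule index_less)
    have dm: "((K div (m * e)) * (b * e) + (p * e + K mod (m * e) mod e)) div (b * e) = K div (m * e)"
      "((K div (m * e)) * (b * e) + (p * e + K mod (m * e) mod e)) mod (b * e) = p * e + K mod (m * e) mod e"
      using index_div[OF 4] index_mod[OF 4] by blast+
    have "(p * e + K mod (m * e) mod e) div e = p" "(p * e + K mod (m * e) mod e) mod e = K mod (m * e) mod e"
      using e by simp_all
    with dm show "bleft b c e ((K div (m * e)) * (b * e) + (p * e + K mod (m * e) mod e)) = K div (m * e) div c * b + p"
      "bright b c e ((K div (m * e)) * (b * e) + (p * e + K mod (m * e) mod e)) = bright m c e K"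
      by (simp_all only: bleft_def bright_def)
  qed
  have bl: "bleft m c e K div m = K div (m * e) div c" "bleft m c e K mod m = K mod (m * e) div e"
    if "K < (a * c) * (m * e)" for K
    using div_less_index[OF mod_less_index[OF that]] by (simp_all add: bleft_def)
  define B where "B = mat b b (\<lambda>(p, q). X $$ (I div (m * e) div c * b + p, J div (m * e) div c * b + q))"
  have "?L $$ (I, J) = \<Phi> (?y \<cdot>\<^sub>m B) $$ (I mod (m * e) div e, J mod (m * e) div e)"
  proof -
    have "mat b b (\<lambda>(p, q). mat (b * e) (b * e) (\<lambda>(p, q). bip_tensor a b c e X Y $$
        (I div (m * e) * (b * e) + p, J div (m * e) * (b * e) + q)) $$
        (p * e + I mod (m * e) mod e, q * e + J mod (m * e) mod e)) = ?y \<cdot>\<^sub>m B"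
    proof (rule eq_matI)
      fix p q assume "p < dim_row (?y \<cdot>\<^sub>m B)" "q < dim_col (?y \<cdot>\<^sub>m B)"
      hence pq: "p < b" "q < b" by (simp_all add: B_def)
      show "mat b b (\<lambda>(p, q). mat (b * e) (b * e) (\<lambda>(p, q). bip_tensor a b c e X Y $$
        (I div (m * e) * (b * e) + p, J div (m * e) * (b * e) + q)) $$
        (p * e + I mod (m * e) mod e, q * e + J mod (m * e) mod e)) $$ (p, q) = (?y \<cdot>\<^sub>m B) $$ (p, q)"
        using pq idx[OF IJ(1) pq(1)] idx[OF IJ(2) pq(2)]
        by (simp only: bip_tensor_eq B_def index_mat(1) index_smult_mat(1) split mult.commute
            dim_row_mat dim_col_mat)
    qed (simp_all add: B_def)
    thus ?thesis using IJ mo by (simp add: on_left_def on_right_def)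
  qed
  also have "\<dots> = ?y * \<Phi> B $$ (I mod (m * e) div e, J mod (m * e) div e)"
  proof -
    have B: "B \<in> carrier_mat b b" by (simp add: B_def)
    show ?thesis using linear_map_carrier[OF \<Phi> B] div_less_index[OF mo(1)] div_less_index[OF mo(2)]
      by (simp add: linear_map_smult[OF \<Phi> B])
  qed
  also have "\<dots> = ?R $$ (I, J)"
    using IJ bleft_less[OF IJ(1)] bleft_less[OF IJ(2)]
    by (simp add: bip_tensor_eq on_right_def bl B_def)
  finally show "?L $$ (I, J) = ?R $$ (I, J)" .
qed (simp_all add: on_right_def bip_tensor_eq)

text \<open>Extending twice is extending by the product. Complete positivity of an extended
  instrument is therefore complete positivity of the original one with a larger ancilla.\<close>

lemma on_left_on_left:
  "on_left (a * c) (m * c) k (on_left a m c \<Phi>) X = on_left a m (c * k) \<Phi> X" (is "?L = ?R")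
proof (rule eq_matI)
  fix I J assume "I < dim_row ?R" "J < dim_col ?R"
  hence IJ: "I < (m * c) * k" "J < (m * c) * k" by (simp_all add: on_left_def mult.assoc)
  note d = div_less_index[OF IJ(1)] div_less_index[OF IJ(2)]
  have k: "K div k mod c < c" "K mod (c * k) = (K div k mod c) * k + K mod k" "K div (c * k) = K div k div c"
    if "K < (m * c) * k" for K
    using mod_less_index[OF div_less_index[OF that]]
    by (simp_all add: mod_mult2_eq div_mult2_eq mult.commute[of c k] mult.commute[of k "_ mod _"])
  have "mat a a (\<lambda>(p, q). mat (a * c) (a * c) (\<lambda>(p, q). X $$ (p * k + I mod k, q * k + J mod k)) $$
      (p * c + I div k mod c, q * c + J div k mod c)) =
    mat a a (\<lambda>(p, q). X $$ (p * (c * k) + I mod (c * k), q * (c * k) + J mod (c * k)))"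
    using k[OF IJ(1)] k[OF IJ(2)]
    by (intro eq_matI) (auto simp: index_less algebra_simps)
  thus "?L $$ (I, J) = ?R $$ (I, J)"
    using IJ d k(3)[OF IJ(1)] k(3)[OF IJ(2)] by (simp add: on_left_def mult.assoc)
qed (simp_all add: on_left_def mult.assoc)

lemma instrument_tensor:
  assumes I: "instrument a m q I"
  shows "instrument (a * c) (m * c) q (\<lambda>x. on_left a m c (I x))"
  unfolding instrument_def
proof (intro conjI allI impI ballI)
  fix x assume x: "x < q"
  show "completely_positive (a * c) (m * c) (on_left a m c (I x))"
    using on_left_linear[OF instrument_linear[OF I x]] on_left_psd[OF instrument_cp[OF I x]]
    unfolding completely_positive_def on_left_on_left by (simp add: mult.assoc)
next
  fix X :: "complex mat" assume "X \<in> carrier_mat (a * c) (a * c)"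
  thus "(\<Sum>x<q. mat_trace (on_left a m c (I x) X)) = mat_trace X"
    by (rule instrument_trace_left[OF I])
qed

lemma bip_tensor_mat_sum:
  "bip_tensor a b c e (mat_sum (a * b) q F) Y = mat_sum ((a * c) * (b * e)) q (\<lambda>x. bip_tensor a b c e (F x) Y)"
  by (intro eq_matI) (auto simp: bip_tensor_eq mat_sum_def bleft_less sum_distrib_right)

text \<open>The protocol tree is kept and every instrument extended by the identity. The result is
  described on product operators, which is what tensor powers require.\<close>

lemma locc_tensor_left:
  assumes "locc a b a' b' \<Lambda>"
  shows "\<exists>N. locc (a * c) (b * e) (a' * c) (b' * e) N \<and>
    (\<forall>X \<in> carrier_mat (a * b) (a * b). \<forall>Y. N (bip_tensor a b c e X Y) = bip_tensor a' b' c e (\<Lambda> X) Y)"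
  using assms
proof (induction rule: locc.induct)
  case (finish a b)
  show ?case using locc.finish by blast
next
  case (alice a m q I b a' b' F)
  then obtain N where N: "\<And>x. x < q \<Longrightarrow> locc (m * c) (b * e) (a' * c) (b' * e) (N x)"
    "\<And>x X Y. x < q \<Longrightarrow> X \<in> carrier_mat (m * b) (m * b) \<Longrightarrow>
      N x (bip_tensor m b c e X Y) = bip_tensor a' b' c e (F x X) Y" by metis
  let ?N = "\<lambda>X. mat_sum ((a' * c) * (b' * e)) q (\<lambda>x. N x (on_left (a * c) (m * c) (b * e) (on_left a m c (I x)) X))"
  have "locc (a * c) (b * e) (a' * c) (b' * e) ?N"
    by (rule locc.alice[OF instrument_tensor[OF alice.hyps(1)] N(1)])
  moreover have "?N (bip_tensor a b c e X Y) =
    bip_tensor a' b' c e (mat_sum (a' * b') q (\<lambda>x. F x (on_left a m b (I x) X))) Y"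
    if "X \<in> carrier_mat (a * b) (a * b)" for X Y
    unfolding bip_tensor_mat_sum
    by (intro mat_sum_cong) (simp add: on_left_bip_tensor[OF instrument_linear[OF alice.hyps(1)] that] N(2))
  ultimately show ?case by blast
next
  case (bob b m q I a a' b' F)
  then obtain N where N: "\<And>x. x < q \<Longrightarrow> locc (a * c) (m * e) (a' * c) (b' * e) (N x)"
    "\<And>x X Y. x < q \<Longrightarrow> X \<in> carrier_mat (a * m) (a * m) \<Longrightarrow>
      N x (bip_tensor a m c e X Y) = bip_tensor a' b' c e (F x X) Y" by metis
  let ?N = "\<lambda>X. mat_sum ((a' * c) * (b' * e)) q (\<lambda>x. N x (on_right (b * e) (m * e) (a * c) (on_left b m e (I x)) X))"
  have "locc (a * c) (b * e) (a' * c) (b' * e) ?N"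
    by (rule locc.bob[OF instrument_tensor[OF bob.hyps(1)] N(1)])
  moreover have "?N (bip_tensor a b c e X Y) =
    bip_tensor a' b' c e (mat_sum (a' * b') q (\<lambda>x. F x (on_right b m a (I x) X))) Y"
    if "X \<in> carrier_mat (a * b) (a * b)" for X Y
    unfolding bip_tensor_mat_sum
    by (intro mat_sum_cong) (simp add: on_right_bip_tensor[OF instrument_linear[OF bob.hyps(1)] that] N(2))
  ultimately show ?case by blast
qed

subsection \<open>Instruments given by Kraus operators\<close>

text \<open>A single Kraus operator. With one such operator per outcome, vectors are mapped to
  vectors, and the protocols below can be followed on pure inputs.\<close>

definition kmap :: "nat \<Rightarrow> nat \<Rightarrow> (nat \<Rightarrow> nat \<Rightarrow> complex) \<Rightarrow> complex mat \<Rightarrow> complex mat" where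
  "kmap n m A X = mat m m (\<lambda>(i, j). \<Sum>p<n. \<Sum>q<n. A i p * X $$ (p, q) * cnj (A j q))"

text \<open>The completeness relation, entry by entry: the sum of
  \<open>A\<^sub>x\<^sup>* A\<^sub>x\<close> over the outcomes is the identity.\<close>

definition kraus :: "nat \<Rightarrow> nat \<Rightarrow> nat \<Rightarrow> (nat \<Rightarrow> nat \<Rightarrow> nat \<Rightarrow> complex) \<Rightarrow> bool" where
  "kraus n m q A \<longleftrightarrow>
    (\<forall>p<n. \<forall>p'<n. (\<Sum>x<q. \<Sum>i<m. cnj (A x i p) * A x i p') = (if p = p' then 1 else 0))"

lemma kmap_linear: "linear_map n m (kmap n m A)"
  unfolding linear_map_def
  by (auto intro!: eq_matI simp: kmap_def sum.distrib algebra_simps sum_distrib_left)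

lemma on_left_kmap:
  assumes "I < m * k" "J < m * k"
  shows "on_left n m k (kmap n m A) X $$ (I, J) =
    (\<Sum>p<n. \<Sum>q<n. A (I div k) p * X $$ (p * k + I mod k, q * k + J mod k) * cnj (A (J div k) q))"
  using assms by (simp add: on_left_def kmap_def div_less_index)

lemma on_right_kmap:
  assumes "I < k * m" "J < k * m"
  shows "on_right n m k (kmap n m A) X $$ (I, J) =
    (\<Sum>p<n. \<Sum>q<n. A (I mod m) p * X $$ (I div m * n + p, J div m * n + q) * cnj (A (J mod m) q))"
  using assms by (simp add: on_right_def kmap_def mod_less_index)

lemma kmap_completely_positive: "completely_positive n m (kmap n m A)"
  unfolding completely_positive_def
proof (intro conjI allI impI kmap_linear)
  fix k X assume X: "psd (n * k) X"
  \<comment> \<open>The kernel of \<open>A\<close> tensored with the identity, so that the extended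
    map becomes a congruence.\<close>
  define T where "T I P = (if P mod k = I mod k then A (I div k) (P div k) else 0)" for I P
  have "on_left n m k (kmap n m A) X =
    mat (m * k) (m * k) (\<lambda>(I, J). \<Sum>P<n * k. \<Sum>Q<n * k. T I P * X $$ (P, Q) * cnj (T J Q))"
  proof (rule eq_matI, goal_cases)
    case (1 I J)
    hence IJ: "I < m * k" "J < m * k" by simp_all
    have "(\<Sum>Q<n * k. T I P * X $$ (P, Q) * cnj (T J Q)) =
      (\<Sum>q<n. T I P * X $$ (P, q * k + J mod k) * cnj (A (J div k) q))" for P
    proof -
      have "(\<Sum>c<k. T I P * X $$ (P, q * k + c) * cnj (T J (q * k + c))) =
        (\<Sum>c<k. if c = J mod k then T I P * X $$ (P, q * k + c) * cnj (A (J div k) q) else 0)" for q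
        by (intro sum.cong refl) (simp add: T_def)
      thus ?thesis using mod_less_index[OF IJ(2)] by (simp add: sum_mult_index)
    qed
    moreover have "(\<Sum>P<n * k. \<Sum>q<n. T I P * X $$ (P, q * k + J mod k) * cnj (A (J div k) q)) =
      (\<Sum>p<n. \<Sum>q<n. A (I div k) p * X $$ (p * k + I mod k, q * k + J mod k) * cnj (A (J div k) q))"
    proof -
      have "(\<Sum>c<k. \<Sum>q<n. T I (p * k + c) * X $$ (p * k + c, q * k + J mod k) * cnj (A (J div k) q)) =
        (\<Sum>c<k. if c = I mod k then \<Sum>q<n. A (I div k) p * X $$ (p * k + c, q * k + J mod k) * cnj (A (J div k) q) else 0)" for p
        by (intro sum.cong refl) (simp add: T_def)
      thus ?thesis using mod_less_index[OF IJ(1)] by (simp add: sum_mult_index)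
    qed
    ultimately show ?case using IJ by (simp add: on_left_kmap)
  qed (simp_all add: on_left_def)
  thus "psd (m * k) (on_left n m k (kmap n m A) X)" using psd_congruence[OF X] by simp
qed

lemma sum_swap_inner:
  "(\<Sum>x\<in>A. \<Sum>i\<in>B. \<Sum>p\<in>C. f x i p) = (\<Sum>p\<in>C. \<Sum>x\<in>A. \<Sum>i\<in>B. f x i p)"
  by (rule trans[OF sum.cong[OF refl sum.swap] sum.swap])

lemma sum_swap_pairs:
  "(\<Sum>x\<in>A. \<Sum>i\<in>B. \<Sum>p\<in>C. \<Sum>q\<in>D. f x i p q) = (\<Sum>p\<in>C. \<Sum>q\<in>D. \<Sum>x\<in>A. \<Sum>i\<in>B. f x i p q)"
  by (rule trans[OF sum_swap_inner sum.cong[OF refl sum_swap_inner]])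

lemma kraus_instrument:
  assumes "kraus n m q A"
  shows "instrument n m q (\<lambda>x. kmap n m (A x))"
  unfolding instrument_def
proof (intro conjI allI impI ballI kmap_completely_positive)
  fix X :: "complex mat" assume X: "X \<in> carrier_mat n n"
  let ?f = "\<lambda>x i p p'. X $$ (p, p') * (cnj (A x i p') * A x i p)"
  have "(\<Sum>x<q. mat_trace (kmap n m (A x) X)) = (\<Sum>x<q. \<Sum>i<m. \<Sum>p<n. \<Sum>p'<n. ?f x i p p')"
    by (simp add: mat_trace_def kmap_def mult_ac)
  also have "\<dots> = (\<Sum>p<n. \<Sum>p'<n. \<Sum>x<q. \<Sum>i<m. ?f x i p p')"
    by (rule sum_swap_pairs)
  also have "\<dots> = (\<Sum>p<n. \<Sum>p'<n. X $$ (p, p') * (if p' = p then 1 else 0))"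
    using assms by (intro sum.cong refl) (simp add: kraus_def flip: sum_distrib_left)
  also have "\<dots> = mat_trace X"
    using X by (simp add: mat_trace_def if_distrib[of "(*) _"] cong: if_cong)
  finally show "(\<Sum>x<q. mat_trace (kmap n m (A x) X)) = mat_trace X" .
qed


subsection \<open>Relabelling, discarding, preparation\<close>

text \<open>An old label is decomposed as \<open>f s i\<close>; the part \<open>s\<close> is
  measured and \<open>i\<close> remains. With \<open>q = 1\<close> this is a mere relabelling, and
  if \<open>s\<close> labels a tensor factor, that factor is measured in the standard basis and
  removed.\<close>

lemma kraus_selection:
  assumes bij: "bij_betw (\<lambda>(s, i). f s i) ({..<q} \<times> {..<m}) {..<n}"
  shows "kraus n m q (\<lambda>s i p. if p = f s i then 1 else 0)"
  unfolding kraus_def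
proof (intro allI impI)
  fix p p' assume "p < n" "p' < n"
  have "(\<Sum>x<q. \<Sum>i<m. cnj (if p = f x i then 1 else 0) * (if p' = f x i then 1 else 0 :: complex)) =
    (\<Sum>z\<in>{..<q} \<times> {..<m}. (if p = (case z of (s, i) \<Rightarrow> f s i) then if p = p' then 1 else 0 else 0))"
    unfolding sum.cartesian_product by (intro sum.cong refl) auto
  also have "\<dots> = (\<Sum>y<n. if p = y then if p = p' then 1 else 0 else 0)"
    by (rule sum.reindex_bij_betw[OF bij])
  also have "\<dots> = (if p = p' then 1 else 0)" using \<open>p < n\<close> by simp
  finally show "(\<Sum>x<q. \<Sum>i<m. cnj (if p = f x i then 1 else 0) * (if p' = f x i then 1 else 0 :: complex)) =
    (if p = p' then 1 else 0)" .
qed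

text \<open>Both parties measure such a part and forget the outcomes, so the result is a sum over
  \<open>s\<close> and \<open>t\<close>. It covers both the exchange of factors and the partial
  trace.\<close>

lemma locc_select:
  fixes f g :: "nat \<Rightarrow> nat \<Rightarrow> nat" and q q' :: nat
  assumes f: "bij_betw (\<lambda>(s, i). f s i) ({..<q} \<times> {..<m}) {..<a}"
    and g: "bij_betw (\<lambda>(s, i). g s i) ({..<q'} \<times> {..<m'}) {..<b}"
  shows "\<exists>N. locc a b m m' N \<and> (\<forall>X \<in> carrier_mat (a * b) (a * b). N X =
    mat (m * m') (m * m') (\<lambda>(I, J). \<Sum>s<q. \<Sum>t<q'.
      X $$ (f s (I div m') * b + g t (I mod m'), f s (J div m') * b + g t (J mod m'))))"
proof -
  define A where "A s i p = (if p = f s i then 1 else 0 :: complex)" for s i p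
  define B where "B t i p = (if p = g t i then 1 else 0 :: complex)" for t i p
  have fl: "f s i < a" if "s < q" "i < m" for s i using f that unfolding bij_betw_def by auto
  have gl: "g s i < b" if "s < q'" "i < m'" for s i using g that unfolding bij_betw_def by auto
  let ?L = "\<lambda>s X. on_left a m b (kmap a m (A s)) X"
  let ?R = "\<lambda>t X. on_right b m' m (kmap b m' (B t)) X"
  let ?N = "\<lambda>X. mat_sum (m * m') q (\<lambda>s. (\<lambda>Y. mat_sum (m * m') q' (\<lambda>t. (\<lambda>Z. Z) (?R t Y))) (?L s X))"
  have "locc a b m m' ?N"
    using kraus_selection[OF f] kraus_selection[OF g]
    by (intro locc.alice[where F = "\<lambda>_ Y. mat_sum (m * m') q' (\<lambda>t. (\<lambda>Z. Z) (?R t Y))"]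
        locc.bob[where F = "\<lambda>_ Z. Z"] kraus_instrument locc.finish) (simp_all add: A_def[abs_def] B_def[abs_def])
  moreover have "?N X = mat (m * m') (m * m') (\<lambda>(I, J). \<Sum>s<q. \<Sum>t<q'.
      X $$ (f s (I div m') * b + g t (I mod m'), f s (J div m') * b + g t (J mod m')))" for X
  proof (rule eq_matI, goal_cases)
    case (1 I J)
    hence IJ: "I < m * m'" "J < m * m'" by simp_all
    have "?R t (?L s X) $$ (I, J) =
      X $$ (f s (I div m') * b + g t (I mod m'), f s (J div m') * b + g t (J mod m'))"
      if st: "s < q" "t < q'" for s t
    proof -
      note gI = gl[OF st(2) mod_less_index[OF IJ(1)]] gl[OF st(2) mod_less_index[OF IJ(2)]]
      note d = div_less_index[OF IJ(1)] div_less_index[OF IJ(2)]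
      note fI = fl[OF st(1) d(1)] fl[OF st(1) d(2)]
      have "?R t (?L s X) $$ (I, J) =
        ?L s X $$ (I div m' * b + g t (I mod m'), J div m' * b + g t (J mod m'))"
        unfolding on_right_kmap[OF IJ] B_def by (rule delta_sum2[OF gI])
      also have "\<dots> = X $$ (f s (I div m') * b + g t (I mod m'), f s (J div m') * b + g t (J mod m'))"
        unfolding on_left_kmap[OF index_less[OF d(1) gI(1)] index_less[OF d(2) gI(2)]]
          index_div[OF gI(1)] index_div[OF gI(2)] index_mod[OF gI(1)] index_mod[OF gI(2)] A_def
        by (rule delta_sum2[OF fI])
      finally show ?thesis .
    qed
    thus ?case using IJ by (simp add: mat_sum_def)
  qed (simp_all add: mat_sum_def)
  ultimately show ?thesis by blast
qed

lemma bij_betw_flip_index: "bij_betw (\<lambda>(s, i). flip_index n k i) ({..<1::nat} \<times> {..<n * k}) {..<k * n}"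
proof (rule bij_betw_byWitness[where f' = "\<lambda>I. (0, flip_index k n I)"])
  have inv: "flip_index k n (flip_index n k I) = I" if "I < n * k" for n k I
    using div_less_index[OF that] by (simp add: flip_index_def)
  show "\<forall>a\<in>{..<1::nat} \<times> {..<n * k}. (0, flip_index k n (case a of (s, i) \<Rightarrow> flip_index n k i)) = a"
    by (auto simp: inv)
  show "\<forall>I\<in>{..<k * n}. (case (0, flip_index k n I) of (s, i) \<Rightarrow> flip_index n k i) = I"
    by (auto simp: inv)
qed (auto simp: flip_index_less)

lemma locc_swap:
  "\<exists>N. locc (a * c) (b * e) (c * a) (e * b) N \<and> (\<forall>X Y. N (bip_tensor a b c e X Y) = bip_tensor c e a b Y X)"
proof -
  obtain N where N: "locc (a * c) (b * e) (c * a) (e * b) N"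
    "\<And>X. X \<in> carrier_mat (a * c * (b * e)) (a * c * (b * e)) \<Longrightarrow> N X =
    mat (c * a * (e * b)) (c * a * (e * b)) (\<lambda>(I, J). \<Sum>s<1::nat. \<Sum>t<1::nat.
      X $$ (flip_index c a (I div (e * b)) * (b * e) + flip_index e b (I mod (e * b)),
            flip_index c a (J div (e * b)) * (b * e) + flip_index e b (J mod (e * b))))"
    using locc_select[OF bij_betw_flip_index[of c a] bij_betw_flip_index[of e b]] by blast
  have "N (bip_tensor a b c e X Y) = bip_tensor c e a b Y X" for X Y
  proof (rule eq_matI)
    have idx: "bleft b c e (flip_index c a (I div (e * b)) * (b * e) + flip_index e b (I mod (e * b))) = bright e a b I"
      "bright b c e (flip_index c a (I div (e * b)) * (b * e) + flip_index e b (I mod (e * b))) = bleft e a b I"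
      "flip_index c a (I div (e * b)) * (b * e) + flip_index e b (I mod (e * b)) < a * c * (b * e)"
      if I: "I < c * a * (e * b)" for I
    proof -
      note d = div_less_index[OF I] and mo = mod_less_index[OF I]
      note f = flip_index_less[OF d] flip_index_less[OF mo]
      show "flip_index c a (I div (e * b)) * (b * e) + flip_index e b (I mod (e * b)) < a * c * (b * e)"
        using f by (rule index_less)
      show "bleft b c e (flip_index c a (I div (e * b)) * (b * e) + flip_index e b (I mod (e * b))) = bright e a b I"
        "bright b c e (flip_index c a (I div (e * b)) * (b * e) + flip_index e b (I mod (e * b))) = bleft e a b I"
        unfolding bleft_def bright_def index_div[OF f(2)] index_mod[OF f(2)]
        unfolding flip_index_def index_div[OF div_less_index[OF d]] index_mod[OF div_less_index[OF d]]
          index_div[OF div_less_index[OF mo]] index_mod[OF div_less_index[OF mo]]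
        by (rule refl)+
    qed
    fix I J assume "I < dim_row (bip_tensor c e a b Y X)" "J < dim_col (bip_tensor c e a b Y X)"
    hence IJ: "I < c * a * (e * b)" "J < c * a * (e * b)" by (simp_all add: bip_tensor_eq)
    have "N (bip_tensor a b c e X Y) $$ (I, J) = bip_tensor a b c e X Y $$
        (flip_index c a (I div (e * b)) * (b * e) + flip_index e b (I mod (e * b)),
         flip_index c a (J div (e * b)) * (b * e) + flip_index e b (J mod (e * b)))"
      using N(2)[OF bip_tensor_carrier, of X Y] IJ by simp
    also have "\<dots> = bip_tensor c e a b Y X $$ (I, J)"
      using IJ idx[OF IJ(1)] idx[OF IJ(2)] by (simp add: bip_tensor_eq)
    finally show "N (bip_tensor a b c e X Y) $$ (I, J) = bip_tensor c e a b Y X $$ (I, J)" .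
  qed (use N(2)[OF bip_tensor_carrier, of X Y] in \<open>simp_all add: bip_tensor_eq\<close>)
  with N(1) show ?thesis by blast
qed

lemma bij_betw_index: "bij_betw (\<lambda>(s, i). i * c + s) ({..<c} \<times> {..<m}) {..<m * c}" for c m :: nat
  by (rule bij_betw_byWitness[where f' = "\<lambda>I. (I mod c, I div c)"])
    (auto simp: index_less div_less_index mod_less_index)

text \<open>The partial trace is a standard-basis measurement of the second factors whose outcome is
  ignored.\<close>

lemma locc_discard:
  "\<exists>N. locc (a * c) (b * e) a b N \<and> (\<forall>X \<in> carrier_mat (a * b) (a * b). \<forall>Y \<in> carrier_mat (c * e) (c * e).
     N (bip_tensor a b c e X Y) = mat_trace Y \<cdot>\<^sub>m X)"
proof -
  obtain N where N: "locc (a * c) (b * e) a b N"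
    "\<And>X. X \<in> carrier_mat (a * c * (b * e)) (a * c * (b * e)) \<Longrightarrow> N X =
    mat (a * b) (a * b) (\<lambda>(I, J). \<Sum>s<c. \<Sum>t<e.
      X $$ ((I div b * c + s) * (b * e) + (I mod b * e + t), (J div b * c + s) * (b * e) + (J mod b * e + t)))"
    using locc_select[OF bij_betw_index[of c a] bij_betw_index[of e b]] by blast
  have "N (bip_tensor a b c e X Y) = mat_trace Y \<cdot>\<^sub>m X"
    if X: "X \<in> carrier_mat (a * b) (a * b)" and Y: "Y \<in> carrier_mat (c * e) (c * e)" for X Y
  proof (rule eq_matI)
    fix I J assume "I < dim_row (mat_trace Y \<cdot>\<^sub>m X)" "J < dim_col (mat_trace Y \<cdot>\<^sub>m X)"
    hence IJ: "I < a * b" "J < a * b" using X by simp_all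
    have idx: "bleft b c e ((K div b * c + s) * (b * e) + (K mod b * e + t)) = K"
      "bright b c e ((K div b * c + s) * (b * e) + (K mod b * e + t)) = s * e + t"
      "(K div b * c + s) * (b * e) + (K mod b * e + t) < a * c * (b * e)"
      if K: "K < a * b" and s: "s < c" and t: "t < e" for K s t
    proof -
      have l: "K mod b * e + t < b * e" using mod_less_index[OF K] t by (rule index_less)
      show "(K div b * c + s) * (b * e) + (K mod b * e + t) < a * c * (b * e)"
        using index_less[OF div_less_index[OF K] s] l by (rule index_less)
      show "bleft b c e ((K div b * c + s) * (b * e) + (K mod b * e + t)) = K"
        "bright b c e ((K div b * c + s) * (b * e) + (K mod b * e + t)) = s * e + t"
        unfolding bleft_def bright_def index_div[OF l] index_mod[OF l] index_div[OF s] index_mod[OF s]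
          index_div[OF t] index_mod[OF t] by simp_all
    qed
    have "N (bip_tensor a b c e X Y) $$ (I, J) = (\<Sum>s<c. \<Sum>t<e. X $$ (I, J) * Y $$ (s * e + t, s * e + t))"
      using N(2)[OF bip_tensor_carrier, of X Y] IJ
      by (simp add: bip_tensor_eq idx[OF IJ(1)] idx[OF IJ(2)])
    also have "\<dots> = mat_trace Y * X $$ (I, J)"
      using Y by (simp add: mat_trace_def sum_mult_index sum_distrib_left mult.commute)
    finally show "N (bip_tensor a b c e X Y) $$ (I, J) = (mat_trace Y \<cdot>\<^sub>m X) $$ (I, J)" using X IJ by simp
  qed (use X N(2)[OF bip_tensor_carrier, of X Y] in simp_all)
  with N(1) show ?thesis by blast
qed

text \<open>Each party measures in the standard basis and prepares the basis vector 0, the Kraus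
  operators being \<open>|0><x|\<close>. It fills in for the \<open>n\<close> at which the actual
  protocol does not fit.\<close>

lemma locc_exists:
  assumes "m > 0" "m' > 0"
  shows "\<exists>\<Lambda>. locc a b m m' \<Lambda>"
proof -
  have inst: "instrument n m n (\<lambda>x. kmap n m (\<lambda>i p. if i = 0 \<and> p = x then 1 else 0))" if "m > 0" for n m
  proof (rule kraus_instrument, unfold kraus_def, intro allI impI)
    fix p p' assume p: "p < n" "p' < n"
    have "(\<Sum>x<n. \<Sum>i<m. cnj (if i = 0 \<and> p = x then 1 else 0) * (if i = 0 \<and> p' = x then 1 else 0 :: complex)) =
      (\<Sum>x<n. \<Sum>i<m. if i = 0 then if p = x then if p = p' then 1 else 0 else 0 else 0)"
      by (intro sum.cong refl) auto
    also have "\<dots> = (if p = p' then 1 else 0)" using p that by simp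
    finally show "(\<Sum>x<n. \<Sum>i<m. cnj (if i = 0 \<and> p = x then 1 else 0) * (if i = 0 \<and> p' = x then 1 else 0 :: complex)) =
      (if p = p' then 1 else 0)" .
  qed
  show ?thesis
    by (rule exI) (rule locc.alice[OF inst[OF assms(1)] locc.bob[OF inst[OF assms(2)] locc.finish]])
qed

subsection \<open>Tensor powers\<close>

lemma bip_power_carrier [simp]: "bip_power a b X n \<in> carrier_mat (a ^ n * b ^ n) (a ^ n * b ^ n)"
  using bip_tensor_carrier[of "a ^ _" "b ^ _" a b] by (induction n) (simp_all add: mult_ac)

lemma bip_tensor_assoc:
  "bip_tensor (a * a') (b * b') a'' b'' (bip_tensor a b a' b' X Y) Z =
   bip_tensor a b (a' * a'') (b' * b'') X (bip_tensor a' b' a'' b'' Y Z)" (is "?L = ?R")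
proof (rule eq_matI)
  have idx: "bleft b a' b' (bleft (b * b') a'' b'' I) = bleft b (a' * a'') (b' * b'') I"
    "bright b a' b' (bleft (b * b') a'' b'' I) = bleft b' a'' b'' (bright b (a' * a'') (b' * b'') I)"
    "bright (b * b') a'' b'' I = bright b' a'' b'' (bright b (a' * a'') (b' * b'') I)"
    "bleft (b * b') a'' b'' I < (a * a') * (b * b')"
    "bright b (a' * a'') (b' * b'') I < (a' * a'') * (b' * b'')"
    if I: "I < (a * a' * a'') * (b * b' * b'')" for I
  proof -
    note b = mod_less_index[OF I] and a = div_less_index[OF I]
    have I': "I < (a * (a' * a'')) * (b * (b' * b''))" using I by (simp add: mult.assoc)
    show "bleft (b * b') a'' b'' I < (a * a') * (b * b')" using I by (rule bleft_less)
    show "bright b (a' * a'') (b' * b'') I < (a' * a'') * (b' * b'')" using I' by (rule bright_less)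
    define A where "A = I div (b * b' * b'')"
    define B where "B = I mod (b * b' * b'')"
    have A: "I div (b * (b' * b'')) = A" and B: "I mod (b * (b' * b'')) = B" by (simp_all add: A_def B_def mult.assoc)
    have Al: "A < a * a' * a''" and Bl: "B < b * b' * b''" using a b by (simp_all add: A_def B_def)
    have Bd: "B div b'' < b * b'" using Bl by (rule div_less_index)
    have Bm: "B mod (b' * b'') < b' * b''" using Bl by (intro mod_less_index[where m = b]) (simp add: mult.assoc)
    have B1: "B div b'' div b' = B div (b' * b'')" "B div b'' mod b' = B mod (b' * b'') div b''"
      "B mod b'' = B mod (b' * b'') mod b''"
      using index_div[OF mod_less_index[OF Bl]] index_mod[OF mod_less_index[OF Bl]]
      by (simp_all add: div_mult2_eq mod_mult2_eq mult.commute[of b' b''] mult.commute[of b'' "_ mod _"])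
    have A1: "A div a'' div a' = A div (a' * a'')" "A div a'' mod a' = A mod (a' * a'') div a''"
      "A mod a'' = A mod (a' * a'') mod a''"
      using index_div[OF mod_less_index[OF Al]] index_mod[OF mod_less_index[OF Al]]
      by (simp_all add: div_mult2_eq mod_mult2_eq mult.commute[of a' a''] mult.commute[of a'' "_ mod _"])
    show "bleft b a' b' (bleft (b * b') a'' b'' I) = bleft b (a' * a'') (b' * b'') I"
      "bright b a' b' (bleft (b * b') a'' b'' I) = bleft b' a'' b'' (bright b (a' * a'') (b' * b'') I)"
      "bright (b * b') a'' b'' I = bright b' a'' b'' (bright b (a' * a'') (b' * b'') I)"
      unfolding bleft_def bright_def A B A_def[symmetric] B_def[symmetric] index_div[OF Bd] index_mod[OF Bd]
        index_div[OF Bm] index_mod[OF Bm]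
      by (simp_all only: A1 B1)
  qed
  fix I J assume "I < dim_row ?R" "J < dim_col ?R"
  hence IJ: "I < (a * a' * a'') * (b * b' * b'')" "J < (a * a' * a'') * (b * b' * b'')"
    by (simp_all add: bip_tensor_eq mult.assoc)
  have IJ': "I < (a * (a' * a'')) * (b * (b' * b''))" "J < (a * (a' * a'')) * (b * (b' * b''))"
    using IJ by (simp_all add: mult.assoc)
  show "?L $$ (I, J) = ?R $$ (I, J)"
    unfolding bip_tensor_eq index_mat(1)[OF IJ] index_mat(1)[OF IJ'] split
      index_mat(1)[OF idx(4)[OF IJ(1)] idx(4)[OF IJ(2)]] index_mat(1)[OF idx(5)[OF IJ(1)] idx(5)[OF IJ(2)]]
      idx(1-3)[OF IJ(1)] idx(1-3)[OF IJ(2)]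
    by (rule mult.assoc)
qed (simp_all add: bip_tensor_eq mult.assoc)

lemma bip_tensor_one:
  assumes "X \<in> carrier_mat (a * b) (a * b)"
  shows "bip_tensor a b 1 1 X (1\<^sub>m 1) = X" "bip_tensor 1 1 a b (1\<^sub>m 1) X = X"
proof -
  show "bip_tensor a b 1 1 X (1\<^sub>m 1) = X"
    using assms by (intro eq_matI) (auto simp: bip_tensor_eq bleft_def bright_def)
  have "bleft 1 a b I = 0" "bright 1 a b I = I" if "I < a * b" for I
    using that div_less_index[OF that] by (simp_all add: bleft_def bright_def mod_less_index)
  thus "bip_tensor 1 1 a b (1\<^sub>m 1) X = X"
    using assms by (intro eq_matI) (auto simp: bip_tensor_eq)
qed

lemma bip_power_add:
  "bip_power a b X (n + m) = bip_tensor (a ^ n) (b ^ n) (a ^ m) (b ^ m) (bip_power a b X n) (bip_power a b X m)"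
proof (induction m)
  case 0
  show ?case using bip_tensor_one(1)[OF bip_power_carrier] by simp
next
  case (Suc m)
  have "bip_power a b X (n + Suc m) = bip_tensor (a ^ n * a ^ m) (b ^ n * b ^ m) a b
      (bip_tensor (a ^ n) (b ^ n) (a ^ m) (b ^ m) (bip_power a b X n) (bip_power a b X m)) X"
    using Suc by (simp add: power_add)
  thus ?case by (simp add: bip_tensor_assoc mult.commute[of a] mult.commute[of b])
qed

text \<open>The grouping into blocks: \<open>k * m\<close> copies are \<open>m\<close> copies of a
  block of \<open>k\<close>, with no rearrangement of the factors.\<close>

lemma bip_power_mult: "bip_power a b X (k * m) = bip_power (a ^ k) (b ^ k) (bip_power a b X k) m"
proof (induction m)
  case (Suc m)
  have "bip_power a b X (k * Suc m) = bip_power a b X (k * m + k)" by (simp add: add.commute)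
  also have "\<dots> = bip_power (a ^ k) (b ^ k) (bip_power a b X k) (Suc m)"
    unfolding bip_power_add Suc by (simp add: power_mult)
  finally show ?case .
qed simp

text \<open>\<open>locc_tensor_left\<close> acts on the first factor only. Hence \<open>N1\<close>
  treats the first \<open>m\<close> copies, \<open>N2\<close> exchanges them with the last one,
  \<open>N3\<close> treats the latter, and \<open>N4\<close> restores the order.\<close>

lemma locc_power:
  assumes \<Lambda>: "locc a b a' b' \<Lambda>"
  shows "\<exists>N. locc (a ^ m) (b ^ m) (a' ^ m) (b' ^ m) N \<and>
    (\<forall>X \<in> carrier_mat (a * b) (a * b). N (bip_power a b X m) = bip_power a' b' (\<Lambda> X) m)"
proof (induction m)
  case 0
  show ?case using locc.finish[of 1 1] by auto
next
  case (Suc m)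
  then obtain N where N: "locc (a ^ m) (b ^ m) (a' ^ m) (b' ^ m) N"
    "\<And>X. X \<in> carrier_mat (a * b) (a * b) \<Longrightarrow> N (bip_power a b X m) = bip_power a' b' (\<Lambda> X) m" by blast
  obtain N1 where N1: "locc (a ^ m * a) (b ^ m * b) (a' ^ m * a) (b' ^ m * b) N1"
    "\<And>X Y. X \<in> carrier_mat (a ^ m * b ^ m) (a ^ m * b ^ m) \<Longrightarrow>
      N1 (bip_tensor (a ^ m) (b ^ m) a b X Y) = bip_tensor (a' ^ m) (b' ^ m) a b (N X) Y"
    using locc_tensor_left[OF N(1), of a b] by blast
  obtain N2 where N2: "locc (a' ^ m * a) (b' ^ m * b) (a * a' ^ m) (b * b' ^ m) N2"
    "\<And>X Y. N2 (bip_tensor (a' ^ m) (b' ^ m) a b X Y) = bip_tensor a b (a' ^ m) (b' ^ m) Y X"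
    using locc_swap by blast
  obtain N3 where N3: "locc (a * a' ^ m) (b * b' ^ m) (a' * a' ^ m) (b' * b' ^ m) N3"
    "\<And>X Y. X \<in> carrier_mat (a * b) (a * b) \<Longrightarrow>
      N3 (bip_tensor a b (a' ^ m) (b' ^ m) X Y) = bip_tensor a' b' (a' ^ m) (b' ^ m) (\<Lambda> X) Y"
    using locc_tensor_left[OF \<Lambda>, of "a' ^ m" "b' ^ m"] by blast
  obtain N4 where N4: "locc (a' * a' ^ m) (b' * b' ^ m) (a' ^ m * a') (b' ^ m * b') N4"
    "\<And>X Y. N4 (bip_tensor a' b' (a' ^ m) (b' ^ m) X Y) = bip_tensor (a' ^ m) (b' ^ m) a' b' Y X"
    using locc_swap by blast
  obtain M1 where M1: "locc (a ^ m * a) (b ^ m * b) (a * a' ^ m) (b * b' ^ m) M1"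
    "\<And>X. X \<in> carrier_mat (a ^ m * a * (b ^ m * b)) (a ^ m * a * (b ^ m * b)) \<Longrightarrow> M1 X = N2 (N1 X)"
    using locc_compose[OF N1(1) N2(1)] by blast
  obtain M2 where M2: "locc (a ^ m * a) (b ^ m * b) (a' * a' ^ m) (b' * b' ^ m) M2"
    "\<And>X. X \<in> carrier_mat (a ^ m * a * (b ^ m * b)) (a ^ m * a * (b ^ m * b)) \<Longrightarrow> M2 X = N3 (M1 X)"
    using locc_compose[OF M1(1) N3(1)] by blast
  obtain M3 where M3: "locc (a ^ m * a) (b ^ m * b) (a' ^ m * a') (b' ^ m * b') M3"
    "\<And>X. X \<in> carrier_mat (a ^ m * a * (b ^ m * b)) (a ^ m * a * (b ^ m * b)) \<Longrightarrow> M3 X = N4 (M2 X)"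
    using locc_compose[OF M2(1) N4(1)] by blast
  have "M3 (bip_power a b X (Suc m)) = bip_power a' b' (\<Lambda> X) (Suc m)" if X: "X \<in> carrier_mat (a * b) (a * b)" for X
    by (simp only: bip_power.simps(2) M3(2) M2(2) M1(2) N1(2) N2(2) N3(2) N4(2) N(2) X
        bip_tensor_carrier bip_power_carrier)
  with M3(1) show ?case by (auto simp: mult.commute)
qed

section \<open>Correcting a given set of Pauli errors\<close>

subsection \<open>Walsh characters\<close>

text \<open>The character \<open>(-1)^(b.x)\<close> of the group of \<open>N\<close>-bit masks under
  \<open>xor\<close>, with values in \<open>complex\<close> since it acts as a phase.\<close>

definition walsh :: "nat \<Rightarrow> nat \<Rightarrow> nat \<Rightarrow> complex" where
  "walsh N b x = (\<Prod>i<N. if bit b i \<and> bit x i then -1 else 1)"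

lemma walsh_commute: "walsh N b x = walsh N x b"
  by (simp add: walsh_def conj_commute)

lemma walsh_xor: "walsh N b (xor x y) = walsh N b x * walsh N b y"
  unfolding walsh_def prod.distrib[symmetric] by (intro prod.cong refl) (simp add: bit_xor_iff)

lemma walsh_xor_left: "walsh N (xor b c) x = walsh N b x * walsh N c x"
  using walsh_xor[of N x b c] by (simp add: walsh_commute)

lemma walsh_0 [simp]: "walsh N b 0 = 1"
  by (simp add: walsh_def)

lemma walsh_cases: "walsh N b x = 1 \<or> walsh N b x = -1"
proof -
  have "walsh N b x * walsh N b x = walsh N b 0"
    using walsh_xor[of N b x x] by simp
  thus ?thesis by (simp add: square_eq_1_iff)
qed

lemma walsh_square [simp]: "walsh N b x * walsh N b x = 1"
  using walsh_cases[of N b x] by auto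

lemma cnj_walsh [simp]: "cnj (walsh N b x) = walsh N b x"
  using walsh_cases[of N b x] by auto

lemma xor_less: "x < 2 ^ N \<Longrightarrow> y < 2 ^ N \<Longrightarrow> xor x y < (2 ^ N :: nat)"
  by (metis take_bit_nat_eq_self_iff take_bit_xor)

lemma xor_cancel [simp]: "xor (xor x y) y = (x :: nat)"
  by (simp add: xor.assoc)

lemma xor_eq_0_iff: "xor x y = 0 \<longleftrightarrow> x = (y :: nat)"
  by (metis xor_cancel xor_self_eq xor.left_neutral)

lemma walsh_separates:
  assumes "x \<noteq> 0" "x < 2 ^ N"
  obtains b where "b < 2 ^ N" "walsh N b x = -1"
proof -
  obtain i where i: "bit x i" using assms(1) by (metis bit_eq_iff bit_0_eq bot_apply bot_bool_def)
  have "i < N"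
  proof (rule ccontr)
    assume "\<not> i < N"
    hence "\<not> bit (take_bit N x) i" by (simp add: bit_take_bit_iff)
    thus False using i assms(2) by (simp add: take_bit_nat_eq_self)
  qed
  have "walsh N (2 ^ i) x = (\<Prod>j<N. if j = i then -1 else 1)"
    unfolding walsh_def using i by (intro prod.cong refl) (auto simp: bit_exp_iff)
  also have "\<dots> = -1" using \<open>i < N\<close> by simp
  finally show ?thesis using that[of "2 ^ i"] \<open>i < N\<close> by simp
qed

text \<open>Subgroups of the group of \<open>N\<close>-bit masks; every element is its own inverse.
  After each round the basis of the remaining system is labelled by a smaller subgroup.\<close>

definition xor_group :: "nat \<Rightarrow> nat set \<Rightarrow> bool" where
  "xor_group N G \<longleftrightarrow> 0 \<in> G \<and> G \<subseteq> {..<2 ^ N} \<and> (\<forall>x\<in>G. \<forall>y\<in>G. xor x y \<in> G)"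

lemma xor_group_full: "xor_group N {..<2 ^ N}"
  by (auto simp: xor_group_def xor_less)

lemma xor_group_finite: "xor_group N G \<Longrightarrow> finite G"
  unfolding xor_group_def using finite_subset by blast

lemma xor_groupD:
  assumes "xor_group N G"
  shows "0 \<in> G" "x \<in> G \<Longrightarrow> x < 2 ^ N" "x \<in> G \<Longrightarrow> y \<in> G \<Longrightarrow> xor x y \<in> G"
  using assms by (auto simp: xor_group_def)

text \<open>Translation by \<open>v\<close> exchanges the two values of the character.\<close>

lemma character_half:
  fixes ch :: "nat \<Rightarrow> complex"
  assumes G: "xor_group N G" and hom: "\<And>x y. ch (xor x y) = ch x * ch y"
    and "v \<in> G" "ch v = -1"
  shows "card {x \<in> G. ch x = -1} = card {x \<in> G. ch x = 1}"
  by (rule bij_betw_same_card[of "\<lambda>x. xor x v"],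
      rule bij_betw_byWitness[where f' = "\<lambda>x. xor x v"])
    (use assms xor_groupD[OF G] in auto)

lemma character_half_card:
  fixes ch :: "nat \<Rightarrow> complex"
  assumes G: "xor_group N G" and hom: "\<And>x y. ch (xor x y) = ch x * ch y"
    and pm: "\<And>x. ch x = 1 \<or> ch x = -1"
    and "v \<in> G" "ch v = -1"
  shows "card G = 2 * card {x \<in> G. ch x = 1}" "card G = 2 * card {x \<in> G. ch x = -1}"
proof -
  have "G = {x \<in> G. ch x = 1} \<union> {x \<in> G. ch x = -1}" using pm by auto
  hence "card G = card {x \<in> G. ch x = 1} + card {x \<in> G. ch x = -1}"
    using xor_group_finite[OF G] by (subst (1) \<open>G = _\<close>, intro card_Un_disjoint) auto
  thus "card G = 2 * card {x \<in> G. ch x = 1}" "card G = 2 * card {x \<in> G. ch x = -1}"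
    using character_half[OF assms(1,2,4,5)] by simp_all
qed

subsection \<open>The error vectors and the deficit in fidelity\<close>

text \<open>\<open>pauli N (a, b)\<close> is the unnormalised vector that results from \<open>\<Sum>\<^sub>x |x\<rangle>|x\<rangle>\<close> by the phase flip with
  mask \<open>b\<close> and the bit flip with mask \<open>a\<close>.\<close>

definition pauli :: "nat \<Rightarrow> nat \<times> nat \<Rightarrow> nat \<Rightarrow> nat \<Rightarrow> complex" where
  "pauli N e x y = (if y = xor x (fst e) then walsh N (snd e) x else 0)"

definition ebits_vec :: "nat \<Rightarrow> nat \<Rightarrow> complex" where
  "ebits_vec r I = (if I div 2 ^ r = I mod 2 ^ r then complex_of_real (1 / sqrt (2 ^ r)) else 0)"

text \<open>The infidelity with \<open>r\<close> ebits, with the trace in place of 1. In this form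
  it is linear, so it adds up over outcomes and over the rank-one components of a state.\<close>

definition deficit :: "nat \<Rightarrow> complex mat \<Rightarrow> real" where
  "deficit r X = Re (mat_trace X) - Re (qform (2 ^ r * 2 ^ r) X (ebits_vec r))"

lemma deficit_mat_sum:
  assumes "\<And>x. x < q \<Longrightarrow> F x \<in> carrier_mat (2 ^ r * 2 ^ r) (2 ^ r * 2 ^ r)"
  shows "deficit r (mat_sum (2 ^ r * 2 ^ r) q F) = (\<Sum>x<q. deficit r (F x))"
  using mat_sum_trace[of q F] assms by (simp add: deficit_def qform_mat_sum sum_subtractf)

lemma ebits_vec_norm: "(\<Sum>I<2 ^ r * 2 ^ r. (cmod (ebits_vec r I))\<^sup>2) = 1"
proof -
  have "(\<Sum>I<2 ^ r * 2 ^ r. (cmod (ebits_vec r I))\<^sup>2) =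
    (\<Sum>i<2 ^ r::nat. \<Sum>c<2 ^ r::nat. if i = c then 1 / 2 ^ r else 0)"
    unfolding sum_mult_index by (intro sum.cong refl) (simp add: ebits_vec_def norm_divide power_divide)
  thus ?thesis by simp
qed

lemma trace_rank_one: "mat_trace (rank_one n f) = complex_of_real (\<Sum>i<n. (cmod (f i))\<^sup>2)"
  by (simp add: mat_trace_def rank_one_def flip: complex_norm_square)

text \<open>For a vector the deficit is its squared distance from the line through
  \<open>ebits_vec r\<close>, hence at most the squared distance from any point \<open>z\<close> of
  this line.\<close>

lemma deficit_rank_one_le:
  "deficit r (rank_one (2 ^ r * 2 ^ r) f) \<le> (\<Sum>I<2 ^ r * 2 ^ r. (cmod (f I - z * ebits_vec r I))\<^sup>2)"
proof -
  define w where "w = (\<Sum>I<2 ^ r * 2 ^ r. cnj (ebits_vec r I) * f I)"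
  have *: "(cmod (x - z * y))\<^sup>2 = (cmod x)\<^sup>2 - 2 * Re (cnj z * (cnj y * x)) + (cmod z)\<^sup>2 * (cmod y)\<^sup>2" for x y
    unfolding cmod_power2 by (simp add: power2_eq_square algebra_simps)
  have "(\<Sum>I<2 ^ r * 2 ^ r. (cmod (f I - z * ebits_vec r I))\<^sup>2) =
    (\<Sum>I<2 ^ r * 2 ^ r. (cmod (f I))\<^sup>2) - 2 * Re (cnj z * w) + (cmod z)\<^sup>2"
  proof -
    have "Re (cnj z * w) = (\<Sum>I<2 ^ r * 2 ^ r. Re (cnj z * (cnj (ebits_vec r I) * f I)))"
      by (simp only: w_def sum_distrib_left Re_sum)
    moreover have "(cmod z)\<^sup>2 = (\<Sum>I<2 ^ r * 2 ^ r. (cmod z)\<^sup>2 * (cmod (ebits_vec r I))\<^sup>2)"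
      by (simp only: sum_distrib_left[symmetric] ebits_vec_norm mult_1_right)
    ultimately show ?thesis unfolding * by (simp only: sum.distrib sum_subtractf sum_distrib_left[symmetric])
  qed
  moreover have "2 * Re (cnj z * w) \<le> (cmod z)\<^sup>2 + (cmod w)\<^sup>2"
  proof -
    have "Re (cnj z * w) \<le> cmod z * cmod w" using complex_Re_le_cmod[of "cnj z * w"] by (simp add: norm_mult)
    moreover have "2 * (cmod z * cmod w) \<le> (cmod z)\<^sup>2 + (cmod w)\<^sup>2"
      using sum_squares_bound[of "cmod z" "cmod w"] by (simp add: mult.assoc)
    ultimately show ?thesis by linarith
  qed
  ultimately show ?thesis by (simp add: deficit_def trace_rank_one qform_rank_one w_def)
qed

lemma on_left_rank_one:
  "on_left n m k (kmap n m A) (rank_one (n * k) (\<lambda>I. \<psi> (I div k) (I mod k))) =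
   rank_one (m * k) (\<lambda>I. \<Sum>p<n. A (I div k) p * \<psi> p (I mod k))"
proof (rule eq_matI, goal_cases)
  case (1 I J)
  hence IJ: "I < m * k" "J < m * k" by (simp_all add: rank_one_def)
  note md = mod_less_index[OF IJ(1)] mod_less_index[OF IJ(2)]
  have "on_left n m k (kmap n m A) (rank_one (n * k) (\<lambda>I. \<psi> (I div k) (I mod k))) $$ (I, J) =
    (\<Sum>p<n. \<Sum>q<n. (A (I div k) p * \<psi> p (I mod k)) * cnj (A (J div k) q * \<psi> q (J mod k)))"
    unfolding on_left_kmap[OF IJ]
    by (intro sum.cong refl) (simp add: rank_one_def index_less md index_div[OF md(1)] index_div[OF md(2)])
  also have "\<dots> = rank_one (m * k) (\<lambda>I. \<Sum>p<n. A (I div k) p * \<psi> p (I mod k)) $$ (I, J)"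
    using IJ by (simp only: rank_one_def index_mat(1) split cnj_sum sum_product)
  finally show ?case .
qed (simp_all add: rank_one_def on_left_def)

lemma on_right_rank_one:
  "on_right n m k (kmap n m A) (rank_one (k * n) (\<lambda>I. \<psi> (I div n) (I mod n))) =
   rank_one (k * m) (\<lambda>I. \<Sum>p<n. A (I mod m) p * \<psi> (I div m) p)"
proof (rule eq_matI, goal_cases)
  case (1 I J)
  hence IJ: "I < k * m" "J < k * m" by (simp_all add: rank_one_def)
  note d = div_less_index[OF IJ(1)] div_less_index[OF IJ(2)]
  have "on_right n m k (kmap n m A) (rank_one (k * n) (\<lambda>I. \<psi> (I div n) (I mod n))) $$ (I, J) =
    (\<Sum>p<n. \<Sum>q<n. (A (I mod m) p * \<psi> (I div m) p) * cnj (A (J mod m) q * \<psi> (J div m) q))"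
    unfolding on_right_kmap[OF IJ]
    by (intro sum.cong refl) (simp add: rank_one_def index_less d)
  also have "\<dots> = rank_one (k * m) (\<lambda>I. \<Sum>p<n. A (I mod m) p * \<psi> (I div m) p) $$ (I, J)"
    using IJ by (simp only: rank_one_def index_mat(1) split cnj_sum sum_product)
  finally show ?case .
qed (simp_all add: rank_one_def on_right_def)

text \<open>The basis vectors of a system of dimension \<open>n\<close> are labelled by the elements of \<open>G\<close> through \<open>g\<close>.
  The property says that some LOCC map to \<open>r\<close> qubit pairs turns all vectors in the span of the error
  vectors in \<open>S\<close> into ebits.\<close>

definition correctable :: "nat \<Rightarrow> nat \<Rightarrow> nat \<Rightarrow> nat set \<Rightarrow> (nat \<Rightarrow> nat) \<Rightarrow> (nat \<times> nat) set \<Rightarrow> bool" where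
  "correctable N r n G g S \<longleftrightarrow> (\<exists>\<Lambda>. locc n n (2 ^ r) (2 ^ r) \<Lambda> \<and>
    (\<forall>\<Psi> c. deficit r (\<Lambda> (rank_one (n * n) (\<lambda>I. \<Psi> (g (I div n)) (g (I mod n))))) \<le>
      (\<Sum>x\<in>G. \<Sum>y\<in>G. (cmod (\<Psi> x y - (\<Sum>e\<in>S. c e * pauli N e x y)))\<^sup>2)))"

text \<open>The Kraus operators of a two-outcome measurement, stacked over \<open>s\<close>, form an
  isometry.\<close>

lemma isometry_norm:
  fixes M :: "nat \<Rightarrow> nat \<Rightarrow> nat \<Rightarrow> complex"
  assumes G: "finite G"
    and M: "\<And>x x'. x \<in> G \<Longrightarrow> x' \<in> G \<Longrightarrow> (\<Sum>s<2::nat. \<Sum>y\<in>K. cnj (M s y x) * M s y x') = (if x = x' then 1 else 0)"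
  shows "(\<Sum>s<2::nat. \<Sum>y\<in>K. (cmod (\<Sum>x\<in>G. M s y x * f x))\<^sup>2) = (\<Sum>x\<in>G. (cmod (f x))\<^sup>2)"
proof -
  let ?h = "\<lambda>s y x x'. cnj (f x) * f x' * (cnj (M s y x) * M s y x')"
  have "complex_of_real (\<Sum>s<2::nat. \<Sum>y\<in>K. (cmod (\<Sum>x\<in>G. M s y x * f x))\<^sup>2) =
    (\<Sum>s<2::nat. \<Sum>y\<in>K. \<Sum>x\<in>G. \<Sum>x'\<in>G. ?h s y x x')"
    unfolding of_real_sum cnj_mult_self[symmetric] cnj_sum sum_product
    by (intro sum.cong refl) simp
  also have "\<dots> = (\<Sum>x\<in>G. \<Sum>x'\<in>G. \<Sum>s<2::nat. \<Sum>y\<in>K. ?h s y x x')"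
    by (rule sum_swap_pairs)
  also have "\<dots> = (\<Sum>x\<in>G. \<Sum>x'\<in>G. cnj (f x) * f x' * (if x = x' then 1 else 0))"
    by (intro sum.cong refl) (simp only: sum_distrib_left[symmetric] M)
  also have "\<dots> = complex_of_real (\<Sum>x\<in>G. (cmod (f x))\<^sup>2)"
    using G by (simp add: if_distrib[of "(*) _"] cnj_mult_self cong: if_cong)
  finally show ?thesis by (simp only: of_real_eq_iff)
qed

text \<open>Both parties apply the measurement \<open>M\<close>, with outcomes \<open>s\<close> and
  \<open>t\<close>. The hypotheses say that it maps the vector of error \<open>e\<close> to a
  multiple \<open>\<kappa>\<close> of the vector of \<open>red e\<close>, which vanishes unless
  \<open>e\<close> is compatible (\<open>C\<close>) with the outcomes. Thus the span of
  \<open>S\<close> is mapped into the spans of the reduced sets, and since \<open>M\<close> is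
  isometric for both parties, the squared distances from these spans add up, over all outcomes, to
  at most the original one.\<close>

lemma correctable_step:
  fixes M :: "nat \<Rightarrow> nat \<Rightarrow> nat \<Rightarrow> complex"
  assumes g: "bij_betw g {..<n} G" and k: "bij_betw k {..<m} K" and S: "finite S"
    and M: "\<And>x x'. x \<in> G \<Longrightarrow> x' \<in> G \<Longrightarrow> (\<Sum>s<2::nat. \<Sum>y\<in>K. cnj (M s y x) * M s y x') = (if x = x' then 1 else 0)"
    and \<kappa>: "\<And>s t e y y'. s < 2 \<Longrightarrow> t < 2 \<Longrightarrow> e \<in> S \<Longrightarrow> y \<in> K \<Longrightarrow> y' \<in> K \<Longrightarrow>
      (\<Sum>x\<in>G. \<Sum>x'\<in>G. M s y x * M t y' x' * pauli N e x x') = \<kappa> s t e * pauli N (red e) y y'"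
    and \<kappa>0: "\<And>s t e. s < 2 \<Longrightarrow> t < 2 \<Longrightarrow> e \<in> S \<Longrightarrow> \<not> C s t e \<Longrightarrow> \<kappa> s t e = 0"
    and IH: "\<And>s t. s < 2 \<Longrightarrow> t < 2 \<Longrightarrow> correctable N r m K k (red ` {e \<in> S. C s t e})"
  shows "correctable N r n G g S"
proof -
  have fin: "finite G" using g by (simp add: bij_betw_finite[symmetric])
  have kK: "k i \<in> K" if "i < m" for i using k that by (auto simp: bij_betw_def)
  define P where "P s t \<Lambda> \<longleftrightarrow> locc m m (2 ^ r) (2 ^ r) \<Lambda> \<and>
    (\<forall>\<Psi> c. deficit r (\<Lambda> (rank_one (m * m) (\<lambda>I. \<Psi> (k (I div m)) (k (I mod m))))) \<le>
      (\<Sum>x\<in>K. \<Sum>y\<in>K. (cmod (\<Psi> x y - (\<Sum>e\<in>red ` {e \<in> S. C s t e}. c e * pauli N e x y)))\<^sup>2))" for s t \<Lambda>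
  have "\<exists>\<Lambda>. P s t \<Lambda>" if "s < 2" "t < 2" for s t
    using IH[OF that] unfolding correctable_def P_def .
  then obtain F where FP: "\<And>s t. s < 2 \<Longrightarrow> t < 2 \<Longrightarrow> P s t (F s t)" by metis
  have F: "locc m m (2 ^ r) (2 ^ r) (F s t)"
    "deficit r (F s t (rank_one (m * m) (\<lambda>I. \<Psi> (k (I div m)) (k (I mod m))))) \<le>
      (\<Sum>x\<in>K. \<Sum>y\<in>K. (cmod (\<Psi> x y - (\<Sum>e\<in>red ` {e \<in> S. C s t e}. c e * pauli N e x y)))\<^sup>2)"
    if "s < 2" "t < 2" for s t \<Psi> c
    using FP[OF that] unfolding P_def by blast+
  define A where "A s i p = M s (k i) (g p)" for s i p
  have kr: "kraus n m 2 A"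
    unfolding kraus_def
  proof (intro allI impI)
    fix p p' assume p: "p < n" "p' < n"
    have "(\<Sum>s<2. \<Sum>i<m. cnj (A s i p) * A s i p') = (\<Sum>s<2. \<Sum>y\<in>K. cnj (M s y (g p)) * M s y (g p'))"
      unfolding A_def by (intro sum.cong refl sum.reindex_bij_betw[OF k])
    also have "\<dots> = (if g p = g p' then 1 else 0)"
      using g p by (intro M) (auto simp: bij_betw_def)
    also have "g p = g p' \<longleftrightarrow> p = p'" using g p by (auto simp: bij_betw_def inj_on_def)
    finally show "(\<Sum>s<2. \<Sum>i<m. cnj (A s i p) * A s i p') = (if p = p' then 1 else 0)" .
  qed
  let ?D = "2 ^ r * 2 ^ r :: nat"
  let ?L = "\<lambda>s X. on_left n m n (kmap n m (A s)) X"
  let ?R = "\<lambda>t X. on_right n m m (kmap n m (A t)) X"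
  define \<Lambda> where "\<Lambda> = (\<lambda>X. mat_sum ?D 2 (\<lambda>s. mat_sum ?D 2 (\<lambda>t. F s t (?R t (?L s X)))))"
  have "locc n n (2 ^ r) (2 ^ r) \<Lambda>"
    unfolding \<Lambda>_def
    by (rule locc.alice[where F = "\<lambda>s Y. mat_sum ?D 2 (\<lambda>t. F s t (?R t Y))",
          OF kraus_instrument[OF kr] locc.bob[OF kraus_instrument[OF kr] F(1)]])
  moreover have "deficit r (\<Lambda> (rank_one (n * n) (\<lambda>I. \<Psi> (g (I div n)) (g (I mod n))))) \<le>
      (\<Sum>x\<in>G. \<Sum>y\<in>G. (cmod (\<Psi> x y - (\<Sum>e\<in>S. c e * pauli N e x y)))\<^sup>2)" for \<Psi> c
  proof -
    define \<Psi>' where "\<Psi>' s t y y' = (\<Sum>x'\<in>G. M t y' x' * (\<Sum>x\<in>G. M s y x * \<Psi> x x'))" for s t y y'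
    \<comment> \<open>Different errors may reduce to the same one; their coefficients are then
      added.\<close>
    define c' where "c' s t e' = (\<Sum>e | e \<in> {e \<in> S. C s t e} \<and> red e = e'. c e * \<kappa> s t e)" for s t e'
    define \<Delta> where "\<Delta> x y = \<Psi> x y - (\<Sum>e\<in>S. c e * pauli N e x y)" for x y
    have RL: "?R t (?L s (rank_one (n * n) (\<lambda>I. \<Psi> (g (I div n)) (g (I mod n))))) =
      rank_one (m * m) (\<lambda>I. \<Psi>' s t (k (I div m)) (k (I mod m)))" for s t
    proof -
      have L: "?L s (rank_one (n * n) (\<lambda>I. \<Psi> (g (I div n)) (g (I mod n)))) =
        rank_one (m * n) (\<lambda>I. \<Sum>p<n. A s (I div n) p * \<Psi> (g p) (g (I mod n)))"
        by (rule on_left_rank_one[where \<psi> = "\<lambda>i j. \<Psi> (g i) (g j)"])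
      have R: "?R t (rank_one (m * n) (\<lambda>I. \<Sum>p<n. A s (I div n) p * \<Psi> (g p) (g (I mod n)))) =
        rank_one (m * m) (\<lambda>I. \<Sum>q<n. A t (I mod m) q * (\<Sum>p<n. A s (I div m) p * \<Psi> (g p) (g q)))"
        by (rule on_right_rank_one[where \<psi> = "\<lambda>i j. \<Sum>p<n. A s i p * \<Psi> (g p) (g j)"])
      have "(\<lambda>I. \<Sum>q<n. A t (I mod m) q * (\<Sum>p<n. A s (I div m) p * \<Psi> (g p) (g q))) =
        (\<lambda>I. \<Psi>' s t (k (I div m)) (k (I mod m)))"
      proof
        fix I
        have inner: "(\<Sum>p<n. M s y (g p) * \<Psi> (g p) z) = (\<Sum>x\<in>G. M s y x * \<Psi> x z)" for y z
          by (rule sum.reindex_bij_betw[OF g, of "\<lambda>x. M s y x * \<Psi> x z"])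
        show "(\<Sum>q<n. A t (I mod m) q * (\<Sum>p<n. A s (I div m) p * \<Psi> (g p) (g q))) =
          \<Psi>' s t (k (I div m)) (k (I mod m))"
          unfolding A_def inner \<Psi>'_def
          by (rule sum.reindex_bij_betw[OF g, of "\<lambda>x'. M t (k (I mod m)) x' * (\<Sum>x\<in>G. M s (k (I div m)) x * \<Psi> x x')"])
      qed
      thus ?thesis unfolding L R by (rule arg_cong)
    qed
    have car: "F s t X \<in> carrier_mat ?D ?D" if "s < 2" "t < 2" "X \<in> carrier_mat (m * m) (m * m)" for s t X
      by (rule linear_map_carrier[OF locc_linear[OF F(1)[OF that(1,2)]] that(3)])
    have diff: "\<Psi>' s t y y' - (\<Sum>e\<in>red ` {e \<in> S. C s t e}. c' s t e * pauli N e y y') =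
        (\<Sum>x'\<in>G. M t y' x' * (\<Sum>x\<in>G. M s y x * \<Delta> x x'))" if st: "s < 2" "t < 2" and y: "y \<in> K" "y' \<in> K" for s t y y'
    proof -
      have "(\<Sum>x'\<in>G. M t y' x' * (\<Sum>x\<in>G. M s y x * (\<Sum>e\<in>S. c e * pauli N e x x'))) =
        (\<Sum>x'\<in>G. \<Sum>x\<in>G. \<Sum>e\<in>S. c e * (M s y x * M t y' x' * pauli N e x x'))"
        unfolding sum_distrib_left by (intro sum.cong refl) (simp add: mult_ac)
      also have "\<dots> = (\<Sum>x'\<in>G. \<Sum>e\<in>S. \<Sum>x\<in>G. c e * (M s y x * M t y' x' * pauli N e x x'))"
        by (rule sum.cong[OF refl], rule sum.swap)
      also have "\<dots> = (\<Sum>e\<in>S. \<Sum>x'\<in>G. \<Sum>x\<in>G. c e * (M s y x * M t y' x' * pauli N e x x'))"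
        by (rule sum.swap)
      also have "\<dots> = (\<Sum>e\<in>S. \<Sum>x\<in>G. \<Sum>x'\<in>G. c e * (M s y x * M t y' x' * pauli N e x x'))"
        by (rule sum.cong[OF refl], rule sum.swap)
      also have "\<dots> = (\<Sum>e\<in>S. c e * (\<kappa> s t e * pauli N (red e) y y'))"
        by (intro sum.cong refl) (simp only: sum_distrib_left[symmetric] \<kappa>[OF st _ y])
      also have "\<dots> = (\<Sum>e\<in>{e \<in> S. C s t e}. c e * \<kappa> s t e * pauli N (red e) y y')"
        using S \<kappa>0[OF st] by (intro sum.mono_neutral_cong_right) auto
      also have "\<dots> = (\<Sum>e'\<in>red ` {e \<in> S. C s t e}. \<Sum>e | e \<in> {e \<in> S. C s t e} \<and> red e = e'.
          c e * \<kappa> s t e * pauli N (red e) y y')"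
        using S by (intro sum.image_gen) simp
      also have "\<dots> = (\<Sum>e'\<in>red ` {e \<in> S. C s t e}. c' s t e' * pauli N e' y y')"
        unfolding c'_def sum_distrib_right by (intro sum.cong refl) auto
      finally show ?thesis
        unfolding \<Psi>'_def \<Delta>_def by (simp add: right_diff_distrib sum_subtractf)
    qed
    have "deficit r (\<Lambda> (rank_one (n * n) (\<lambda>I. \<Psi> (g (I div n)) (g (I mod n))))) =
      (\<Sum>s<2. deficit r (mat_sum ?D 2 (\<lambda>t. F s t (rank_one (m * m) (\<lambda>I. \<Psi>' s t (k (I div m)) (k (I mod m)))))))"
      unfolding \<Lambda>_def RL by (rule deficit_mat_sum) simp
    also have "\<dots> = (\<Sum>s<2. \<Sum>t<2. deficit r (F s t (rank_one (m * m) (\<lambda>I. \<Psi>' s t (k (I div m)) (k (I mod m))))))"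
      by (rule sum.cong[OF refl], rule deficit_mat_sum) (auto intro: car)
    also have "\<dots> \<le> (\<Sum>s<2. \<Sum>t<2. \<Sum>y\<in>K. \<Sum>y'\<in>K.
        (cmod (\<Psi>' s t y y' - (\<Sum>e\<in>red ` {e \<in> S. C s t e}. c' s t e * pauli N e y y')))\<^sup>2)"
      by (intro sum_mono F(2)) auto
    also have "\<dots> = (\<Sum>s<2. \<Sum>t<2. \<Sum>y\<in>K. \<Sum>y'\<in>K. (cmod (\<Sum>x'\<in>G. M t y' x' * (\<Sum>x\<in>G. M s y x * \<Delta> x x')))\<^sup>2)"
      by (intro sum.cong refl) (simp only: diff lessThan_iff)
    also have "\<dots> = (\<Sum>s<2::nat. \<Sum>y\<in>K. \<Sum>t<2::nat. \<Sum>y'\<in>K. (cmod (\<Sum>x'\<in>G. M t y' x' * (\<Sum>x\<in>G. M s y x * \<Delta> x x')))\<^sup>2)"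
      by (rule sum.cong[OF refl], rule sum.swap)
    also have "\<dots> = (\<Sum>s<2::nat. \<Sum>y\<in>K. \<Sum>x'\<in>G. (cmod (\<Sum>x\<in>G. M s y x * \<Delta> x x'))\<^sup>2)"
      by (rule sum.cong[OF refl], rule sum.cong[OF refl], rule isometry_norm[OF fin M])
    also have "\<dots> = (\<Sum>s<2::nat. \<Sum>x'\<in>G. \<Sum>y\<in>K. (cmod (\<Sum>x\<in>G. M s y x * \<Delta> x x'))\<^sup>2)"
      by (rule sum.cong[OF refl], rule sum.swap)
    also have "\<dots> = (\<Sum>x'\<in>G. \<Sum>s<2::nat. \<Sum>y\<in>K. (cmod (\<Sum>x\<in>G. M s y x * \<Delta> x x'))\<^sup>2)"
      by (rule sum.swap)
    also have "\<dots> = (\<Sum>x'\<in>G. \<Sum>x\<in>G. (cmod (\<Delta> x x'))\<^sup>2)"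
      by (rule sum.cong[OF refl], rule isometry_norm[OF fin M])
    also have "\<dots> = (\<Sum>x\<in>G. \<Sum>x'\<in>G. (cmod (\<Delta> x x'))\<^sup>2)" by (rule sum.swap)
    finally show ?thesis unfolding \<Delta>_def .
  qed
  ultimately show ?thesis unfolding correctable_def by blast
qed

subsection \<open>One round of the protocol\<close>

lemma xor_left_cancel [simp]: "xor x (xor x y) = (y :: nat)"
  by (simp flip: xor.assoc)

lemma xor_right_eq_iff: "xor x v = xor y v \<longleftrightarrow> x = (y :: nat)"
  by (metis xor_cancel)

lemma xor_eq_iff: "x = xor y v \<longleftrightarrow> y = xor x (v :: nat)"
  by (metis xor_cancel)

text \<open>No two errors in \<open>S\<close> can be told apart on \<open>G\<close>, so they all
  have the same vector there, and one unitary correction by Bob undoes every superposition of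
  them.\<close>

lemma correctable_base:
  assumes G: "xor_group N G" and g: "bij_betw g {..<2 ^ r} G" and S: "finite S" and a: "a \<in> G"
    and eq: "\<And>e. e \<in> S \<Longrightarrow> fst e = a" "\<And>e x. e \<in> S \<Longrightarrow> x \<in> G \<Longrightarrow> walsh N (snd e) x = walsh N b x"
  shows "correctable N r (2 ^ r) G g S"
proof -
  let ?n = "2 ^ r :: nat"
  note fin = xor_group_finite[OF G]
  have gG: "g i \<in> G" if "i < ?n" for i using g that by (auto simp: bij_betw_def)
  have gi: "g i = g j \<longleftrightarrow> i = j" if "i < ?n" "j < ?n" for i j
    using g that by (auto simp: bij_betw_def inj_on_def)
  have shift: "bij_betw (\<lambda>y. xor y a) G G"
    by (rule bij_betw_byWitness[where f' = "\<lambda>y. xor y a"]) (use a xor_groupD[OF G] in auto)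
  \<comment> \<open>The inverse error: translation by \<open>a\<close> with the sign of
    \<open>b\<close>. Labels outside \<open>G\<close> do not appear because \<open>a\<close> lies in
    \<open>G\<close>.\<close>
  define B where "B i p = (if g p = xor (g i) a then walsh N b (g i) else 0)" for i p
  have kr: "kraus ?n ?n 1 (\<lambda>_. B)"
    unfolding kraus_def
  proof (intro allI impI)
    fix p p' assume p: "p < ?n" "p' < ?n"
    have "(\<Sum>x<1::nat. \<Sum>i<?n. cnj (B i p) * B i p') =
      (\<Sum>i<?n. (\<lambda>y. if y = xor (g p) a then if g p = g p' then 1 else 0 else 0) (g i))"
      by (auto simp: B_def xor_eq_iff[of _ "g p"] intro!: sum.cong)
    also have "\<dots> = (\<Sum>y\<in>G. if y = xor (g p) a then if g p = g p' then 1 else 0 else 0)"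
      by (rule sum.reindex_bij_betw[OF g])
    also have "\<dots> = (if p = p' then 1 else 0)"
      using fin xor_groupD(3)[OF G gG[OF p(1)] a] gi[OF p] by simp
    finally show "(\<Sum>x<1::nat. \<Sum>i<?n. cnj (B i p) * B i p') = (if p = p' then 1 else 0)" .
  qed
  let ?D = "?n * ?n"
  let ?R = "on_right ?n ?n ?n (kmap ?n ?n B)"
  define \<Lambda> where "\<Lambda> = (\<lambda>X. mat_sum ?D 1 (\<lambda>_. ?R X))"
  have "locc ?n ?n ?n ?n \<Lambda>"
    unfolding \<Lambda>_def using locc.bob[OF kraus_instrument[OF kr], where F = "\<lambda>_ X. X"] locc.finish by simp
  moreover have "deficit r (\<Lambda> (rank_one ?D (\<lambda>I. \<Psi> (g (I div ?n)) (g (I mod ?n))))) \<le>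
      (\<Sum>x\<in>G. \<Sum>y\<in>G. (cmod (\<Psi> x y - (\<Sum>e\<in>S. c e * pauli N e x y)))\<^sup>2)" for \<Psi> c
  proof -
    define z where "z = (\<Sum>e\<in>S. c e)"
    define f where "f I = walsh N b (g (I mod ?n)) * \<Psi> (g (I div ?n)) (xor (g (I mod ?n)) a)" for I
    define \<Delta> where "\<Delta> x y = (cmod (\<Psi> x y - z * pauli N (a, b) x y))\<^sup>2" for x y
    have "?R (rank_one ?D (\<lambda>I. \<Psi> (g (I div ?n)) (g (I mod ?n)))) =
      rank_one ?D (\<lambda>I. \<Sum>p<?n. B (I mod ?n) p * \<Psi> (g (I div ?n)) (g p))"
      by (rule on_right_rank_one[where \<psi> = "\<lambda>i j. \<Psi> (g i) (g j)"])
    also have "(\<lambda>I. \<Sum>p<?n. B (I mod ?n) p * \<Psi> (g (I div ?n)) (g p)) = f"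
    proof
      fix I
      have "(\<Sum>p<?n. B (I mod ?n) p * \<Psi> (g (I div ?n)) (g p)) =
        (\<Sum>p<?n. (\<lambda>y. if y = xor (g (I mod ?n)) a then f I else 0) (g p))"
        by (intro sum.cong refl) (simp add: B_def f_def)
      also have "\<dots> = (\<Sum>y\<in>G. if y = xor (g (I mod ?n)) a then f I else 0)"
        by (rule sum.reindex_bij_betw[OF g])
      also have "\<dots> = f I" using fin xor_groupD(3)[OF G gG[of "I mod ?n"] a] by simp
      finally show "(\<Sum>p<?n. B (I mod ?n) p * \<Psi> (g (I div ?n)) (g p)) = f I" .
    qed
    finally have "deficit r (\<Lambda> (rank_one ?D (\<lambda>I. \<Psi> (g (I div ?n)) (g (I mod ?n))))) = deficit r (rank_one ?D f)"
      unfolding \<Lambda>_def by (subst deficit_mat_sum) simp_all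
    \<comment> \<open>The factor \<open>sqrt (2 ^ r)\<close> appears because \<open>pauli\<close> is
      not normalised while \<open>ebits_vec\<close> is a unit vector.\<close>
    also have "\<dots> \<le> (\<Sum>I<?D. (cmod (f I - (z * complex_of_real (sqrt (2 ^ r))) * ebits_vec r I))\<^sup>2)"
      by (rule deficit_rank_one_le)
    also have "\<dots> = (\<Sum>i<?n. \<Sum>j<?n. (cmod (f (i * ?n + j) - z * (if i = j then 1 else 0)))\<^sup>2)"
      unfolding sum_mult_index by (intro sum.cong refl) (simp add: ebits_vec_def mult.assoc flip: of_real_mult)
    also have "\<dots> = (\<Sum>i<?n. \<Sum>j<?n. (\<lambda>y. \<Delta> (g i) (xor y a)) (g j))"
    proof (intro sum.cong refl)
      fix i j assume ij: "i \<in> {..<?n}" "j \<in> {..<?n}"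
      let ?w = "walsh N b (g j)"
      have "cmod ?w = 1" using walsh_cases[of N b "g j"] by auto
      have "f (i * ?n + j) - z * (if i = j then 1 else 0) = ?w * (\<Psi> (g i) (xor (g j) a) - z * pauli N (a, b) (g i) (xor (g j) a))"
        using ij gi[of i j] by (auto simp: f_def pauli_def xor_right_eq_iff algebra_simps)
      thus "(cmod (f (i * ?n + j) - z * (if i = j then 1 else 0)))\<^sup>2 = (\<lambda>y. \<Delta> (g i) (xor y a)) (g j)"
        using \<open>cmod ?w = 1\<close> by (simp add: \<Delta>_def norm_mult)
    qed
    also have "\<dots> = (\<Sum>i<?n. \<Sum>y\<in>G. \<Delta> (g i) (xor y a))"
      by (rule sum.cong[OF refl], rule sum.reindex_bij_betw[OF g])
    also have "\<dots> = (\<Sum>i<?n. \<Sum>y\<in>G. \<Delta> (g i) y)"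
      by (rule sum.cong[OF refl], rule sum.reindex_bij_betw[OF shift])
    also have "\<dots> = (\<Sum>x\<in>G. \<Sum>y\<in>G. \<Delta> x y)"
      by (rule sum.reindex_bij_betw[OF g])
    also have "\<dots> = (\<Sum>x\<in>G. \<Sum>y\<in>G. (cmod (\<Psi> x y - (\<Sum>e\<in>S. c e * pauli N e x y)))\<^sup>2)"
    proof (intro sum.cong refl)
      fix x y assume "x \<in> G" "y \<in> G"
      hence "(\<Sum>e\<in>S. c e * pauli N e x y) = (\<Sum>e\<in>S. c e * pauli N (a, b) x y)"
        using eq by (intro sum.cong refl) (simp add: pauli_def)
      thus "\<Delta> x y = (cmod (\<Psi> x y - (\<Sum>e\<in>S. c e * pauli N e x y)))\<^sup>2"
        by (simp add: \<Delta>_def z_def sum_distrib_right)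
    qed
    finally show ?thesis .
  qed
  ultimately show ?thesis unfolding correctable_def by blast
qed

definition hyperplane :: "nat \<Rightarrow> nat \<Rightarrow> nat set \<Rightarrow> nat set" where
  "hyperplane N h G = {x \<in> G. walsh N h x = 1}"

text \<open>For \<open>v\<close> with \<open>walsh N h v = -1\<close>, every coset of
  \<open>{0, v}\<close> in the group has exactly one representative in the hyperplane, and a bit
  flip mask is replaced by this representative. The phase mask may stay, since only its character on
  the smaller group matters.\<close>

definition proj_error :: "nat \<Rightarrow> nat \<Rightarrow> nat \<Rightarrow> nat \<times> nat \<Rightarrow> nat \<times> nat" where
  "proj_error N h v e = (if walsh N h (fst e) = 1 then fst e else xor (fst e) v, snd e)"

lemma hyperplane_group: "xor_group N G \<Longrightarrow> xor_group N (hyperplane N h G)"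
  by (auto simp: xor_group_def hyperplane_def walsh_xor)

lemma sum_lessThan_2: "(\<Sum>s<2::nat. f s) = f 0 + f 1"
  by (simp add: numeral_2_eq_2)

text \<open>Exactly one of \<open>x\<close> and \<open>xor x v\<close> lies in the hyperplane; both
  measurements owe their completeness to this.\<close>

lemma hyperplane_sum_delta:
  assumes G: "xor_group N G" and v: "v \<in> G" "walsh N h v = -1" and "x \<in> G"
  shows "(\<Sum>y\<in>hyperplane N h G. if x = y then c else 0) + (\<Sum>y\<in>hyperplane N h G. if x = xor y v then c else 0) = (c :: complex)"
proof -
  have fin: "finite (hyperplane N h G)" using xor_group_finite[OF hyperplane_group[OF G]] .
  have "x \<in> hyperplane N h G \<longleftrightarrow> xor x v \<notin> hyperplane N h G"
    using assms xor_groupD(3)[OF G \<open>x \<in> G\<close> v(1)] walsh_cases[of N h x] by (auto simp: hyperplane_def walsh_xor)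
  thus ?thesis using fin by (auto simp: xor_eq_iff[of x] eq_commute[of "xor x v"])
qed

lemma hyperplane_xor:
  assumes "y \<in> hyperplane N h G" "y' \<in> hyperplane N h G" "walsh N h v = -1"
  shows "walsh N h a = -1 \<Longrightarrow> y' \<noteq> xor y a"
    and "walsh N h a = 1 \<Longrightarrow> y' \<noteq> xor (xor y a) v"
    and "xor y' v = xor y a \<longleftrightarrow> y' = xor (xor y a) v"
    and "xor (xor y v) a = xor (xor y a) v"
    and "xor y (xor a v) = xor (xor y a) v"
proof -
  show "xor y' v = xor y a \<longleftrightarrow> y' = xor (xor y a) v" by (metis xor_cancel)
qed (use assms in \<open>auto simp: hyperplane_def walsh_xor xor.assoc xor.commute xor.left_commute\<close>)

text \<open>Both parties measure the parity \<open>h\<close> of their bits, Bob then knows \<open>walsh N h a\<close> for the bit flip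
  mask \<open>a\<close> of the error.\<close>

lemma correctable_bit_step:
  assumes G: "xor_group N G" and v: "v \<in> G" "walsh N h v = -1"
    and g: "bij_betw g {..<n} G" and k: "bij_betw k {..<m} (hyperplane N h G)"
    and S: "finite S" "fst ` S \<subseteq> G"
    and IH: "\<And>s t. s < 2 \<Longrightarrow> t < 2 \<Longrightarrow> correctable N r m (hyperplane N h G) k
      (proj_error N h v ` {e \<in> S. walsh N h (fst e) = (-1) ^ (s + t)})"
  shows "correctable N r n G g S"
proof -
  let ?K = "hyperplane N h G"
  \<comment> \<open>Outcome 0 keeps the labels in the hyperplane; outcome 1 keeps the others, moved
    into the hyperplane by \<open>v\<close>. Thus \<open>h\<close> is what is measured, and
    \<open>v\<close> only serves to relabel.\<close>
  define M where "M s y x = (if x = (if s = 0 then y else xor y v) then 1 else 0 :: complex)" for s :: nat and y x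
  \<comment> \<open>The two parities differ by the character \<open>h\<close> of the bit flip mask.
    For \<open>s = 1\<close> Alice's true label is \<open>xor y v\<close>, which contributes the
    sign of the phase mask at \<open>v\<close>.\<close>
  define \<kappa> where "\<kappa> s t e = (if walsh N h (fst e) = (-1) ^ (s + t) then walsh N (snd e) (if s = 0 then 0 else v) else 0)"
    for s t :: nat and e :: "nat \<times> nat"
  have fin: "finite G" using xor_group_finite[OF G] .
  have KG: "y \<in> G" "xor y v \<in> G" if "y \<in> ?K" for y
    using that xor_groupD(3)[OF G _ v(1)] by (auto simp: hyperplane_def)
  show ?thesis
  proof (rule correctable_step[where M = M and \<kappa> = \<kappa> and red = "proj_error N h v"
        and C = "\<lambda>s t e. walsh N h (fst e) = (-1) ^ (s + t)", OF g k S(1)])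
    fix x x' assume x: "x \<in> G" "x' \<in> G"
    have "(\<Sum>s<2::nat. \<Sum>y\<in>?K. cnj (M s y x) * M s y x') =
      (\<Sum>y\<in>?K. if x = y then if x = x' then 1 else 0 else 0) + (\<Sum>y\<in>?K. if x = xor y v then if x = x' then 1 else 0 else 0)"
      unfolding sum_lessThan_2 M_def by (intro arg_cong2[of _ _ _ _ "(+)"] sum.cong refl) auto
    also have "\<dots> = (if x = x' then 1 else 0)"
      by (rule hyperplane_sum_delta[OF G v x(1)])
    finally show "(\<Sum>s<2::nat. \<Sum>y\<in>?K. cnj (M s y x) * M s y x') = (if x = x' then 1 else 0)" .
  next
    fix s t :: nat and e y y' assume st: "s < 2" "t < 2" and e: "e \<in> S" and y: "y \<in> ?K" "y' \<in> ?K"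
    define p where "p = (if s = 0 then y else xor y v)"
    define p' where "p' = (if t = 0 then y' else xor y' v)"
    have pG: "p \<in> G" "p' \<in> G" using KG[OF y(1)] KG[OF y(2)] by (simp_all add: p_def p'_def)
    have "(\<Sum>x\<in>G. \<Sum>x'\<in>G. M s y x * M t y' x' * pauli N e x x') =
      (\<Sum>x\<in>G. if x = p then \<Sum>x'\<in>G. if x' = p' then pauli N e x x' else 0 else 0)"
      unfolding M_def p_def[symmetric] p'_def[symmetric] by (intro sum.cong refl) (auto intro!: sum.cong)
    also have "\<dots> = pauli N e p p'" using fin pG by simp
    also have "\<dots> = \<kappa> s t e * pauli N (proj_error N h v e) y y'"
    proof -
      have "s = 0 \<or> s = 1" "t = 0 \<or> t = 1" using st by auto
      moreover have "walsh N h (fst e) = 1 \<or> walsh N h (fst e) = -1" by (rule walsh_cases)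
      moreover note hyperplane_xor[OF y v(2), of "fst e"]
      ultimately show ?thesis
        by (elim disjE) (auto simp: p_def p'_def \<kappa>_def pauli_def proj_error_def walsh_xor xor_right_eq_iff)
    qed
    finally show "(\<Sum>x\<in>G. \<Sum>x'\<in>G. M s y x * M t y' x' * pauli N e x x') = \<kappa> s t e * pauli N (proj_error N h v e) y y'" .
  qed (use IH in \<open>auto simp: \<kappa>_def\<close>)
qed

text \<open>Both parties measure the sign under the translation by \<open>v\<close>, which reveals \<open>walsh N b v\<close> for the
  phase flip mask \<open>b\<close> of the error.\<close>

lemma correctable_phase_step:
  assumes G: "xor_group N G" and v: "v \<in> G" "walsh N h v = -1"
    and g: "bij_betw g {..<n} G" and k: "bij_betw k {..<m} (hyperplane N h G)"
    and S: "finite S" "fst ` S \<subseteq> G"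
    and IH: "\<And>s t. s < 2 \<Longrightarrow> t < 2 \<Longrightarrow> correctable N r m (hyperplane N h G) k
      (proj_error N h v ` {e \<in> S. walsh N (snd e) v = (-1) ^ (s + t)})"
  shows "correctable N r n G g S"
proof -
  let ?K = "hyperplane N h G"
  define q where "q = complex_of_real (1 / sqrt 2)"
  have qq: "q * q = 1 / 2" "cnj q = q" by (simp_all add: q_def flip: of_real_mult)
  \<comment> \<open>Projection onto the normalised sum or difference of \<open>y\<close> and
    \<open>xor y v\<close>. The roles are exchanged: \<open>v\<close> is measured, and
    \<open>h\<close> only selects a label for each coset of \<open>{0, v}\<close>.\<close>
  define M where "M s y x = q * ((if x = y then 1 else 0) + (-1) ^ s * (if x = xor y v then 1 else 0))" for s :: nat and y x
  \<comment> \<open>If the bit flip leaves the hyperplane, Bob's representative is shifted by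
    \<open>v\<close>, on which his outcome \<open>t\<close> acts with the sign
    \<open>(-1) ^ t\<close>.\<close>
  define \<kappa> where "\<kappa> s t e = (if walsh N (snd e) v = (-1) ^ (s + t) then if walsh N h (fst e) = 1 then 1 else (-1) ^ t else 0 :: complex)"
    for s t :: nat and e :: "nat \<times> nat"
  have fin: "finite G" using xor_group_finite[OF G] .
  have KG: "y \<in> G" "xor y v \<in> G" if "y \<in> ?K" for y
    using that xor_groupD(3)[OF G _ v(1)] by (auto simp: hyperplane_def)
  show ?thesis
  proof (rule correctable_step[where M = M and \<kappa> = \<kappa> and red = "proj_error N h v"
        and C = "\<lambda>s t e. walsh N (snd e) v = (-1) ^ (s + t)", OF g k S(1)])
    fix x x' assume x: "x \<in> G" "x' \<in> G"
    have "cnj (M 0 y x) * M 0 y x' + cnj (M 1 y x) * M 1 y x' =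
      (if x = y then if x = x' then 1 else 0 else 0) + (if x = xor y v then if x = x' then 1 else 0 else 0)" for y
      using qq by (simp add: M_def algebra_simps)
    hence "(\<Sum>s<2::nat. \<Sum>y\<in>?K. cnj (M s y x) * M s y x') =
      (\<Sum>y\<in>?K. if x = y then if x = x' then 1 else 0 else 0) + (\<Sum>y\<in>?K. if x = xor y v then if x = x' then 1 else 0 else 0)"
      unfolding sum_lessThan_2 sum.distrib[symmetric] by (intro sum.cong refl)
    also have "\<dots> = (if x = x' then 1 else 0)"
      by (rule hyperplane_sum_delta[OF G v x(1)])
    finally show "(\<Sum>s<2::nat. \<Sum>y\<in>?K. cnj (M s y x) * M s y x') = (if x = x' then 1 else 0)" .
  next
    fix s t :: nat and e y y' assume st: "s < 2" "t < 2" and e: "e \<in> S" and y: "y \<in> ?K" "y' \<in> ?K"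
    have delta: "(\<Sum>x\<in>G. M s y x * f x) = q * (f y + (-1) ^ s * f (xor y v))" if "y \<in> ?K" for s y and f :: "nat \<Rightarrow> complex"
    proof -
      have "(\<Sum>x\<in>G. M s y x * f x) = q * ((\<Sum>x\<in>G. if x = y then f x else 0) + (-1) ^ s * (\<Sum>x\<in>G. if x = xor y v then f x else 0))"
        unfolding M_def sum_distrib_left sum.distrib[symmetric] by (intro sum.cong refl) (auto simp: algebra_simps)
      thus ?thesis using fin KG[OF that] by simp
    qed
    have "(\<Sum>x\<in>G. \<Sum>x'\<in>G. M s y x * M t y' x' * pauli N e x x') =
      (\<Sum>x\<in>G. M s y x * (\<Sum>x'\<in>G. M t y' x' * pauli N e x x'))"
      by (simp add: sum_distrib_left mult.assoc)
    also have "\<dots> = q * q * (pauli N e y y' + (-1) ^ t * pauli N e y (xor y' v) +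
        (-1) ^ s * (pauli N e (xor y v) y' + (-1) ^ t * pauli N e (xor y v) (xor y' v)))"
      by (simp only: delta[OF y(1)] delta[OF y(2)]) (simp add: algebra_simps)
    also have "\<dots> = \<kappa> s t e * pauli N (proj_error N h v e) y y'"
    proof -
      have "s = 0 \<or> s = 1" "t = 0 \<or> t = 1" using st by auto
      moreover have "walsh N h (fst e) = 1 \<or> walsh N h (fst e) = -1" by (rule walsh_cases)
      moreover have "walsh N (snd e) v = 1 \<or> walsh N (snd e) v = -1" by (rule walsh_cases)
      moreover note hyperplane_xor[OF y v(2), of "fst e"]
      ultimately show ?thesis
        unfolding qq by (elim disjE) (auto simp: \<kappa>_def pauli_def proj_error_def walsh_xor xor_right_eq_iff)
    qed
    finally show "(\<Sum>x\<in>G. \<Sum>x'\<in>G. M s y x * M t y' x' * pauli N e x x') = \<kappa> s t e * pauli N (proj_error N h v e) y y'" .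
  qed (use IH in \<open>auto simp: \<kappa>_def\<close>)
qed

subsection \<open>Choosing the measurements\<close>

text \<open>Ordered pairs of errors that still act differently and hence must be told apart; their
  number is the potential that decreases in each round. Phase masks are compared through their
  characters on \<open>G\<close> only, because masks with the same character need no
  distinction.\<close>

definition confusable_pairs :: "nat \<Rightarrow> nat set \<Rightarrow> (nat \<times> nat) set \<Rightarrow> ((nat \<times> nat) \<times> (nat \<times> nat)) set" where
  "confusable_pairs N G S = {(e, e') \<in> S \<times> S.
    fst e \<noteq> fst e' \<or> (\<exists>x\<in>G. walsh N (snd e) x \<noteq> walsh N (snd e') x)}"

lemma confusable_pairs_finite: "finite S \<Longrightarrow> finite (confusable_pairs N G S)"
  unfolding confusable_pairs_def by (rule finite_subset[of _ "S \<times> S"]) auto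

text \<open>Double counting: if each \<open>p\<close> is separated by half of all \<open>h\<close>,
  some \<open>h\<close> separates at least half of all \<open>p\<close>.\<close>

lemma averaging:
  assumes "finite P" "finite H" "H \<noteq> {}"
    and half: "\<And>p. p \<in> P \<Longrightarrow> 2 * card {h \<in> H. Q p h} = card H"
  shows "\<exists>h\<in>H. card P \<le> 2 * card {p \<in> P. Q p h}"
proof (rule ccontr)
  assume "\<not> ?thesis"
  hence "(\<Sum>h\<in>H. 2 * card {p \<in> P. Q p h}) < (\<Sum>h\<in>H. card P)"
    using assms by (intro sum_strict_mono) auto
  moreover have "(\<Sum>h\<in>H. card {p \<in> P. Q p h}) = (\<Sum>p\<in>P. card {h \<in> H. Q p h})"
  proof -
    have card: "card {x \<in> A. R x} = (\<Sum>x\<in>A. if R x then 1 else 0)" if "finite A" for A :: "'c set" and R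
      unfolding card_eq_sum using that by (rule sum.inter_filter)
    have "(\<Sum>h\<in>H. card {p \<in> P. Q p h}) = (\<Sum>h\<in>H. \<Sum>p\<in>P. if Q p h then 1 else 0)"
      by (rule sum.cong[OF refl], rule card[OF assms(1)])
    also have "\<dots> = (\<Sum>p\<in>P. \<Sum>h\<in>H. if Q p h then 1 else 0)" by (rule sum.swap)
    also have "\<dots> = (\<Sum>p\<in>P. card {h \<in> H. Q p h})"
      by (rule sum.cong[OF refl], rule card[OF assms(2), symmetric])
    finally show ?thesis .
  qed
  moreover have "(\<Sum>p\<in>P. 2 * card {h \<in> H. Q p h}) = card P * card H" using half by simp
  ultimately show False by (simp add: sum_distrib_left[symmetric] mult.commute)
qed

text \<open>A confusable pair differs in the bit flips or in the phase characters, and one of the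
  two kinds comprises at least half of the pairs. Within it, a random parity or a random translation
  separates each pair with probability 1/2. Together this gives a quarter.\<close>

lemma choose_measurement:
  assumes G: "xor_group N G" "G \<noteq> {0}" and S: "finite S" "fst ` S \<subseteq> G"
  obtains v h where "v \<in> G" "walsh N h v = -1"
    "card (confusable_pairs N G S) \<le> 4 * card {(e, e') \<in> confusable_pairs N G S. walsh N h (fst e) \<noteq> walsh N h (fst e')} \<or>
     card (confusable_pairs N G S) \<le> 4 * card {(e, e') \<in> confusable_pairs N G S. walsh N (snd e) v \<noteq> walsh N (snd e') v}"
proof -
  let ?P = "confusable_pairs N G S"
  have finP: "finite ?P" using S(1) by (rule confusable_pairs_finite)
  define P1 where "P1 = {(e, e') \<in> ?P. fst e \<noteq> fst e'}"
  define P2 where "P2 = {(e, e') \<in> ?P. \<exists>x\<in>G. walsh N (snd e) x \<noteq> walsh N (snd e') x}"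
  have fin12: "finite P1" "finite P2" using finP by (auto simp: P1_def P2_def intro: finite_subset)
  have "?P = P1 \<union> P2" by (auto simp: P1_def P2_def confusable_pairs_def)
  hence le: "card ?P \<le> card P1 + card P2" by (metis card_Un_le)
  consider "?P = {}" | "P1 \<noteq> {}" "card ?P \<le> 2 * card P1" | "P2 \<noteq> {}" "card ?P \<le> 2 * card P2"
  proof (cases "?P = {}")
    case False
    hence "card ?P > 0" using finP by (simp add: card_gt_0_iff)
    hence "(P1 \<noteq> {} \<and> card ?P \<le> 2 * card P1) \<or> (P2 \<noteq> {} \<and> card ?P \<le> 2 * card P2)"
      using le by (cases "card P1 \<le> card P2") auto
    thus ?thesis using that by blast
  qed
  thus ?thesis
  proof cases
    case 1
    \<comment> \<open>There is nothing to separate, but the round still has to halve the system, so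
      any nontrivial choice will do.\<close>
    obtain v where v: "v \<in> G" "v \<noteq> 0" using G xor_groupD(1)[OF G(1)] by blast
    obtain h where "walsh N h v = -1" using walsh_separates[OF v(2) xor_groupD(2)[OF G(1) v(1)]] by blast
    thus ?thesis using that[OF v(1)] 1 by simp
  next
    case 2
    have "2 * card {h \<in> {..<2 ^ N}. walsh N h (fst (fst p)) \<noteq> walsh N h (fst (snd p))} = card {..<2 ^ N :: nat}"
      if p: "p \<in> P1" for p
    proof -
      obtain e e' where p': "p = (e, e')" by (cases p)
      define x where "x = xor (fst e) (fst e')"
      have ee: "fst e \<noteq> fst e'" "fst e \<in> G" "fst e' \<in> G"
        using p S(2) unfolding p' P1_def confusable_pairs_def by auto
      have "x \<noteq> 0" "x < 2 ^ N" using ee xor_groupD(2,3)[OF G(1)] by (auto simp: x_def xor_eq_0_iff)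
      then obtain b where b: "b < 2 ^ N" "walsh N b x = -1" using walsh_separates by blast
      have "walsh N h (fst e) \<noteq> walsh N h (fst e') \<longleftrightarrow> walsh N h x = -1" for h
        using walsh_cases[of N h "fst e"] walsh_cases[of N h "fst e'"] by (auto simp: x_def walsh_xor)
      moreover have "card {..<2 ^ N :: nat} = 2 * card {h \<in> {..<2 ^ N}. walsh N h x = -1}"
        by (rule character_half_card(2)[OF xor_group_full walsh_xor_left walsh_cases _ b(2)]) (use b in simp)
      ultimately show ?thesis by (simp add: p')
    qed
    moreover have "{..<2 ^ N} \<noteq> ({} :: nat set)" using xor_groupD(1)[OF xor_group_full, of N] by blast
    ultimately have "\<exists>h\<in>{..<2 ^ N}. card P1 \<le> 2 * card {p \<in> P1. walsh N h (fst (fst p)) \<noteq> walsh N h (fst (snd p))}"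
      by (intro averaging[OF fin12(1) finite_lessThan])
    then
    obtain h where h: "h < 2 ^ N"
      "card P1 \<le> 2 * card {p \<in> P1. walsh N h (fst (fst p)) \<noteq> walsh N h (fst (snd p))}"
      by auto
    let ?Q = "{p \<in> P1. walsh N h (fst (fst p)) \<noteq> walsh N h (fst (snd p))}"
    let ?Q' = "{(e, e') \<in> ?P. walsh N h (fst e) \<noteq> walsh N h (fst e')}"
    have "card P1 > 0" using 2 fin12 by (simp add: card_gt_0_iff)
    hence "?Q \<noteq> {}" using h(2) by (metis card.empty mult_0_right not_less)
    then obtain e e' where e: "(e, e') \<in> P1" "walsh N h (fst e) \<noteq> walsh N h (fst e')" by auto
    have "fst e \<in> G" "fst e' \<in> G" using e(1) S(2) unfolding P1_def confusable_pairs_def by auto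
    \<comment> \<open>A separated pair provides an element of \<open>G\<close> on which
      \<open>h\<close> is nontrivial.\<close>
    hence v: "xor (fst e) (fst e') \<in> G" by (rule xor_groupD(3)[OF G(1)])
    have hv: "walsh N h (xor (fst e) (fst e')) = -1"
      using e(2) walsh_cases[of N h "fst e"] walsh_cases[of N h "fst e'"] by (auto simp: walsh_xor)
    have "card ?Q \<le> card ?Q'"
      using finP by (intro card_mono) (auto simp: P1_def intro: finite_subset)
    hence "card ?P \<le> 4 * card ?Q'" using 2(2) h(2) by linarith
    thus ?thesis using that[OF v hv] by blast
  next
    case 3
    have "2 * card {v \<in> G. walsh N (snd (fst p)) v \<noteq> walsh N (snd (snd p)) v} = card G"
      if p: "p \<in> P2" for p
    proof -
      obtain e e' where p': "p = (e, e')" by (cases p)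
      obtain x where x: "x \<in> G" "walsh N (snd e) x \<noteq> walsh N (snd e') x"
        using p unfolding p' P2_def by auto
      let ?f = "walsh N (xor (snd e) (snd e'))"
      have *: "walsh N (snd e) v \<noteq> walsh N (snd e') v \<longleftrightarrow> ?f v = -1" for v
        using walsh_cases[of N "snd e" v] walsh_cases[of N "snd e'" v] by (auto simp: walsh_xor_left)
      have "card G = 2 * card {v \<in> G. ?f v = -1}"
        by (rule character_half_card(2)[OF G(1) walsh_xor walsh_cases x(1)]) (use * x(2) in blast)
      thus ?thesis by (simp add: p' *)
    qed
    from averaging[where Q = "\<lambda>p v. walsh N (snd (fst p)) v \<noteq> walsh N (snd (snd p)) v", OF fin12(2) xor_group_finite[OF G(1)] _ this]
    obtain v where v: "v \<in> G"
      "card P2 \<le> 2 * card {p \<in> P2. walsh N (snd (fst p)) v \<noteq> walsh N (snd (snd p)) v}"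
      using xor_groupD(1)[OF G(1)] by auto
    let ?Q = "{p \<in> P2. walsh N (snd (fst p)) v \<noteq> walsh N (snd (snd p)) v}"
    let ?Q' = "{(e, e') \<in> ?P. walsh N (snd e) v \<noteq> walsh N (snd e') v}"
    have "card P2 > 0" using 3 fin12 by (simp add: card_gt_0_iff)
    hence "?Q \<noteq> {}" using v(2) by (metis card.empty mult_0_right not_less)
    then obtain e e' where e: "walsh N (snd e) v \<noteq> walsh N (snd e') v" by auto
    hence "v \<noteq> 0" by (metis walsh_0)
    then obtain h where h: "walsh N h v = -1" using walsh_separates xor_groupD(2)[OF G(1) v(1)] by blast
    have "card ?Q \<le> card ?Q'"
      using finP by (intro card_mono) (auto simp: P2_def intro: finite_subset)
    hence "card ?P \<le> 4 * card ?Q'" using 3(2) v(2) by linarith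
    thus ?thesis using that[OF v(1) h] by blast
  qed
qed

text \<open>Only pairs with equal value of \<open>f\<close> survive an outcome, and the reduction
  creates no new ones: errors that act differently on the hyperplane after it acted differently on
  \<open>G\<close> before. So at least a quarter of the pairs is lost.\<close>

lemma confusable_pairs_step:
  assumes G: "xor_group N G" and S: "finite S"
    and P: "card (confusable_pairs N G S) \<le> 4 * card {(e, e') \<in> confusable_pairs N G S. f e \<noteq> f e'}"
  shows "4 * card (confusable_pairs N (hyperplane N h G) (proj_error N h v ` {e \<in> S. f e = c})) \<le>
    3 * card (confusable_pairs N G S)"
proof -
  let ?P = "confusable_pairs N G S"
  let ?A = "{(e, e') \<in> ?P. f e \<noteq> f e'}"
  let ?B = "{(e, e') \<in> ?P. f e = f e'}"
  have finP: "finite ?P" using S by (rule confusable_pairs_finite)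
  hence fin: "finite ?A" "finite ?B" by (auto intro: finite_subset[of _ ?P])
  have "card (?A \<union> ?B) = card ?A + card ?B" using fin by (rule card_Un_disjoint) auto
  moreover have "?A \<union> ?B = ?P" by auto
  ultimately have "card ?P = card ?A + card ?B" by simp
  moreover have "card (confusable_pairs N (hyperplane N h G) (proj_error N h v ` {e \<in> S. f e = c})) \<le>
    card (map_prod (proj_error N h v) (proj_error N h v) ` ?B)"
  proof (intro card_mono finite_imageI fin(2) subsetI)
    fix p assume "p \<in> confusable_pairs N (hyperplane N h G) (proj_error N h v ` {e \<in> S. f e = c})"
    then obtain z z' where p: "p = (z, z')" and z: "z \<in> proj_error N h v ` {e \<in> S. f e = c}"
        "z' \<in> proj_error N h v ` {e \<in> S. f e = c}"
      and d: "fst z \<noteq> fst z' \<or> (\<exists>x\<in>hyperplane N h G. walsh N (snd z) x \<noteq> walsh N (snd z') x)"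
      unfolding confusable_pairs_def by blast
    from z obtain e e' where e: "e \<in> S" "e' \<in> S" "f e = f e'" and z: "z = proj_error N h v e" "z' = proj_error N h v e'"
      by auto
    have "(e, e') \<in> ?B"
      using e d unfolding z confusable_pairs_def proj_error_def hyperplane_def by (auto split: if_splits)
    thus "p \<in> map_prod (proj_error N h v) (proj_error N h v) ` ?B" unfolding p z by force
  qed
  moreover have "card (map_prod (proj_error N h v) (proj_error N h v) ` ?B) \<le> card ?B"
    using fin(2) by (rule card_image_le)
  ultimately show ?thesis using P by linarith
qed

text \<open>Each of the \<open>d\<close> rounds halves the group, at the cost of one ebit, and
  multiplies the number of confusable pairs by at most 3/4, whatever the outcomes. The last
  hypothesis leaves fewer than one pair at the end.\<close>

theorem correctable_few_errors:
  assumes "xor_group N G" "bij_betw g {..<2 ^ (r + d)} G" "finite S" "fst ` S \<subseteq> G"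
    "card (confusable_pairs N G S) * 3 ^ d < 4 ^ d"
  shows "correctable N r (2 ^ (r + d)) G g S"
  using assms
proof (induction d arbitrary: G g S)
  case 0
  note G = \<open>xor_group N G\<close>
  have "card (confusable_pairs N G S) = 0" using "0.prems"(5) by simp
  hence emp: "confusable_pairs N G S = {}" using confusable_pairs_finite[OF "0.prems"(3)] by simp
  show ?case
  proof (cases "S = {}")
    case True
    thus ?thesis using correctable_base[OF G, of g r S 0] "0.prems" xor_groupD(1)[OF G] by simp
  next
    case False
    then obtain e0 where e0: "e0 \<in> S" by blast
    have *: "fst e = fst e0 \<and> (\<forall>x\<in>G. walsh N (snd e) x = walsh N (snd e0) x)" if "e \<in> S" for e
    proof (rule ccontr)
      assume "\<not> ?thesis"
      hence "(e, e0) \<in> confusable_pairs N G S" using that e0 by (simp add: confusable_pairs_def)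
      thus False using emp by simp
    qed
    show ?thesis
      unfolding add_0_right
    proof (rule correctable_base[OF G])
      show "bij_betw g {..<2 ^ r} G" using "0.prems"(2) by simp
      show "finite S" "fst e0 \<in> G" using "0.prems"(3,4) e0 by auto
    qed (use * in blast)+
  qed
next
  case (Suc d)
  note G = \<open>xor_group N G\<close> and g = \<open>bij_betw g {..<2 ^ (r + Suc d)} G\<close>
    and S = \<open>finite S\<close> \<open>fst ` S \<subseteq> G\<close>
  have cG: "card G = 2 * 2 ^ (r + d)" using bij_betw_same_card[OF g] by simp
  hence "G \<noteq> {0}" by auto
  then obtain v h where v: "v \<in> G" "walsh N h v = -1" and
    choice: "card (confusable_pairs N G S) \<le> 4 * card {(e, e') \<in> confusable_pairs N G S. walsh N h (fst e) \<noteq> walsh N h (fst e')} \<or>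
     card (confusable_pairs N G S) \<le> 4 * card {(e, e') \<in> confusable_pairs N G S. walsh N (snd e) v \<noteq> walsh N (snd e') v}"
    using choose_measurement[OF G _ S] by blast
  let ?K = "hyperplane N h G"
  have K: "xor_group N ?K" using G by (rule hyperplane_group)
  have "card G = 2 * card ?K"
    unfolding hyperplane_def by (rule character_half_card(1)[OF G walsh_xor walsh_cases v])
  hence "card ?K = 2 ^ (r + d)" using cG by simp
  then obtain k :: "nat \<Rightarrow> nat" where k: "bij_betw k {..<2 ^ (r + d)} ?K"
    using ex_bij_betw_nat_finite[OF xor_group_finite[OF K]] by (auto simp: atLeast0LessThan)
  \<comment> \<open>Here \<open>f\<close> is the sign revealed by either kind of measurement, and
    \<open>c\<close> is the product of the two outcomes.\<close>
  have IH: "correctable N r (2 ^ (r + d)) ?K k (proj_error N h v ` {e \<in> S. f e = c})"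
    if f: "card (confusable_pairs N G S) \<le> 4 * card {(e, e') \<in> confusable_pairs N G S. f e \<noteq> f e'}" for f and c :: complex
  proof (rule Suc.IH[OF K k])
    show "finite (proj_error N h v ` {e \<in> S. f e = c})" using S by simp
    show "fst ` proj_error N h v ` {e \<in> S. f e = c} \<subseteq> ?K"
    proof -
      have "fst (proj_error N h v e) \<in> ?K" if "e \<in> S" for e
        using that S(2) v walsh_cases[of N h "fst e"] xor_groupD(3)[OF G _ v(1), of "fst e"]
        by (auto simp: proj_error_def hyperplane_def walsh_xor)
      thus ?thesis by auto
    qed
    have "4 * card (confusable_pairs N ?K (proj_error N h v ` {e \<in> S. f e = c})) * 3 ^ d \<le>
        3 * card (confusable_pairs N G S) * 3 ^ d"
      using confusable_pairs_step[OF G S(1) f] by (rule mult_right_mono) simp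
    also have "\<dots> < 4 * 4 ^ d" using Suc.prems(5) by (simp add: mult_ac)
    finally show "card (confusable_pairs N ?K (proj_error N h v ` {e \<in> S. f e = c})) * 3 ^ d < 4 ^ d" by simp
  qed
  from choice show ?case
  proof
    assume "card (confusable_pairs N G S) \<le> 4 * card {(e, e') \<in> confusable_pairs N G S. walsh N h (fst e) \<noteq> walsh N h (fst e')}"
    from IH[OF this] show ?thesis by (intro correctable_bit_step[OF G v g k S])
  next
    assume "card (confusable_pairs N G S) \<le> 4 * card {(e, e') \<in> confusable_pairs N G S. walsh N (snd e) v \<noteq> walsh N (snd e') v}"
    from IH[OF this] show ?thesis by (intro correctable_phase_step[OF G v g k S])
  qed
qed

section \<open>Independent noise on many blocks\<close>

lemma psd_eq_mat_sum:
  assumes "psd n A"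
  obtains g where "A = mat_sum n n (\<lambda>k. rank_one n (g k))"
proof -
  obtain g where "\<And>i j. i < n \<Longrightarrow> j < n \<Longrightarrow> A $$ (i, j) = (\<Sum>k<n. g k i * cnj (g k j))"
    using psd_decomposition[OF assms] by blast
  hence "A = mat_sum n n (\<lambda>k. rank_one n (g k))"
    using assms by (intro eq_matI) (auto simp: psd_iff mat_sum_def rank_one_def)
  thus ?thesis using that by blast
qed

lemma sum_bip_index:
  "(\<Sum>I<(a * c) * (b * e). F (bleft b c e I) (bright b c e I)) = (\<Sum>P<a * b. \<Sum>Q<c * e. F P Q)"
proof -
  have "(\<Sum>I<(a * c) * (b * e). F (bleft b c e I) (bright b c e I)) =
    (\<Sum>i<a. \<Sum>i'<c. \<Sum>j<b. \<Sum>j'<e. F (i * b + j) (i' * e + j'))"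
    unfolding sum_mult_index
  proof (intro sum.cong refl)
    fix i i' j j' assume *: "i' \<in> {..<c}" "j \<in> {..<b}" "j' \<in> {..<e}"
    hence l: "j * e + j' < b * e" by (simp add: index_less)
    show "F (bleft b c e ((i * c + i') * (b * e) + (j * e + j'))) (bright b c e ((i * c + i') * (b * e) + (j * e + j'))) =
      F (i * b + j) (i' * e + j')"
      unfolding bleft_def bright_def index_div[OF l] index_mod[OF l] using * by simp
  qed
  also have "\<dots> = (\<Sum>i<a. \<Sum>j<b. \<Sum>i'<c. \<Sum>j'<e. F (i * b + j) (i' * e + j'))"
    by (rule sum.cong[OF refl], rule sum.swap)
  also have "\<dots> = (\<Sum>P<a * b. \<Sum>Q<c * e. F P Q)" by (simp only: sum_mult_index)
  finally show ?thesis .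
qed

lemma qform_bip_tensor:
  "qform ((a * c) * (b * e)) (bip_tensor a b c e X Y) (\<lambda>I. f (bleft b c e I) * h (bright b c e I)) =
   qform (a * b) X f * qform (c * e) Y h"
proof -
  let ?N = "(a * c) * (b * e)"
  let ?t = "\<lambda>P Q P' Q'. (cnj (f P) * X $$ (P, P') * f P') * (cnj (h Q) * Y $$ (Q, Q') * h Q')"
  have "qform ?N (bip_tensor a b c e X Y) (\<lambda>I. f (bleft b c e I) * h (bright b c e I)) =
    (\<Sum>I<?N. \<Sum>J<?N. ?t (bleft b c e I) (bright b c e I) (bleft b c e J) (bright b c e J))"
    unfolding qform_def by (intro sum.cong refl) (simp add: bip_tensor_eq)
  also have "\<dots> = (\<Sum>I<?N. \<Sum>P'<a * b. \<Sum>Q'<c * e. ?t (bleft b c e I) (bright b c e I) P' Q')"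
    by (intro sum.cong refl sum_bip_index)
  also have "\<dots> = (\<Sum>P<a * b. \<Sum>Q<c * e. \<Sum>P'<a * b. \<Sum>Q'<c * e. ?t P Q P' Q')"
    by (rule sum_bip_index)
  also have "\<dots> = (\<Sum>P<a * b. \<Sum>P'<a * b. \<Sum>Q<c * e. \<Sum>Q'<c * e. ?t P Q P' Q')"
    by (rule sum.cong[OF refl], rule sum.swap)
  also have "\<dots> = qform (a * b) X f * qform (c * e) Y h"
    by (simp only: qform_def sum_distrib_left[symmetric] sum_distrib_right[symmetric])
  finally show ?thesis .
qed

lemma psd_bip_tensor:
  assumes "psd (a * b) X" "psd (c * e) Y"
  shows "psd ((a * c) * (b * e)) (bip_tensor a b c e X Y)"
proof -
  obtain f where f: "\<And>i j. i < a * b \<Longrightarrow> j < a * b \<Longrightarrow> X $$ (i, j) = (\<Sum>k<a * b. f k i * cnj (f k j))"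
    using psd_decomposition[OF assms(1)] by blast
  obtain h where h: "\<And>i j. i < c * e \<Longrightarrow> j < c * e \<Longrightarrow> Y $$ (i, j) = (\<Sum>k<c * e. h k i * cnj (h k j))"
    using psd_decomposition[OF assms(2)] by blast
  let ?N = "(a * c) * (b * e)"
  let ?r = "\<lambda>k l. rank_one ?N (\<lambda>I. f k (bleft b c e I) * h l (bright b c e I))"
  have "bip_tensor a b c e X Y = mat_sum ?N (a * b) (\<lambda>k. mat_sum ?N (c * e) (\<lambda>l. ?r k l))"
  proof (rule eq_matI, goal_cases)
    case (1 I J)
    hence IJ: "I < ?N" "J < ?N" by (simp_all add: mat_sum_def)
    have "bip_tensor a b c e X Y $$ (I, J) = (\<Sum>k<a * b. f k (bleft b c e I) * cnj (f k (bleft b c e J))) *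
      (\<Sum>k<c * e. h k (bright b c e I) * cnj (h k (bright b c e J)))"
      using IJ bleft_less bright_less f h by (simp add: bip_tensor_eq)
    also have "\<dots> = (\<Sum>k<a * b. \<Sum>l<c * e. ?r k l $$ (I, J))"
      unfolding sum_product using IJ by (intro sum.cong refl) (simp add: rank_one_def mult_ac)
    finally show ?case using IJ by (simp add: mat_sum_def)
  qed (simp_all add: mat_sum_def bip_tensor_eq)
  thus ?thesis by (simp add: mat_sum_psd rank_one_psd)
qed

lemma psd_one: "psd (Suc 0) (1\<^sub>m (Suc 0))"
  by (auto simp: psd_iff qform_def less_eq_complex_def)

lemma mat_trace_bip_tensor:
  assumes "X \<in> carrier_mat (a * b) (a * b)" "Y \<in> carrier_mat (c * e) (c * e)"
  shows "mat_trace (bip_tensor a b c e X Y) = mat_trace X * mat_trace Y"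
proof -
  have "mat_trace (bip_tensor a b c e X Y) = (\<Sum>P<a * b. \<Sum>Q<c * e. X $$ (P, P) * Y $$ (Q, Q))"
    unfolding sum_bip_index[symmetric] by (simp add: mat_trace_carrier[OF bip_tensor_carrier]) (simp add: bip_tensor_eq)
  thus ?thesis using assms by (simp add: mat_trace_carrier sum_product)
qed

lemma bip_power_density:
  assumes "\<rho> \<in> density_ops (a * b)"
  shows "bip_power a b \<rho> n \<in> density_ops (a ^ n * b ^ n)"
proof (induction n)
  case 0
  show ?case using psd_one by (simp add: density_ops_def mat_trace_def)
next
  case (Suc n)
  have "\<rho> \<in> carrier_mat (a * b) (a * b)" using assms by (simp add: density_ops_def psd_iff)
  hence "mat_trace (bip_power a b \<rho> (Suc n)) = 1"
    using Suc assms by (simp add: mat_trace_bip_tensor density_ops_def)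
  moreover have "psd ((a ^ n * a) * (b ^ n * b)) (bip_power a b \<rho> (Suc n))"
    using Suc assms psd_bip_tensor by (simp add: density_ops_def)
  ultimately show ?case by (simp add: density_ops_def mult.commute)
qed

subsection \<open>Error probabilities\<close>

definition errors :: "nat \<Rightarrow> (nat \<times> nat) set" where
  "errors N = {..<2 ^ N} \<times> {..<2 ^ N}"

lemma finite_errors [simp]: "finite (errors N)"
  by (simp add: errors_def)

definition pauli_vec :: "nat \<Rightarrow> nat \<times> nat \<Rightarrow> nat \<Rightarrow> complex" where
  "pauli_vec N e I = pauli N e (I div 2 ^ N) (I mod 2 ^ N)"

text \<open>The weight of \<open>\<omega>\<close> on the normalised error vector,
  \<open>2 ^ N\<close> being the squared norm of \<open>pauli_vec\<close>. The state need not be a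
  mixture of error vectors; these are only its diagonal entries in the Bell basis.\<close>

definition error_prob :: "nat \<Rightarrow> complex mat \<Rightarrow> nat \<times> nat \<Rightarrow> real" where
  "error_prob N \<omega> e = Re (qform (2 ^ N * 2 ^ N) \<omega> (pauli_vec N e)) / 2 ^ N"

lemma error_prob_nonneg: "psd (2 ^ N * 2 ^ N) \<omega> \<Longrightarrow> error_prob N \<omega> e \<ge> 0"
  by (auto simp: error_prob_def psd_iff less_eq_complex_def)

definition pauli_basis :: "nat \<Rightarrow> nat \<Rightarrow> nat \<Rightarrow> complex" where
  "pauli_basis N k I = complex_of_real (1 / sqrt (2 ^ N)) * pauli_vec N (k div 2 ^ N, k mod 2 ^ N) I"

lemma walsh_sum:
  assumes "b < 2 ^ N" "b' < 2 ^ N"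
  shows "(\<Sum>x<2 ^ N. walsh N b x * walsh N b' x) = (if b = b' then 2 ^ N else 0)"
proof (cases "b = b'")
  case False
  let ?f = "walsh N (xor b b')"
  have "xor b b' \<noteq> 0" "xor b b' < 2 ^ N" using False assms by (simp_all add: xor_eq_0_iff xor_less)
  then obtain v where v: "v < 2 ^ N" "?f v = -1" using walsh_separates by (metis walsh_commute)
  have bij: "bij_betw (\<lambda>x. xor x v) {..<2 ^ N} {..<2 ^ N}"
    by (rule bij_betw_byWitness[where f' = "\<lambda>x. xor x v"]) (use v in \<open>auto simp: xor_less\<close>)
  have "(\<Sum>x<2 ^ N. ?f x) = (\<Sum>x<2 ^ N. ?f (xor x v))"
    by (rule sum.reindex_bij_betw[OF bij, symmetric])
  also have "\<dots> = - (\<Sum>x<2 ^ N. ?f x)" using v by (simp add: walsh_xor sum_negf)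
  finally have "(\<Sum>x<2 ^ N. ?f x) = 0" by simp
  thus ?thesis using False by (simp add: walsh_xor_left)
qed simp

text \<open>Different bit flips have disjoint supports, and for equal bit flips the phases are
  orthogonal characters.\<close>

lemma pauli_basis_orthonormal: "orthonormal (2 ^ N * 2 ^ N) (pauli_basis N)"
  unfolding orthonormal_def
proof (intro allI impI)
  fix k l :: nat assume kl: "k < 2 ^ N * 2 ^ N" "l < 2 ^ N * 2 ^ N"
  let ?n = "2 ^ N :: nat"
  let ?a = "k div ?n" and ?b = "k mod ?n" and ?a' = "l div ?n" and ?b' = "l mod ?n"
  note less = div_less_index[OF kl(1)] mod_less_index[OF kl(1)] div_less_index[OF kl(2)] mod_less_index[OF kl(2)]
  define s where "s = complex_of_real (1 / sqrt (2 ^ N))"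
  have ss: "s * s = 1 / 2 ^ N" "cnj s = s" by (simp_all add: s_def flip: of_real_mult)
  have "(\<Sum>I<?n * ?n. cnj (pauli_basis N k I) * pauli_basis N l I) =
    (\<Sum>x<?n. \<Sum>y<?n. if y = xor x ?a then if ?a = ?a' then s * s * (walsh N ?b x * walsh N ?b' x) else 0 else 0)"
    unfolding sum_mult_index
  proof (intro sum.cong refl)
    fix x y :: nat assume "y \<in> {..<?n}"
    hence *: "pauli_basis N j (x * ?n + y) = s * pauli N (j div ?n, j mod ?n) x y" for j
      by (simp add: pauli_basis_def pauli_vec_def s_def)
    have "xor x ?a = xor x ?a' \<longleftrightarrow> ?a = ?a'" by (metis xor_left_cancel)
    thus "cnj (pauli_basis N k (x * ?n + y)) * pauli_basis N l (x * ?n + y) =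
      (if y = xor x ?a then if ?a = ?a' then s * s * (walsh N ?b x * walsh N ?b' x) else 0 else 0)"
      unfolding * by (auto simp: pauli_def ss(2))
  qed
  also have "\<dots> = (\<Sum>x<?n. if ?a = ?a' then s * s * (walsh N ?b x * walsh N ?b' x) else 0)"
    using less by (intro sum.cong refl) (simp add: xor_less)
  also have "\<dots> = (if ?a = ?a' then s * s * (\<Sum>x<?n. walsh N ?b x * walsh N ?b' x) else 0)"
    by (simp add: sum_distrib_left)
  also have "\<dots> = (if ?a = ?a' \<and> ?b = ?b' then 1 else 0)"
    using less by (simp add: walsh_sum ss)
  also have "?a = ?a' \<and> ?b = ?b' \<longleftrightarrow> k = l" by (metis div_mult_mod_eq)
  finally show "(\<Sum>I<?n * ?n. cnj (pauli_basis N k I) * pauli_basis N l I) = (if k = l then 1 else 0)" .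
qed

definition error_index :: "nat \<Rightarrow> nat \<times> nat \<Rightarrow> nat" where
  "error_index N e = fst e * 2 ^ N + snd e"

lemma error_index_bij: "bij_betw (error_index N) (errors N) {..<2 ^ N * 2 ^ N}"
  by (rule bij_betw_byWitness[where f' = "\<lambda>k. (k div 2 ^ N, k mod 2 ^ N)"])
    (auto simp: error_index_def errors_def index_less div_less_index div_mult_mod_eq)

lemma coef_pauli_basis:
  assumes "e \<in> errors N"
  shows "(cmod (coef (2 ^ N * 2 ^ N) (pauli_basis N) f (error_index N e)))\<^sup>2 =
    (cmod (\<Sum>I<2 ^ N * 2 ^ N. cnj (pauli_vec N e I) * f I))\<^sup>2 / 2 ^ N"
proof -
  have "pauli_basis N (error_index N e) I = complex_of_real (1 / sqrt (2 ^ N)) * pauli_vec N e I" for I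
    using assms by (cases e) (simp add: pauli_basis_def error_index_def errors_def)
  hence "coef (2 ^ N * 2 ^ N) (pauli_basis N) f (error_index N e) =
    complex_of_real (1 / sqrt (2 ^ N)) * (\<Sum>I<2 ^ N * 2 ^ N. cnj (pauli_vec N e I) * f I)"
    by (simp add: coef_def sum_distrib_left mult_ac)
  thus ?thesis by (simp add: norm_mult norm_divide power_mult_distrib power_divide)
qed

lemma sum_error_prob:
  assumes "psd (2 ^ N * 2 ^ N) \<omega>"
  shows "(\<Sum>e\<in>errors N. error_prob N \<omega> e) = Re (mat_trace \<omega>)"
proof -
  let ?n = "2 ^ N * 2 ^ N :: nat"
  obtain g where g: "\<And>i j. i < ?n \<Longrightarrow> j < ?n \<Longrightarrow> \<omega> $$ (i, j) = (\<Sum>k<?n. g k i * cnj (g k j))"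
    using psd_decomposition[OF assms] by blast
  have q: "qform ?n \<omega> v = complex_of_real (\<Sum>k<?n. (cmod (\<Sum>i<?n. cnj (v i) * g k i))\<^sup>2)" for v
    by (rule qform_decomposition) (rule g)
  have "(\<Sum>e\<in>errors N. error_prob N \<omega> e) =
    (\<Sum>e\<in>errors N. \<Sum>k<?n. (cmod (coef ?n (pauli_basis N) (g k) (error_index N e)))\<^sup>2)"
    unfolding error_prob_def q
    by (intro sum.cong refl) (simp add: coef_pauli_basis sum_divide_distrib)
  also have "\<dots> = (\<Sum>k<?n. \<Sum>e\<in>errors N. (cmod (coef ?n (pauli_basis N) (g k) (error_index N e)))\<^sup>2)"
    by (rule sum.swap)
  also have "\<dots> = (\<Sum>k<?n. \<Sum>l<?n. (cmod (coef ?n (pauli_basis N) (g k) l))\<^sup>2)"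
    by (rule sum.cong[OF refl], rule sum.reindex_bij_betw[OF error_index_bij])
  also have "\<dots> = (\<Sum>k<?n. \<Sum>i<?n. (cmod (g k i))\<^sup>2)"
    by (rule sum.cong[OF refl], rule parseval_norm[OF pauli_basis_orthonormal])
  also have "\<dots> = (\<Sum>i<?n. \<Sum>k<?n. (cmod (g k i))\<^sup>2)" by (rule sum.swap)
  also have "\<dots> = Re (mat_trace \<omega>)"
  proof -
    have "\<omega> \<in> carrier_mat ?n ?n" using assms by (simp add: psd_iff)
    hence "mat_trace \<omega> = (\<Sum>i<?n. \<Sum>k<?n. g k i * cnj (g k i))"
      using g by (simp add: mat_trace_carrier)
    also have "\<dots> = complex_of_real (\<Sum>i<?n. \<Sum>k<?n. (cmod (g k i))\<^sup>2)"
      unfolding of_real_sum complex_norm_square by (rule refl)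
    finally show ?thesis by simp
  qed
  finally show ?thesis .
qed

text \<open>The coefficients are those of the orthogonal projection onto the span of
  \<open>S\<close>; by Parseval the remainder consists of the components on the other
  errors.\<close>

lemma pauli_projection:
  assumes S: "S \<subseteq> errors N"
  shows "\<exists>c. (\<Sum>x<2 ^ N. \<Sum>y<2 ^ N. (cmod (f (x * 2 ^ N + y) - (\<Sum>e\<in>S. c e * pauli N e x y)))\<^sup>2) =
    (\<Sum>e\<in>errors N - S. (cmod (\<Sum>I<2 ^ N * 2 ^ N. cnj (pauli_vec N e I) * f I))\<^sup>2 / 2 ^ N)"
proof -
  let ?n = "2 ^ N * 2 ^ N :: nat"
  let ?u = "pauli_basis N"
  define s where "s = complex_of_real (1 / sqrt (2 ^ N))"
  define c where "c e = coef ?n ?u f (error_index N e) * s" for e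
  define R where "R I = (\<Sum>k<?n. (if k \<in> error_index N ` S then 0 else coef ?n ?u f k) * ?u k I)" for I
  have inj: "inj_on (error_index N) (errors N)" using error_index_bij by (rule bij_betw_imp_inj_on)
  have img: "error_index N ` S \<subseteq> {..<?n}" using error_index_bij S by (auto simp: bij_betw_def)
  have u: "?u (error_index N e) I = s * pauli_vec N e I" if "e \<in> S" for e I
    using that S by (cases e) (auto simp: pauli_basis_def error_index_def errors_def s_def)
  have R: "f I - (\<Sum>e\<in>S. c e * pauli_vec N e I) = R I" if "I < ?n" for I
  proof -
    have "(\<Sum>e\<in>S. c e * pauli_vec N e I) = (\<Sum>e\<in>S. coef ?n ?u f (error_index N e) * ?u (error_index N e) I)"
      by (intro sum.cong refl) (simp add: c_def u mult_ac)
    also have "\<dots> = (\<Sum>k\<in>error_index N ` S. coef ?n ?u f k * ?u k I)"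
      using inj_on_subset[OF inj S] by (simp add: sum.reindex)
    also have "\<dots> = (\<Sum>k<?n. if k \<in> error_index N ` S then coef ?n ?u f k * ?u k I else 0)"
      using img by (simp add: sum.inter_restrict[symmetric] Int_absorb1)
    finally have "f I - (\<Sum>e\<in>S. c e * pauli_vec N e I) = (\<Sum>k<?n. coef ?n ?u f k * ?u k I) -
      (\<Sum>k<?n. if k \<in> error_index N ` S then coef ?n ?u f k * ?u k I else 0)"
      using orthonormal_expand[OF pauli_basis_orthonormal that, of f] by simp
    also have "\<dots> = R I"
      unfolding R_def sum_subtractf[symmetric] by (intro sum.cong refl) auto
    finally show ?thesis .
  qed
  have coefR: "coef ?n ?u R k = (if k \<in> error_index N ` S then 0 else coef ?n ?u f k)" if "k < ?n" for k
  proof -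
    let ?g = "\<lambda>l. if l \<in> error_index N ` S then 0 else coef ?n ?u f l"
    have "coef ?n ?u R k = (\<Sum>I<?n. \<Sum>l<?n. ?g l * (cnj (?u k I) * ?u l I))"
      by (simp add: coef_def[of ?n ?u R] R_def sum_distrib_left mult_ac)
    also have "\<dots> = (\<Sum>l<?n. ?g l * (\<Sum>I<?n. cnj (?u k I) * ?u l I))"
      by (subst sum.swap) (simp add: sum_distrib_left)
    also have "\<dots> = (\<Sum>l<?n. if l = k then ?g l else 0)"
      using pauli_basis_orthonormal[of N] that unfolding orthonormal_def by (intro sum.cong refl) auto
    also have "\<dots> = ?g k" using that by simp
    finally show ?thesis .
  qed
  have "(\<Sum>x<2 ^ N. \<Sum>y<2 ^ N. (cmod (f (x * 2 ^ N + y) - (\<Sum>e\<in>S. c e * pauli N e x y)))\<^sup>2) =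
    (\<Sum>x<2 ^ N. \<Sum>y<2 ^ N. (cmod (R (x * 2 ^ N + y)))\<^sup>2)"
  proof (intro sum.cong refl)
    fix x y :: nat assume "x \<in> {..<2 ^ N}" "y \<in> {..<2 ^ N}"
    hence xy: "x * 2 ^ N + y < ?n" "y < 2 ^ N" by (simp_all add: index_less)
    show "(cmod (f (x * 2 ^ N + y) - (\<Sum>e\<in>S. c e * pauli N e x y)))\<^sup>2 = (cmod (R (x * 2 ^ N + y)))\<^sup>2"
      using R[OF xy(1)] xy(2) by (simp add: pauli_vec_def)
  qed
  also have "\<dots> = (\<Sum>I<?n. (cmod (R I))\<^sup>2)" by (simp only: sum_mult_index)
  also have "\<dots> = (\<Sum>k<?n. (cmod (coef ?n ?u R k))\<^sup>2)"
    by (rule parseval_norm[OF pauli_basis_orthonormal, symmetric])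
  also have "\<dots> = (\<Sum>e\<in>errors N. (cmod (coef ?n ?u R (error_index N e)))\<^sup>2)"
    by (rule sum.reindex_bij_betw[OF error_index_bij, symmetric])
  also have "\<dots> = (\<Sum>e\<in>errors N - S. (cmod (coef ?n ?u f (error_index N e)))\<^sup>2)"
  proof (rule sum.mono_neutral_cong_right)
    have l: "error_index N e < ?n" if "e \<in> errors N" for e
      using error_index_bij that by (auto simp: bij_betw_def)
    have "error_index N e \<in> error_index N ` S \<longleftrightarrow> e \<in> S" if "e \<in> errors N" for e
      using inj S that by (auto simp: inj_on_def)
    thus "\<forall>e\<in>errors N - (errors N - S). (cmod (coef ?n ?u R (error_index N e)))\<^sup>2 = 0"
      "\<And>e. e \<in> errors N - S \<Longrightarrow> (cmod (coef ?n ?u R (error_index N e)))\<^sup>2 = (cmod (coef ?n ?u f (error_index N e)))\<^sup>2"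
      using l by (auto simp: coefR)
  qed auto
  also have "\<dots> = (\<Sum>e\<in>errors N - S. (cmod (\<Sum>I<2 ^ N * 2 ^ N. cnj (pauli_vec N e I) * f I))\<^sup>2 / 2 ^ N)"
    by (intro sum.cong refl) (simp add: coef_pauli_basis)
  finally show ?thesis by blast
qed

text \<open>The deficit is linear, so the state may be decomposed into vectors, each compared with
  its own projection onto the span of \<open>S\<close>. Coherence between errors is harmless, since
  the whole span is corrected; only the diagonal weights outside \<open>S\<close> remain.\<close>

lemma deficit_le_error_prob:
  assumes "correctable N r (2 ^ N) {..<2 ^ N} (\<lambda>x. x) S" and S: "S \<subseteq> errors N"
  shows "\<exists>\<Lambda>. locc (2 ^ N) (2 ^ N) (2 ^ r) (2 ^ r) \<Lambda> \<and>
    (\<forall>\<omega>. psd (2 ^ N * 2 ^ N) \<omega> \<longrightarrow> deficit r (\<Lambda> \<omega>) \<le> (\<Sum>e\<in>errors N - S. error_prob N \<omega> e))"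
proof -
  let ?n = "2 ^ N * 2 ^ N :: nat"
  obtain \<Lambda> where \<Lambda>: "locc (2 ^ N) (2 ^ N) (2 ^ r) (2 ^ r) \<Lambda>"
    "\<And>\<Psi> c. deficit r (\<Lambda> (rank_one ?n (\<lambda>I. \<Psi> (I div 2 ^ N) (I mod 2 ^ N)))) \<le>
      (\<Sum>x<2 ^ N. \<Sum>y<2 ^ N. (cmod (\<Psi> x y - (\<Sum>e\<in>S. c e * pauli N e x y)))\<^sup>2)"
    using assms(1) unfolding correctable_def by blast
  have "deficit r (\<Lambda> \<omega>) \<le> (\<Sum>e\<in>errors N - S. error_prob N \<omega> e)" if psd: "psd ?n \<omega>" for \<omega>
  proof -
    obtain g where g: "\<omega> = mat_sum ?n ?n (\<lambda>k. rank_one ?n (g k))" using psd_eq_mat_sum[OF psd] by blast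
    have pure: "deficit r (\<Lambda> (rank_one ?n f)) \<le>
      (\<Sum>e\<in>errors N - S. (cmod (\<Sum>I<?n. cnj (pauli_vec N e I) * f I))\<^sup>2 / 2 ^ N)" for f
    proof -
      obtain c where c: "(\<Sum>x<2 ^ N. \<Sum>y<2 ^ N. (cmod (f (x * 2 ^ N + y) - (\<Sum>e\<in>S. c e * pauli N e x y)))\<^sup>2) =
        (\<Sum>e\<in>errors N - S. (cmod (\<Sum>I<?n. cnj (pauli_vec N e I) * f I))\<^sup>2 / 2 ^ N)"
        using pauli_projection[OF S] by blast
      show ?thesis
        using \<Lambda>(2)[where \<Psi> = "\<lambda>x y. f (x * 2 ^ N + y)" and c = c] unfolding c by (simp only: div_mult_mod_eq)
    qed
    have "\<Lambda> \<omega> = mat_sum (2 ^ r * 2 ^ r) ?n (\<lambda>k. \<Lambda> (rank_one ?n (g k)))"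
      unfolding g by (rule linear_map_mat_sum[OF locc_linear[OF \<Lambda>(1)]]) simp
    hence "deficit r (\<Lambda> \<omega>) = (\<Sum>k<?n. deficit r (\<Lambda> (rank_one ?n (g k))))"
      using linear_map_carrier[OF locc_linear[OF \<Lambda>(1)]] by (simp add: deficit_mat_sum)
    also have "\<dots> \<le> (\<Sum>k<?n. \<Sum>e\<in>errors N - S. (cmod (\<Sum>I<?n. cnj (pauli_vec N e I) * g k I))\<^sup>2 / 2 ^ N)"
      by (intro sum_mono pure)
    also have "\<dots> = (\<Sum>e\<in>errors N - S. \<Sum>k<?n. (cmod (\<Sum>I<?n. cnj (pauli_vec N e I) * g k I))\<^sup>2 / 2 ^ N)"
      by (rule sum.swap)
    also have "\<dots> = (\<Sum>e\<in>errors N - S. error_prob N \<omega> e)"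
      unfolding error_prob_def g by (simp add: qform_mat_sum qform_rank_one sum_divide_distrib)
    finally show ?thesis .
  qed
  with \<Lambda>(1) show ?thesis by blast
qed

section \<open>Errors on a sequence of blocks\<close>

definition hi :: "nat \<Rightarrow> nat \<times> nat \<Rightarrow> nat \<times> nat" where
  "hi K e = (fst e div 2 ^ K, snd e div 2 ^ K)"

definition lo :: "nat \<Rightarrow> nat \<times> nat \<Rightarrow> nat \<times> nat" where
  "lo K e = (fst e mod 2 ^ K, snd e mod 2 ^ K)"

text \<open>The last block occupies the \<open>K\<close> low bits of both masks, because
  \<open>bip_tensor\<close> makes the second factor the low digit of each party's index.\<close>

lemma hi_lo_bij: "bij_betw (\<lambda>e. (hi K e, lo K e)) (errors (N + K)) (errors N \<times> errors K)"
proof (rule bij_betw_byWitness[where f' = "\<lambda>(e, e'). (fst e * 2 ^ K + fst e', snd e * 2 ^ K + snd e')"])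
  show "(\<lambda>e. (hi K e, lo K e)) ` errors (N + K) \<subseteq> errors N \<times> errors K"
    by (auto simp: errors_def hi_def lo_def power_add div_less_index)
  show "(\<lambda>(e, e'). (fst e * 2 ^ K + fst e', snd e * 2 ^ K + snd e')) ` (errors N \<times> errors K) \<subseteq> errors (N + K)"
    by (auto simp: errors_def power_add index_less)
qed (auto simp: hi_def lo_def errors_def div_mult_mod_eq)

primrec block_prod :: "nat \<Rightarrow> (nat \<times> nat \<Rightarrow> real) \<Rightarrow> nat \<Rightarrow> nat \<times> nat \<Rightarrow> real" where
  "block_prod K f 0 e = 1"
| "block_prod K f (Suc m) e = block_prod K f m (hi K e) * f (lo K e)"

lemma sum_block_prod: "(\<Sum>e\<in>errors (K * m). block_prod K f m e) = (\<Sum>e\<in>errors K. f e) ^ m"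
proof (induction m)
  case 0
  show ?case by (simp add: errors_def)
next
  case (Suc m)
  have "(\<Sum>e\<in>errors (K * Suc m). block_prod K f (Suc m) e) =
    (\<Sum>e\<in>errors (K * m + K). (\<lambda>(e, e'). block_prod K f m e * f e') (hi K e, lo K e))"
    by (simp add: add.commute)
  also have "\<dots> = (\<Sum>(e, e')\<in>errors (K * m) \<times> errors K. block_prod K f m e * f e')"
    by (rule sum.reindex_bij_betw[OF hi_lo_bij])
  also have "\<dots> = (\<Sum>e\<in>errors K. f e) ^ Suc m"
    unfolding sum.cartesian_product[symmetric] sum_product[symmetric] Suc by (simp add: mult.commute)
  finally show ?case .
qed

lemma block_prod_mult: "block_prod K f m e * block_prod K h m e = block_prod K (\<lambda>e. f e * h e) m e"
proof (induction m arbitrary: e)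
  case (Suc m)
  show ?case unfolding block_prod.simps Suc[symmetric] by (simp only: mult_ac)
qed simp

primrec block_weight :: "nat \<Rightarrow> nat \<Rightarrow> nat \<times> nat \<Rightarrow> nat" where
  "block_weight K 0 e = 0"
| "block_weight K (Suc m) e = block_weight K m (hi K e) + (if lo K e = (0, 0) then 0 else 1)"

text \<open>An exponential of the number of faulty blocks is a product over the blocks, so that its
  sums factor by \<open>sum_block_prod\<close>. Both the counting bound and the tail bound use
  this.\<close>

lemma block_prod_weight: "block_prod K (\<lambda>e. if e = (0, 0) then 1 else z) m e = z ^ block_weight K m e"
  by (induction m arbitrary: e) simp_all

lemma pauli_blocks:
  "pauli (N + K) e x y = pauli N (hi K e) (x div 2 ^ K) (y div 2 ^ K) * pauli K (lo K e) (x mod 2 ^ K) (y mod 2 ^ K)"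
proof -
  obtain a b where e: "e = (a, b)" by (cases e)
  have "(\<Prod>i<K + N. if bit b i \<and> bit x i then -1 else 1 :: complex) =
    (\<Prod>i<K. if bit b i \<and> bit x i then -1 else 1) * (\<Prod>i<N. if bit b (K + i) \<and> bit x (K + i) then -1 else 1)"
    by (induction N) (simp_all add: mult.assoc)
  moreover have "(\<Prod>i<K. if bit b i \<and> bit x i then -1 else 1 :: complex) = walsh K (b mod 2 ^ K) (x mod 2 ^ K)"
    unfolding walsh_def by (intro prod.cong refl) (simp add: bit_take_bit_iff flip: take_bit_eq_mod)
  moreover have "(\<Prod>i<N. if bit b (K + i) \<and> bit x (K + i) then -1 else 1 :: complex) = walsh N (b div 2 ^ K) (x div 2 ^ K)"
    unfolding walsh_def by (intro prod.cong refl) (simp add: bit_drop_bit_eq flip: drop_bit_eq_div)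
  ultimately have "(\<Prod>i<K + N. if bit b i \<and> bit x i then -1 else 1) =
      walsh K (b mod 2 ^ K) (x mod 2 ^ K) * walsh N (b div 2 ^ K) (x div 2 ^ K)"
    by (simp only:)
  moreover have "walsh (N + K) b x = (\<Prod>i<K + N. if bit b i \<and> bit x i then -1 else 1)"
    unfolding walsh_def by (subst add.commute) (rule refl)
  ultimately have w: "walsh (N + K) b x = walsh N (b div 2 ^ K) (x div 2 ^ K) * walsh K (b mod 2 ^ K) (x mod 2 ^ K)"
    by (metis mult.commute)
  have "xor x a div 2 ^ K = xor (x div 2 ^ K) (a div 2 ^ K)" "xor x a mod 2 ^ K = xor (x mod 2 ^ K) (a mod 2 ^ K)"
    by (simp_all flip: drop_bit_eq_div take_bit_eq_mod)
  hence "y = xor x a \<longleftrightarrow> y div 2 ^ K = xor (x div 2 ^ K) (a div 2 ^ K) \<and> y mod 2 ^ K = xor (x mod 2 ^ K) (a mod 2 ^ K)"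
    by (metis div_mult_mod_eq)
  thus ?thesis by (simp add: pauli_def e hi_def lo_def w)
qed

lemma error_prob_tensor:
  assumes "psd (2 ^ N * 2 ^ N) X" "psd (2 ^ K * 2 ^ K) Y"
  shows "error_prob (N + K) (bip_tensor (2 ^ N) (2 ^ N) (2 ^ K) (2 ^ K) X Y) e =
    error_prob N X (hi K e) * error_prob K Y (lo K e)"
proof -
  let ?n = "2 ^ N :: nat" and ?k = "2 ^ K :: nat"
  let ?l = "bleft ?n ?k ?k" and ?r = "bright ?n ?k ?k"
  have vec: "pauli_vec (N + K) e I = pauli_vec N (hi K e) (?l I) * pauli_vec K (lo K e) (?r I)"
    if I: "I < (?n * ?k) * (?n * ?k)" for I
  proof -
    note d = div_less_index[OF I] and m = mod_less_index[OF I]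
    show ?thesis
      using div_less_index[OF d] div_less_index[OF m] mod_less_index[OF d] mod_less_index[OF m]
      by (simp add: pauli_vec_def pauli_blocks power_add bleft_def bright_def)
  qed
  have "qform ((?n * ?k) * (?n * ?k)) (bip_tensor ?n ?n ?k ?k X Y) (pauli_vec (N + K) e) =
    qform ((?n * ?k) * (?n * ?k)) (bip_tensor ?n ?n ?k ?k X Y) (\<lambda>I. pauli_vec N (hi K e) (?l I) * pauli_vec K (lo K e) (?r I))"
    unfolding qform_def by (intro sum.cong refl) (simp add: vec)
  also have "\<dots> = qform (?n * ?n) X (pauli_vec N (hi K e)) * qform (?k * ?k) Y (pauli_vec K (lo K e))"
    by (rule qform_bip_tensor)
  finally have q: "qform (2 ^ (N + K) * 2 ^ (N + K)) (bip_tensor ?n ?n ?k ?k X Y) (pauli_vec (N + K) e) =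
    qform (?n * ?n) X (pauli_vec N (hi K e)) * qform (?k * ?k) Y (pauli_vec K (lo K e))"
    by (simp add: power_add)
  \<comment> \<open>With one factor real, the real part of the product is the product of the real
    parts.\<close>
  have "Im (qform (?n * ?n) X (pauli_vec N (hi K e))) = 0"
    using assms(1) by (simp add: psd_iff less_eq_complex_def)
  thus ?thesis unfolding error_prob_def q by (simp add: power_add)
qed

lemma error_prob_power:
  assumes "\<tau> \<in> density_ops (2 ^ K * 2 ^ K)"
  shows "e \<in> errors (K * m) \<Longrightarrow> error_prob (K * m) (bip_power (2 ^ K) (2 ^ K) \<tau> m) e = block_prod K (error_prob K \<tau>) m e"
proof (induction m arbitrary: e)
  case 0
  hence e: "e = (0, 0)" by (simp add: errors_def lessThan_Suc)
  have "pauli_vec 0 (0, 0) 0 = 1" by (simp add: pauli_vec_def pauli_def)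
  thus ?case unfolding e by (simp add: error_prob_def qform_def lessThan_Suc)
next
  case (Suc m)
  have psd: "psd (2 ^ (K * m) * 2 ^ (K * m)) (bip_power (2 ^ K) (2 ^ K) \<tau> m)" "psd (2 ^ K * 2 ^ K) \<tau>"
    using bip_power_density[OF assms, of m] assms by (simp_all add: density_ops_def power_mult)
  have "e \<in> errors (K * m + K)" using Suc.prems by (simp add: add.commute)
  hence "hi K e \<in> errors (K * m)" using hi_lo_bij by (auto simp: bij_betw_def)
  have "error_prob (K * Suc m) (bip_power (2 ^ K) (2 ^ K) \<tau> (Suc m)) e =
    error_prob (K * m + K) (bip_tensor (2 ^ (K * m)) (2 ^ (K * m)) (2 ^ K) (2 ^ K) (bip_power (2 ^ K) (2 ^ K) \<tau> m) \<tau>) e"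
    by (simp add: add.commute power_mult)
  also have "\<dots> = error_prob (K * m) (bip_power (2 ^ K) (2 ^ K) \<tau> m) (hi K e) * error_prob K \<tau> (lo K e)"
    by (rule error_prob_tensor[OF psd])
  finally show ?case using Suc.IH[OF \<open>hi K e \<in> errors (K * m)\<close>] by simp
qed

definition light_errors :: "nat \<Rightarrow> nat \<Rightarrow> nat \<Rightarrow> (nat \<times> nat) set" where
  "light_errors K m w = {e \<in> errors (K * m). block_weight K m e \<le> w}"

text \<open>Weighting the errors of weight \<open>k\<close> with \<open>4 ^ (- K * k)\<close> gives a total weight of at most \<open>2 ^ m\<close>.\<close>

lemma card_light_errors: "card (light_errors K m w) \<le> 2 ^ m * 4 ^ (K * w)"
proof -
  \<comment> \<open>The reciprocal of the number of errors on one block: all nonzero errors of a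
    block together weigh at most 1, as does the zero error.\<close>
  define z :: real where "z = 1 / 4 ^ K"
  have z: "0 < z" "z \<le> 1" by (simp_all add: z_def)
  have zero: "(0, 0) \<in> errors K" by (simp add: errors_def)
  have "(\<Sum>e\<in>errors K. if e = (0, 0) then 1 else z) = 1 + (\<Sum>e\<in>errors K - {(0, 0)}. if e = (0, 0) then 1 else z)"
    by (subst sum.remove[OF finite_errors zero]) simp
  also have "(\<Sum>e\<in>errors K - {(0, 0)}. if e = (0, 0) then 1 else z) = (\<Sum>e\<in>errors K - {(0, 0)}. z)"
    by (intro sum.cong refl) auto
  also have "\<dots> \<le> (\<Sum>e\<in>errors K. z)" using z by (intro sum_mono2) auto
  also have "(\<Sum>e\<in>errors K. z) = 1"
    by (simp add: errors_def z_def flip: power_mult_distrib)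
  finally have two: "(\<Sum>e\<in>errors K. if e = (0, 0) then 1 else z) \<le> 2" by simp
  have "real (card (light_errors K m w)) * z ^ w = (\<Sum>e\<in>light_errors K m w. z ^ w)" by simp
  also have "\<dots> \<le> (\<Sum>e\<in>light_errors K m w. z ^ block_weight K m e)"
    using z by (intro sum_mono power_decreasing) (auto simp: light_errors_def)
  also have "\<dots> \<le> (\<Sum>e\<in>errors (K * m). z ^ block_weight K m e)"
    using z by (intro sum_mono2) (auto simp: light_errors_def)
  also have "\<dots> = (\<Sum>e\<in>errors K. if e = (0, 0) then 1 else z) ^ m"
    by (simp only: block_prod_weight[symmetric] sum_block_prod)
  also have "\<dots> \<le> 2 ^ m" using two z by (intro power_mono sum_nonneg) auto
  also have "z ^ w = 1 / 4 ^ (K * w)" by (simp add: z_def power_divide power_mult)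
  finally have "real (card (light_errors K m w)) \<le> 2 ^ m * 4 ^ (K * w)"
    by (simp add: divide_le_eq)
  hence "real (card (light_errors K m w)) \<le> real (2 ^ m * 4 ^ (K * w))" by simp
  thus ?thesis by (simp only: of_nat_le_iff)
qed

text \<open>Chernoff bound with weight \<open>4 ^ g\<close> per faulty block. A block is faulty with
  probability at most \<open>1 / 4 ^ g\<close>, so the expected weight per block is at most 2,
  whereas an error on more than \<open>m / g\<close> blocks has weight at least
  \<open>4 ^ m\<close>.\<close>

lemma heavy_errors_prob:
  assumes \<tau>: "\<tau> \<in> density_ops (2 ^ K * 2 ^ K)" and g: "g > 0"
    and p: "error_prob K \<tau> (0, 0) \<ge> 1 - 1 / 4 ^ g"
  shows "(\<Sum>e\<in>errors (K * m) - light_errors K m (m div g).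
    error_prob (K * m) (bip_power (2 ^ K) (2 ^ K) \<tau> m) e) \<le> (1 / 2) ^ m"
proof -
  define z :: real where "z = 4 ^ g"
  have z: "z \<ge> 1" by (simp add: z_def)
  have psd: "psd (2 ^ K * 2 ^ K) \<tau>" and tr: "mat_trace \<tau> = 1" using \<tau> by (simp_all add: density_ops_def)
  have psdm: "psd (2 ^ (K * m) * 2 ^ (K * m)) (bip_power (2 ^ K) (2 ^ K) \<tau> m)"
    using bip_power_density[OF \<tau>, of m] by (simp add: density_ops_def power_mult)
  let ?P = "error_prob (K * m) (bip_power (2 ^ K) (2 ^ K) \<tau> m)"
  let ?H = "errors (K * m) - light_errors K m (m div g)"
  have zero: "(0, 0) \<in> errors K" by (simp add: errors_def)
  have heavy: "4 ^ m \<le> z ^ block_weight K m e" if "e \<in> ?H" for e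
  proof -
    have "m div g < block_weight K m e" using that by (auto simp: light_errors_def)
    hence "m < block_weight K m e * g" using g by (simp add: div_less_iff_less_mult)
    hence "(4::real) ^ m \<le> 4 ^ (g * block_weight K m e)" by (intro power_increasing) (simp_all add: mult.commute)
    thus ?thesis by (simp add: z_def power_mult)
  qed
  have "4 ^ m * (\<Sum>e\<in>?H. ?P e) \<le> (\<Sum>e\<in>?H. z ^ block_weight K m e * ?P e)"
    unfolding sum_distrib_left using heavy error_prob_nonneg[OF psdm] by (intro sum_mono mult_right_mono) auto
  also have "\<dots> \<le> (\<Sum>e\<in>errors (K * m). z ^ block_weight K m e * ?P e)"
    using error_prob_nonneg[OF psdm] z by (intro sum_mono2) auto
  also have "\<dots> = (\<Sum>e\<in>errors (K * m). block_prod K (\<lambda>e. (if e = (0, 0) then 1 else z) * error_prob K \<tau> e) m e)"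
    by (intro sum.cong refl) (simp add: error_prob_power[OF \<tau>] block_prod_mult flip: block_prod_weight)
  also have "\<dots> = (\<Sum>e\<in>errors K. (if e = (0, 0) then 1 else z) * error_prob K \<tau> e) ^ m"
    by (rule sum_block_prod)
  also have "\<dots> \<le> 2 ^ m"
  proof (rule power_mono)
    let ?q = "\<Sum>e\<in>errors K - {(0, 0)}. error_prob K \<tau> e"
    have "error_prob K \<tau> (0, 0) + ?q = 1"
      using sum_error_prob[OF psd] tr sum.remove[OF finite_errors zero, of "error_prob K \<tau>"] by simp
    moreover have "(\<Sum>e\<in>errors K. (if e = (0, 0) then 1 else z) * error_prob K \<tau> e) = error_prob K \<tau> (0, 0) + z * ?q"
      by (subst sum.remove[OF finite_errors zero]) (simp add: sum_distrib_left)
    moreover have "?q \<le> 1 / z" using calculation(1) p by (simp add: z_def)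
    hence "z * ?q \<le> 1" using z by (simp add: field_simps)
    moreover have "?q \<ge> 0" using error_prob_nonneg[OF psd] by (intro sum_nonneg) auto
    ultimately show "(\<Sum>e\<in>errors K. (if e = (0, 0) then 1 else z) * error_prob K \<tau> e) \<le> 2" by linarith
    show "0 \<le> (\<Sum>e\<in>errors K. (if e = (0, 0) then 1 else z) * error_prob K \<tau> e)"
      using error_prob_nonneg[OF psd] z by (intro sum_nonneg) auto
  qed
  finally have "4 ^ m * (\<Sum>e\<in>?H. ?P e) \<le> 2 ^ m" .
  hence "(\<Sum>e\<in>?H. ?P e) \<le> 2 ^ m / 4 ^ m" by (simp add: field_simps)
  also have "\<dots> = (1 / 2 :: real) ^ m" by (simp flip: power_divide)
  finally show ?thesis .
qed

text \<open>The number of pairs is at most the square of the number of light errors, which explains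
  \<open>4 ^ m * 16 ^ (K * (m div g))\<close>. The protocol is chosen before \<open>\<tau>\<close>,
  so the bound is uniform over all sufficiently good blocks.\<close>

theorem block_distillation:
  assumes g: "g > 0" and r: "r + d = K * m" and small: "4 ^ m * 16 ^ (K * (m div g)) * 3 ^ d < (4 ^ d :: nat)"
  shows "\<exists>\<Lambda>. locc (2 ^ (K * m)) (2 ^ (K * m)) (2 ^ r) (2 ^ r) \<Lambda> \<and>
    (\<forall>\<tau>\<in>density_ops (2 ^ K * 2 ^ K). error_prob K \<tau> (0, 0) \<ge> 1 - 1 / 4 ^ g \<longrightarrow>
      deficit r (\<Lambda> (bip_power (2 ^ K) (2 ^ K) \<tau> m)) \<le> (1 / 2) ^ m)"
proof -
  let ?S = "light_errors K m (m div g)"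
  let ?G = "{..<2 ^ (K * m)} :: nat set"
  have S: "?S \<subseteq> errors (K * m)" by (auto simp: light_errors_def)
  hence finS: "finite ?S" using finite_errors finite_subset by blast
  have "card (confusable_pairs (K * m) ?G ?S) \<le> card (?S \<times> ?S)"
    using finS by (intro card_mono) (auto simp: confusable_pairs_def)
  also have "\<dots> \<le> (2 ^ m * 4 ^ (K * (m div g))) * (2 ^ m * 4 ^ (K * (m div g)))"
    unfolding card_cartesian_product by (intro mult_mono card_light_errors) auto
  also have "\<dots> = 4 ^ m * 16 ^ (K * (m div g))"
  proof -
    have "(4::nat) ^ m = 2 ^ m * 2 ^ m" "(16::nat) ^ x = 4 ^ x * 4 ^ x" for x
      by (simp_all flip: power_mult_distrib)
    thus ?thesis by (simp add: mult_ac)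
  qed
  finally have "card (confusable_pairs (K * m) ?G ?S) * 3 ^ d \<le> 4 ^ m * 16 ^ (K * (m div g)) * 3 ^ d"
    by (rule mult_right_mono) simp
  hence "card (confusable_pairs (K * m) ?G ?S) * 3 ^ d < 4 ^ d" using small by linarith
  hence "correctable (K * m) r (2 ^ (r + d)) ?G (\<lambda>x. x) ?S"
    using finS S r by (intro correctable_few_errors xor_group_full) (auto simp: errors_def bij_betw_def)
  hence "correctable (K * m) r (2 ^ (K * m)) ?G (\<lambda>x. x) ?S" using r by simp
  then obtain \<Lambda> where \<Lambda>: "locc (2 ^ (K * m)) (2 ^ (K * m)) (2 ^ r) (2 ^ r) \<Lambda>"
    "\<And>\<omega>. psd (2 ^ (K * m) * 2 ^ (K * m)) \<omega> \<Longrightarrow>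
      deficit r (\<Lambda> \<omega>) \<le> (\<Sum>e\<in>errors (K * m) - ?S. error_prob (K * m) \<omega> e)"
    using deficit_le_error_prob[OF _ S] by blast
  have "deficit r (\<Lambda> (bip_power (2 ^ K) (2 ^ K) \<tau> m)) \<le> (1 / 2) ^ m"
    if \<tau>: "\<tau> \<in> density_ops (2 ^ K * 2 ^ K)" "error_prob K \<tau> (0, 0) \<ge> 1 - 1 / 4 ^ g" for \<tau>
  proof -
    have "psd (2 ^ (K * m) * 2 ^ (K * m)) (bip_power (2 ^ K) (2 ^ K) \<tau> m)"
      using bip_power_density[OF \<tau>(1), of m] by (simp add: density_ops_def power_mult)
    from \<Lambda>(2)[OF this] show ?thesis using heavy_errors_prob[OF \<tau>(1) g \<tau>(2), of m] by linarith
  qed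
  with \<Lambda>(1) show ?thesis by blast
qed

section \<open>Uniform distillation\<close>

lemma bip_tensor_rank_one:
  "bip_tensor a b c e (rank_one (a * b) f) (rank_one (c * e) h) =
   rank_one ((a * c) * (b * e)) (\<lambda>I. f (bleft b c e I) * h (bright b c e I))"
  by (intro eq_matI) (simp_all add: bip_tensor_eq rank_one_def bleft_less bright_less)

text \<open>After regrouping, the combined labels of Alice and Bob agree exactly if all their digits
  agree, so the product of ebits is one maximally entangled vector.\<close>

lemma ebit_power: "bip_power 2 2 ebit n = rank_one (2 ^ n * 2 ^ n) (ebits_vec n)"
proof (induction n)
  case 0
  show ?case by (intro eq_matI) (auto simp: rank_one_def ebits_vec_def)
next
  case (Suc n)
  have "ebit_vec $ i = ebits_vec 1 i" if "i < 4" for i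
  proof -
    have "i = 0 \<or> i = 1 \<or> i = 2 \<or> i = 3" using that by auto
    thus ?thesis by (auto simp: ebit_vec_def ebits_vec_def)
  qed
  hence ebit: "ebit = rank_one (2 * 2) (ebits_vec 1)"
    by (intro eq_matI) (auto simp: ebit_def rank_one_def)
  have "ebits_vec n (bleft (2 ^ n) 2 2 I) * ebits_vec 1 (bright (2 ^ n) 2 2 I) = ebits_vec (Suc n) I"
    if I: "I < (2 ^ n * 2) * (2 ^ n * 2)" for I
  proof -
    define x where "x = I div (2 ^ n * 2)"
    define y where "y = I mod (2 ^ n * 2)"
    have "y div 2 < 2 ^ n" using mod_less_index[OF I] by (simp add: y_def div_less_index)
    hence "bleft (2 ^ n) 2 2 I div 2 ^ n = x div 2" "bleft (2 ^ n) 2 2 I mod 2 ^ n = y div 2"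
      "bright (2 ^ n) 2 2 I div 2 = x mod 2" "bright (2 ^ n) 2 2 I mod 2 = y mod 2"
      by (simp_all add: bleft_def bright_def x_def y_def)
    moreover have "x = y \<longleftrightarrow> x div 2 = y div 2 \<and> x mod 2 = y mod 2" by (metis div_mult_mod_eq)
    moreover have "I div 2 ^ Suc n = x" "I mod 2 ^ Suc n = y" by (simp_all add: x_def y_def mult.commute)
    ultimately have vec: "ebits_vec n (bleft (2 ^ n) 2 2 I) = (if x div 2 = y div 2 then complex_of_real (1 / sqrt (2 ^ n)) else 0)"
      "ebits_vec 1 (bright (2 ^ n) 2 2 I) = (if x mod 2 = y mod 2 then complex_of_real (1 / sqrt 2) else 0)"
      "ebits_vec (Suc n) I = (if x div 2 = y div 2 \<and> x mod 2 = y mod 2 then complex_of_real (1 / sqrt (2 ^ Suc n)) else 0)"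
      by (simp_all only: ebits_vec_def power_one_right)
    have prod: "complex_of_real (1 / sqrt (2 ^ n)) * complex_of_real (1 / sqrt 2) = complex_of_real (1 / sqrt (2 ^ Suc n))"
      unfolding of_real_mult[symmetric] by (simp add: real_sqrt_mult)
    show ?thesis
      unfolding vec by (simp only: prod[symmetric] if_True if_False mult_zero_left mult_zero_right simp_thms split: if_split) blast
  qed
  hence "rank_one ((2 ^ n * 2) * (2 ^ n * 2)) (\<lambda>I. ebits_vec n (bleft (2 ^ n) 2 2 I) * ebits_vec 1 (bright (2 ^ n) 2 2 I)) =
      rank_one ((2 ^ n * 2) * (2 ^ n * 2)) (ebits_vec (Suc n))"
    by (intro eq_matI) (simp_all only: rank_one_def index_mat split dim_row_mat dim_col_mat)
  thus ?case
    unfolding bip_power.simps Suc unfolding ebit bip_tensor_rank_one by (simp only: power_Suc mult.commute[of 2])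
qed

lemma deficit_density:
  assumes "\<omega> \<in> density_ops (2 ^ r * 2 ^ r)"
  shows "deficit r \<omega> = 1 - Re (qform (2 ^ r * 2 ^ r) \<omega> (ebits_vec r))"
  using assms by (simp add: deficit_def density_ops_def)

lemma trace_distance_ebits:
  assumes "\<omega> \<in> density_ops (2 ^ r * 2 ^ r)"
  shows "1/2 * trace_norm (\<omega> - bip_power 2 2 ebit r) \<le> sqrt (deficit r \<omega>)"
    and "deficit r \<omega> \<le> trace_norm (\<omega> - bip_power 2 2 ebit r)"
    and "trace_norm (\<omega> - bip_power 2 2 ebit r) \<ge> 0"
proof -
  have \<omega>: "psd (2 ^ r * 2 ^ r) \<omega>" "mat_trace \<omega> = 1" using assms by (simp_all add: density_ops_def)
  show "1/2 * trace_norm (\<omega> - bip_power 2 2 ebit r) \<le> sqrt (deficit r \<omega>)"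
    unfolding deficit_density[OF assms] ebit_power by (rule trace_norm_pure_le[OF \<omega> ebits_vec_norm])
  show "deficit r \<omega> \<le> trace_norm (\<omega> - bip_power 2 2 ebit r)"
    unfolding deficit_density[OF assms] ebit_power by (rule fidelity_ge[OF \<omega>(1) ebits_vec_norm])
  show "trace_norm (\<omega> - bip_power 2 2 ebit r) \<ge> 0"
    unfolding ebit_power using \<omega>(1) rank_one_psd by (intro trace_norm_nonneg hermitian_diff psd_hermitian)
qed

lemma locc_density:
  assumes "locc a b a' b' \<Lambda>" "\<rho> \<in> density_ops (a * b)"
  shows "\<Lambda> \<rho> \<in> density_ops (a' * b')"
  using locc_psd[OF assms(1)] locc_trace[OF assms(1)] assms(2)
  by (simp add: density_ops_def psd_iff)

text \<open>Identifies the probability of no error in a block with its fidelity with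
  \<open>K\<close> ebits, the quantity that continuity controls.\<close>

lemma error_prob_zero: "error_prob K \<tau> (0, 0) = Re (qform (2 ^ K * 2 ^ K) \<tau> (ebits_vec K))"
proof -
  define s where "s = complex_of_real (sqrt (2 ^ K))"
  have "pauli_vec K (0, 0) I = s * ebits_vec K I" for I
    by (simp add: pauli_vec_def pauli_def ebits_vec_def s_def walsh_commute[of K 0] flip: of_real_mult)
  hence "qform (2 ^ K * 2 ^ K) \<tau> (pauli_vec K (0, 0)) =
    (cnj s * s) * qform (2 ^ K * 2 ^ K) \<tau> (ebits_vec K)"
    by (simp add: qform_def sum_distrib_left mult_ac)
  also have "cnj s * s = complex_of_real (2 ^ K)" by (simp add: s_def flip: of_real_mult)
  finally show ?thesis by (simp add: error_prob_def)
qed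

subsection \<open>Continuity\<close>

lemma bip_power_tendsto:
  assumes "\<And>i j. i < a * b \<Longrightarrow> j < a * b \<Longrightarrow> (\<lambda>l. \<sigma> l $$ (i, j)) \<longlonglongrightarrow> \<rho> $$ (i, j)"
    and "I < a ^ n * b ^ n" "J < a ^ n * b ^ n"
  shows "(\<lambda>l. bip_power a b (\<sigma> l) n $$ (I, J)) \<longlonglongrightarrow> bip_power a b \<rho> n $$ (I, J)"
  using assms(2,3)
proof (induction n arbitrary: I J)
  case (Suc n)
  have IJ: "I < (a ^ n * a) * (b ^ n * b)" "J < (a ^ n * a) * (b ^ n * b)"
    using Suc.prems by (simp_all add: mult_ac)
  have "(\<lambda>l. bip_power a b (\<sigma> l) n $$ (bleft (b ^ n) a b I, bleft (b ^ n) a b J) *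
        \<sigma> l $$ (bright (b ^ n) a b I, bright (b ^ n) a b J)) \<longlonglongrightarrow>
      bip_power a b \<rho> n $$ (bleft (b ^ n) a b I, bleft (b ^ n) a b J) *
        \<rho> $$ (bright (b ^ n) a b I, bright (b ^ n) a b J)"
    using IJ by (intro tendsto_mult Suc.IH assms(1) bleft_less bright_less)
  thus ?case using IJ by (simp add: bip_tensor_eq)
qed simp

text \<open>\<open>linear_map\<close> contains no continuity; it follows from this expansion in
  matrix units, which makes every entry of the image a fixed linear combination of the entries of
  \<open>X\<close>.\<close>

lemma linear_map_index:
  assumes \<Phi>: "linear_map n m \<Phi>" and X: "X \<in> carrier_mat n n" and ij: "i < m" "j < m"
  shows "\<Phi> X $$ (i, j) = (\<Sum>k<n * n. X $$ (k div n, k mod n) *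
    \<Phi> (mat n n (\<lambda>(p, q). if p = k div n \<and> q = k mod n then 1 else 0)) $$ (i, j))"
proof -
  define E where "E k = mat n n (\<lambda>(p, q). if p = k div n \<and> q = k mod n then 1 else (0::complex))" for k
  have E: "E k \<in> carrier_mat n n" for k by (simp add: E_def)
  have "X = mat_sum n (n * n) (\<lambda>k. X $$ (k div n, k mod n) \<cdot>\<^sub>m E k)"
  proof (rule eq_matI, goal_cases)
    case (1 p q)
    hence pq: "p < n" "q < n" by (simp_all add: mat_sum_def)
    have "(\<Sum>k<n * n. (X $$ (k div n, k mod n) \<cdot>\<^sub>m E k) $$ (p, q)) =
      (\<Sum>k<n * n. if k = p * n + q then X $$ (p, q) else 0)"
    proof (intro sum.cong refl)
      fix k assume "k \<in> {..<n * n}"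
      have "p = k div n \<and> q = k mod n \<longleftrightarrow> k = p * n + q" using pq by (metis div_mult_mod_eq index_div index_mod)
      thus "(X $$ (k div n, k mod n) \<cdot>\<^sub>m E k) $$ (p, q) = (if k = p * n + q then X $$ (p, q) else 0)"
        using pq by (auto simp: E_def)
    qed
    thus ?case using pq by (simp add: mat_sum_def index_less)
  qed (use X in \<open>simp_all add: mat_sum_def\<close>)
  hence "\<Phi> X = mat_sum m (n * n) (\<lambda>k. \<Phi> (X $$ (k div n, k mod n) \<cdot>\<^sub>m E k))"
    using linear_map_mat_sum[OF \<Phi>, of "n * n" "\<lambda>k. X $$ (k div n, k mod n) \<cdot>\<^sub>m E k"] E by simp
  hence "\<Phi> X $$ (i, j) = (\<Sum>k<n * n. \<Phi> (X $$ (k div n, k mod n) \<cdot>\<^sub>m E k) $$ (i, j))"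
    using ij by (simp add: mat_sum_def)
  also have "\<dots> = (\<Sum>k<n * n. X $$ (k div n, k mod n) * \<Phi> (E k) $$ (i, j))"
  proof (rule sum.cong[OF refl])
    fix k
    have "\<Phi> (E k) \<in> carrier_mat m m" by (rule linear_map_carrier[OF \<Phi> E])
    thus "\<Phi> (X $$ (k div n, k mod n) \<cdot>\<^sub>m E k) $$ (i, j) = X $$ (k div n, k mod n) * \<Phi> (E k) $$ (i, j)"
      using ij by (simp add: linear_map_smult[OF \<Phi> E])
  qed
  finally show ?thesis unfolding E_def .
qed

text \<open>Otherwise there are violating states in the balls of radius \<open>1 / (l + 1)\<close>;
  they converge to \<rho> entrywise, and the fidelity is continuous. The radius depends on
  \<open>k\<close> and \<open>\<Phi>\<close>, which are therefore fixed before it.\<close>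

lemma state_ball_uniform:
  assumes \<rho>: "\<rho> \<in> density_ops (d * d)" and \<Phi>: "linear_map (d ^ k * d ^ k) m \<Phi>" and "\<epsilon> > 0"
  shows "\<exists>r>0. \<forall>\<sigma>\<in>state_ball d r \<rho>.
    Re (qform m (\<Phi> (bip_power d d \<rho> k)) v) - \<epsilon> < Re (qform m (\<Phi> (bip_power d d \<sigma> k)) v)"
proof (rule ccontr)
  let ?F = "\<lambda>\<sigma>. Re (qform m (\<Phi> (bip_power d d \<sigma> k)) v)"
  assume "\<not> ?thesis"
  hence "\<exists>\<sigma>\<in>state_ball d (inverse (real (Suc l))) \<rho>. ?F \<sigma> \<le> ?F \<rho> - \<epsilon>" for l
    by (metis inverse_positive_iff_positive not_le of_nat_0_less_iff zero_less_Suc)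
  then obtain \<sigma> where \<sigma>: "\<And>l. \<sigma> l \<in> state_ball d (inverse (real (Suc l))) \<rho>" "\<And>l. ?F (\<sigma> l) \<le> ?F \<rho> - \<epsilon>"
    by metis
  have entry: "(\<lambda>l. \<sigma> l $$ (i, j)) \<longlonglongrightarrow> \<rho> $$ (i, j)" if ij: "i < d * d" "j < d * d" for i j
  proof -
    have "dist (\<sigma> l $$ (i, j)) (\<rho> $$ (i, j)) \<le> 2 * inverse (real (Suc l))" for l
    proof -
      have d: "\<sigma> l \<in> density_ops (d * d)" "1/2 * trace_norm (\<sigma> l - \<rho>) < inverse (real (Suc l))"
        using \<sigma>(1)[of l] by (simp_all add: state_ball_def)
      have h: "hermitian (d * d) (\<sigma> l)" "hermitian (d * d) \<rho>"
        using d(1) \<rho> by (auto simp: density_ops_def intro: psd_hermitian)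
      have "cmod ((\<sigma> l - \<rho>) $$ (i, j)) \<le> trace_norm (\<sigma> l - \<rho>)"
        by (rule cmod_le_trace_norm[OF hermitian_diff[OF h] ij])
      moreover have "\<rho> \<in> carrier_mat (d * d) (d * d)" using \<rho> by (simp add: density_ops_def psd_iff)
      ultimately show ?thesis using d(2) ij by (simp add: dist_norm)
    qed
    hence le: "\<And>l. dist (\<sigma> l $$ (i, j)) (\<rho> $$ (i, j)) \<le> 2 * inverse (real (Suc l))" .
    have lim: "(\<lambda>l. 2 * inverse (real (Suc l))) \<longlonglongrightarrow> 0"
      using tendsto_mult[OF tendsto_const LIMSEQ_inverse_real_of_nat, of 2] by simp
    have "(\<lambda>l. dist (\<sigma> l $$ (i, j)) (\<rho> $$ (i, j))) \<longlonglongrightarrow> 0"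
      by (rule tendsto_sandwich[OF always_eventually always_eventually tendsto_const lim]) (simp_all only: le zero_le_dist simp_thms)
    thus ?thesis by (rule tendsto_dist_iff[THEN iffD2])
  qed
  have "(\<lambda>l. \<Phi> (bip_power d d (\<sigma> l) k) $$ (i, j)) \<longlonglongrightarrow> \<Phi> (bip_power d d \<rho> k) $$ (i, j)" if "i < m" "j < m" for i j
    unfolding linear_map_index[OF \<Phi> bip_power_carrier that]
    by (intro tendsto_sum tendsto_mult tendsto_const bip_power_tendsto[OF entry])
      (auto intro: div_less_index mod_less_index)
  hence "(\<lambda>l. ?F (\<sigma> l)) \<longlonglongrightarrow> ?F \<rho>"
    unfolding qform_def by (intro tendsto_Re tendsto_sum tendsto_mult tendsto_const) auto
  moreover have "\<exists>M. \<forall>l\<ge>M. ?F (\<sigma> l) \<le> ?F \<rho> - \<epsilon>" using \<sigma>(2) by blast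
  ultimately have "?F \<rho> \<le> ?F \<rho> - \<epsilon>" by (rule LIMSEQ_le_const2)
  with \<open>\<epsilon> > 0\<close> show False by simp
qed

subsection \<open>The protocol\<close>

text \<open>Three rounds remove a factor 2, since \<open>2 * 27 \<le> 64\<close>; the one additional
  round makes the inequality strict.\<close>

lemma power_bound:
  assumes "3 * t + 1 \<le> (d :: nat)"
  shows "2 ^ t * 3 ^ d < (4 ^ d :: nat)"
proof -
  obtain s where s: "d = 3 * t + s" "s \<ge> 1" using assms by (metis add_le_imp_le_left le_add_diff_inverse le_add1 order_trans)
  have "(2::nat) ^ t * 27 ^ t \<le> 64 ^ t" unfolding power_mult_distrib[symmetric] by (rule power_mono) simp_all
  moreover have "(3::nat) ^ s < 4 ^ s" using s(2) by (intro power_strict_mono) simp_all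
  ultimately have "(2 ^ t * 27 ^ t) * (3::nat) ^ s < 64 ^ t * 4 ^ s"
    by (intro mult_le_less_imp_less) simp_all
  thus ?thesis by (simp add: s(1) power_add power_mult mult.assoc)
qed

lemma real_num_pairs:
  assumes "R \<ge> 0"
  shows "R * real n \<le> real (num_pairs R n)" "real (num_pairs R n) \<le> R * real n + 1"
proof -
  have "0 \<le> R * real n" using assms by simp
  thus "R * real n \<le> real (num_pairs R n)" "real (num_pairs R n) \<le> R * real n + 1"
    unfolding num_pairs_def by linarith+
qed

lemma block_rate:
  assumes R: "0 < R" "R < R1" and g: "g > 0" "12 / real g \<le> (R1 - R) / (3 * R1)"
    and k: "k > 0" "6 \<le> (R1 - R) / (3 * R1) * (R1 * real k)"
    and K: "R1 * real k \<le> real K"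
    and m: "3 * (R * real k + 2) / ((R1 - R) * real k) \<le> real m" and n: "n < k * (m + 1)"
  shows "num_pairs R n + (3 * (2 * m + 4 * (K * (m div g))) + 1) \<le> K * m"
proof -
  define \<eta> where "\<eta> = (R1 - R) / (3 * R1)"
  have \<eta>: "\<eta> > 0" "1 - 2 * \<eta> > 0" "(1 - 2 * \<eta>) * R1 = R + (R1 - R) / 3"
    using R by (simp_all add: \<eta>_def field_simps)
  have "real (m div g * g) \<le> real m" by (simp only: of_nat_le_iff div_times_less_eq_dividend)
  hence "real (m div g) \<le> real m / real g" using g(1) by (simp add: pos_le_divide_eq)
  hence "12 * real K * real (m div g) \<le> real K * real m * (12 / real g)"
    using g(1) by (simp add: field_simps mult_left_mono)
  also have "\<dots> \<le> real K * real m * \<eta>" using g(2) unfolding \<eta>_def[symmetric] by (rule mult_left_mono) simp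
  finally have 1: "12 * real K * real (m div g) \<le> \<eta> * (real K * real m)" by (simp add: mult_ac)
  have "6 \<le> \<eta> * real K" using k(2) K \<eta>(1) unfolding \<eta>_def[symmetric]
    by (meson mult_left_mono less_imp_le order_trans)
  hence "6 * real m \<le> \<eta> * real K * real m" by (rule mult_right_mono) simp
  hence 2: "6 * real m \<le> \<eta> * (real K * real m)" by (simp add: mult_ac)
  have "real n \<le> real k * (real m + 1)"
  proof -
    have "real n \<le> real (k * (m + 1))" using n by (simp only: of_nat_le_iff less_imp_le)
    thus ?thesis by (simp add: algebra_simps)
  qed
  hence "R * real n \<le> R * (real k * (real m + 1))" using R(1) by (intro mult_left_mono) auto
  hence 3: "real (num_pairs R n) \<le> R * real k * real m + R * real k + 1"
    using real_num_pairs(2)[of R n] R(1) by (simp add: algebra_simps)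
  have 4: "R * real k + 2 \<le> (R1 - R) / 3 * (real k * real m)"
    using m R k(1) by (simp add: field_simps)
  have "(R + (R1 - R) / 3) * (real k * real m) = (1 - 2 * \<eta>) * (R1 * real k * real m)"
    unfolding \<eta>(3)[symmetric] by (simp add: mult_ac)
  also have "\<dots> \<le> (1 - 2 * \<eta>) * (real K * real m)"
    using K \<eta>(2) by (intro mult_left_mono mult_right_mono) auto
  finally have 5: "R * real k * real m + (R1 - R) / 3 * (real k * real m) + 2 * (\<eta> * (real K * real m)) \<le> real K * real m"
    by (simp add: algebra_simps)
  have "real (num_pairs R n + (3 * (2 * m + 4 * (K * (m div g))) + 1)) =
    real (num_pairs R n) + 6 * real m + 12 * real K * real (m div g) + 1" by simp
  also have "\<dots> \<le> real K * real m" using 1 2 3 4 5 by linarith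
  finally show ?thesis by (simp only: of_nat_le_iff flip: of_nat_mult)
qed

text \<open>The \<open>n - k * m\<close> leftover copies are discarded; their trace is 1, so no
  factor remains.\<close>

lemma grouped_protocol:
  assumes \<Lambda>0: "locc (d ^ k) (d ^ k) (2 ^ K) (2 ^ K) \<Lambda>0"
    and D: "locc (2 ^ (K * m)) (2 ^ (K * m)) a b D" and n: "k * m \<le> n"
  shows "\<exists>\<Lambda>. locc (d ^ n) (d ^ n) a b \<Lambda> \<and> (\<forall>\<sigma>\<in>density_ops (d * d).
    \<Lambda> (bip_power d d \<sigma> n) = D (bip_power (2 ^ K) (2 ^ K) (\<Lambda>0 (bip_power d d \<sigma> k)) m))"
proof -
  define l where "l = n - k * m"
  have nl: "n = k * m + l" using n by (simp add: l_def)
  obtain N1 where N1: "locc (d ^ n) (d ^ n) (d ^ (k * m)) (d ^ (k * m)) N1"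
    "\<And>X Y. X \<in> carrier_mat (d ^ (k * m) * d ^ (k * m)) (d ^ (k * m) * d ^ (k * m)) \<Longrightarrow>
      Y \<in> carrier_mat (d ^ l * d ^ l) (d ^ l * d ^ l) \<Longrightarrow>
      N1 (bip_tensor (d ^ (k * m)) (d ^ (k * m)) (d ^ l) (d ^ l) X Y) = mat_trace Y \<cdot>\<^sub>m X"
    using locc_discard[of "d ^ (k * m)" "d ^ l" "d ^ (k * m)" "d ^ l"] unfolding nl power_add by blast
  obtain N2 where N2: "locc (d ^ (k * m)) (d ^ (k * m)) (2 ^ (K * m)) (2 ^ (K * m)) N2"
    "\<And>X. X \<in> carrier_mat (d ^ k * d ^ k) (d ^ k * d ^ k) \<Longrightarrow>
      N2 (bip_power (d ^ k) (d ^ k) X m) = bip_power (2 ^ K) (2 ^ K) (\<Lambda>0 X) m"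
    using locc_power[OF \<Lambda>0, of m] unfolding power_mult[symmetric] by blast
  obtain M where M: "locc (d ^ n) (d ^ n) (2 ^ (K * m)) (2 ^ (K * m)) M"
    "\<And>X. X \<in> carrier_mat (d ^ n * d ^ n) (d ^ n * d ^ n) \<Longrightarrow> M X = N2 (N1 X)"
    using locc_compose[OF N1(1) N2(1)] by blast
  obtain \<Lambda> where \<Lambda>: "locc (d ^ n) (d ^ n) a b \<Lambda>"
    "\<And>X. X \<in> carrier_mat (d ^ n * d ^ n) (d ^ n * d ^ n) \<Longrightarrow> \<Lambda> X = D (M X)"
    using locc_compose[OF M(1) D] by blast
  have "\<Lambda> (bip_power d d \<sigma> n) = D (bip_power (2 ^ K) (2 ^ K) (\<Lambda>0 (bip_power d d \<sigma> k)) m)"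
    if \<sigma>: "\<sigma> \<in> density_ops (d * d)" for \<sigma>
  proof -
    have "N1 (bip_power d d \<sigma> n) = mat_trace (bip_power d d \<sigma> l) \<cdot>\<^sub>m bip_power d d \<sigma> (k * m)"
      unfolding nl bip_power_add by (rule N1(2)) simp_all
    also have "mat_trace (bip_power d d \<sigma> l) = 1"
      using bip_power_density[OF \<sigma>] by (simp add: density_ops_def)
    also have "1 \<cdot>\<^sub>m bip_power d d \<sigma> (k * m) = bip_power d d \<sigma> (k * m)"
      by (intro eq_matI) simp_all
    finally show ?thesis
      by (simp only: \<Lambda>(2) M(2) bip_power_carrier) (simp add: bip_power_mult N2(2))
  qed
  with \<Lambda>(1) show ?thesis by blast
qed

lemma div_filterlim: "k > 0 \<Longrightarrow> filterlim (\<lambda>n. n div k) at_top (at_top :: nat filter)"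
  unfolding filterlim_at_top eventually_at_top_linorder
  by (metis div_le_mono nonzero_mult_div_cancel_right not_gr_zero)

theorem lemma2:
  fixes d :: nat and \<rho> :: "complex mat" and R :: real
  assumes "d \<ge> 2"
    and "\<rho> \<in> density_ops (d * d)"
    and "distillable_entanglement d \<rho> > 0"
    and "0 < R"
    and "ereal R < distillable_entanglement d \<rho>"
  shows "\<exists>r>0. \<exists>\<Lambda>. locc_sequence d R \<Lambda> \<and>
    (\<lambda>n. SUP \<sigma> \<in> state_ball d r \<rho>. ereal (distill_error d R n (\<Lambda> n) \<sigma>)) \<longlonglongrightarrow> 0"
proof -
  note \<rho> = assms(2)
  obtain R1 where R1: "achievable_rate d \<rho> R1" "R < R1"
    using assms(5) unfolding distillable_entanglement_def less_SUP_iff by auto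
  then obtain \<Lambda>0 where \<Lambda>0: "locc_sequence d R1 \<Lambda>0"
    "(\<lambda>n. distill_error d R1 n (\<Lambda>0 n) \<rho>) \<longlonglongrightarrow> 0"
    unfolding achievable_rate_def by blast
  \<comment> \<open>The fraction of the ebits that each of the two main costs may consume.\<close>
  define \<eta> where "\<eta> = (R1 - R) / (3 * R1)"
  have \<eta>: "\<eta> > 0" using R1(2) assms(4) by (simp add: \<eta>_def)
  obtain g :: nat where g: "12 / \<eta> < real g" using reals_Archimedean2 by blast
  have "0 < 12 / \<eta>" using \<eta> by simp
  hence g0: "g > 0" using g by (metis less_trans of_nat_0_less_iff)
  have g12: "12 / real g \<le> \<eta>" using g \<eta> g0 by (simp add: field_simps)
  \<comment> \<open>The block infidelity that \<open>block_distillation\<close> tolerates for this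
    \<open>g\<close>.\<close>
  define \<epsilon> :: real where "\<epsilon> = 1 / 4 ^ g"
  have \<epsilon>: "\<epsilon> > 0" by (simp add: \<epsilon>_def)
  \<comment> \<open>An error below \<open>\<epsilon> / 4\<close> is a trace norm below
    \<open>\<epsilon> / 2\<close>, hence an infidelity below \<open>\<epsilon> / 2\<close> at
    \<rho>. The other half of \<open>\<epsilon>\<close> is left for the passage to \<sigma>.\<close>
  have "eventually (\<lambda>n. distill_error d R1 n (\<Lambda>0 n) \<rho> < \<epsilon> / 4) sequentially"
    using \<Lambda>0(2) \<epsilon> by (intro order_tendstoD(2)) auto
  moreover have "eventually (\<lambda>n. 6 / (\<eta> * R1) \<le> real n) sequentially"
    by (rule eventually_ge_at_top[THEN eventually_mono[OF _], of "nat \<lceil>6 / (\<eta> * R1)\<rceil>"]) linarith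
  ultimately have "eventually (\<lambda>n. distill_error d R1 n (\<Lambda>0 n) \<rho> < \<epsilon> / 4 \<and> 6 / (\<eta> * R1) \<le> real n \<and> n > 0) sequentially"
    using eventually_gt_at_top[of 0] by eventually_elim simp
  then obtain k where k: "distill_error d R1 k (\<Lambda>0 k) \<rho> < \<epsilon> / 4" "6 / (\<eta> * R1) \<le> real k" "k > 0"
    using eventually_happens[of _ sequentially] by auto
  have "R1 > 0" using R1(2) assms(4) by simp
  hence k6: "6 \<le> \<eta> * (R1 * real k)" using k(2) \<eta> by (simp add: field_simps)
  define K where "K = num_pairs R1 k"
  have K: "R1 * real k \<le> real K" using \<open>R1 > 0\<close> by (simp add: K_def real_num_pairs)
  define T where "T \<sigma> = \<Lambda>0 k (bip_power d d \<sigma> k)" for \<sigma>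
  have lk: "locc (d ^ k) (d ^ k) (2 ^ K) (2 ^ K) (\<Lambda>0 k)" using \<Lambda>0(1) by (simp add: locc_sequence_def K_def)
  have T: "T \<sigma> \<in> density_ops (2 ^ K * 2 ^ K)" if "\<sigma> \<in> density_ops (d * d)" for \<sigma>
    unfolding T_def by (rule locc_density[OF lk bip_power_density[OF that]])
  have "deficit K (T \<rho>) \<le> trace_norm (T \<rho> - bip_power 2 2 ebit K)"
    by (rule trace_distance_ebits(2)[OF T[OF \<rho>]])
  also have "\<dots> = 2 * distill_error d R1 k (\<Lambda>0 k) \<rho>" by (simp add: distill_error_def T_def K_def)
  finally have "1 - \<epsilon> / 2 < Re (qform (2 ^ K * 2 ^ K) (T \<rho>) (ebits_vec K))"
    using k(1) by (simp add: deficit_density[OF T[OF \<rho>]])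
  moreover obtain r where r: "r > 0" "\<And>\<sigma>. \<sigma> \<in> state_ball d r \<rho> \<Longrightarrow>
      Re (qform (2 ^ K * 2 ^ K) (T \<rho>) (ebits_vec K)) - \<epsilon> / 2 < Re (qform (2 ^ K * 2 ^ K) (T \<sigma>) (ebits_vec K))"
    using state_ball_uniform[OF \<rho> locc_linear[OF lk], of "\<epsilon> / 2" "ebits_vec K"] \<epsilon> unfolding T_def by auto
  ultimately have ball: "error_prob K (T \<sigma>) (0, 0) \<ge> 1 - 1 / 4 ^ g" if "\<sigma> \<in> state_ball d r \<rho>" for \<sigma>
    using r(2)[OF that] by (simp add: error_prob_zero \<epsilon>_def)
  have dens: "\<sigma> \<in> density_ops (d * d)" if "\<sigma> \<in> state_ball d r \<rho>" for \<sigma>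
    using that by (simp add: state_ball_def)
  \<comment> \<open>Enough ebits are available to correct the errors and still leave
    \<open>num_pairs R n\<close>.\<close>
  define good where "good n \<longleftrightarrow> num_pairs R n + (3 * (2 * (n div k) + 4 * (K * (n div k div g))) + 1) \<le> K * (n div k)" for n
  have "\<exists>\<Lambda>. locc (d ^ n) (d ^ n) (2 ^ num_pairs R n) (2 ^ num_pairs R n) \<Lambda> \<and>
    (good n \<longrightarrow> (\<forall>\<sigma>\<in>state_ball d r \<rho>. deficit (num_pairs R n) (\<Lambda> (bip_power d d \<sigma> n)) \<le> (1 / 2) ^ (n div k)))" for n
  proof (cases "good n")
    \<comment> \<open>This concerns finitely many \<open>n\<close> only, but
      \<open>locc_sequence\<close> asks for a map of the right size at every
      \<open>n\<close>.\<close>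
    case False
    thus ?thesis using locc_exists[of "2 ^ num_pairs R n" "2 ^ num_pairs R n"] by simp
  next
    case True
    define m where "m = n div k"
    define e where "e = K * m - num_pairs R n"
    have e: "num_pairs R n + e = K * m" "3 * (2 * m + 4 * (K * (m div g))) + 1 \<le> e"
      using True by (simp_all add: good_def e_def m_def)
    have "4 ^ m * 16 ^ (K * (m div g)) * 3 ^ e = 2 ^ (2 * m + 4 * (K * (m div g))) * (3::nat) ^ e"
      by (simp add: power_add power_mult)
    also have "\<dots> < 4 ^ e" by (rule power_bound[OF e(2)])
    finally obtain D where D: "locc (2 ^ (K * m)) (2 ^ (K * m)) (2 ^ num_pairs R n) (2 ^ num_pairs R n) D"
      "\<And>\<tau>. \<tau> \<in> density_ops (2 ^ K * 2 ^ K) \<Longrightarrow> error_prob K \<tau> (0, 0) \<ge> 1 - 1 / 4 ^ g \<Longrightarrow>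
        deficit (num_pairs R n) (D (bip_power (2 ^ K) (2 ^ K) \<tau> m)) \<le> (1 / 2) ^ m"
      using block_distillation[OF g0 e(1)] by blast
    have "k * m \<le> n" by (simp add: m_def)
    from grouped_protocol[OF lk D(1) this] obtain \<Lambda>
      where "locc (d ^ n) (d ^ n) (2 ^ num_pairs R n) (2 ^ num_pairs R n) \<Lambda>"
        "\<And>\<sigma>. \<sigma> \<in> density_ops (d * d) \<Longrightarrow> \<Lambda> (bip_power d d \<sigma> n) = D (bip_power (2 ^ K) (2 ^ K) (T \<sigma>) m)"
      unfolding T_def by blast
    thus ?thesis using D(2)[OF T[OF dens] ball] dens unfolding m_def by metis
  qed
  then obtain \<Lambda> where \<Lambda>: "\<And>n. locc (d ^ n) (d ^ n) (2 ^ num_pairs R n) (2 ^ num_pairs R n) (\<Lambda> n)"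
    "\<And>n \<sigma>. good n \<Longrightarrow> \<sigma> \<in> state_ball d r \<rho> \<Longrightarrow>
      deficit (num_pairs R n) (\<Lambda> n (bip_power d d \<sigma> n)) \<le> (1 / 2) ^ (n div k)"
    by metis
  have dn: "\<Lambda> n (bip_power d d \<sigma> n) \<in> density_ops (2 ^ num_pairs R n * 2 ^ num_pairs R n)"
    if "\<sigma> \<in> state_ball d r \<rho>" for n \<sigma>
    by (rule locc_density[OF \<Lambda>(1) bip_power_density[OF dens[OF that]]])
  have err: "distill_error d R n (\<Lambda> n) \<sigma> \<le> sqrt ((1 / 2) ^ (n div k))"
    if "good n" "\<sigma> \<in> state_ball d r \<rho>" for n \<sigma>
    unfolding distill_error_def
    using trace_distance_ebits(1)[OF dn[OF that(2), of n]] real_sqrt_le_mono[OF \<Lambda>(2)[OF that]] by linarith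
  have err0: "0 \<le> distill_error d R n (\<Lambda> n) \<sigma>" if "\<sigma> \<in> state_ball d r \<rho>" for n \<sigma>
    unfolding distill_error_def using trace_distance_ebits(3)[OF dn[OF that, of n]] by simp
  have "\<rho> - \<rho> = 0\<^sub>m (d * d) (d * d)"
    using \<rho> by (intro eq_matI) (auto simp: density_ops_def psd_iff)
  hence \<rho>ball: "\<rho> \<in> state_ball d r \<rho>" using \<rho> r(1) by (simp add: state_ball_def)
  have div: "filterlim (\<lambda>n. n div k) at_top sequentially" using k(3) by (rule div_filterlim)
  \<comment> \<open>The number of blocks from which on the constant overhead fits into the last
    third of the gap.\<close>
  define m0 where "m0 = nat \<lceil>3 * (R * real k + 2) / ((R1 - R) * real k)\<rceil>"
  have "eventually (\<lambda>n. m0 \<le> n div k) sequentially"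
    using div by (simp add: filterlim_at_top)
  hence good: "eventually good sequentially"
  proof eventually_elim
    case (elim n)
    have "3 * (R * real k + 2) / ((R1 - R) * real k) \<le> real (n div k)"
      using elim unfolding m0_def by linarith
    moreover have "n < k * (n div k + 1)"
      using k(3) by (simp add: dividend_less_times_div algebra_simps)
    ultimately show "good n"
      unfolding good_def
      by (intro block_rate[OF assms(4) R1(2) g0 g12[unfolded \<eta>_def] k(3) k6[unfolded \<eta>_def] K])
  qed
  have "(\<lambda>n. (1 / 2 :: real) ^ (n div k)) \<longlonglongrightarrow> 0"
    by (rule filterlim_compose[OF LIMSEQ_power_zero div]) simp
  hence "(\<lambda>n. sqrt ((1 / 2) ^ (n div k))) \<longlonglongrightarrow> sqrt 0" by (rule tendsto_real_sqrt)
  hence lim: "(\<lambda>n. ereal (sqrt ((1 / 2) ^ (n div k)))) \<longlonglongrightarrow> 0"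
    by (simp add: zero_ereal_def)
  have "(\<lambda>n. SUP \<sigma>\<in>state_ball d r \<rho>. ereal (distill_error d R n (\<Lambda> n) \<sigma>)) \<longlonglongrightarrow> 0"
  proof (rule tendsto_sandwich[OF _ _ tendsto_const lim])
    show "\<forall>\<^sub>F n in sequentially. 0 \<le> (SUP \<sigma>\<in>state_ball d r \<rho>. ereal (distill_error d R n (\<Lambda> n) \<sigma>))"
      using err0 \<rho>ball by (intro always_eventually allI SUP_upper2[of \<rho>]) auto
    show "\<forall>\<^sub>F n in sequentially. (SUP \<sigma>\<in>state_ball d r \<rho>. ereal (distill_error d R n (\<Lambda> n) \<sigma>)) \<le>
        ereal (sqrt ((1 / 2) ^ (n div k)))"
      using good by eventually_elim (intro SUP_least, simp add: err)
  qed
  moreover have "locc_sequence d R \<Lambda>" using \<Lambda>(1) by (simp add: locc_sequence_def)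
  ultimately show ?thesis using r(1) by blast
qed

end
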